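(* Let $\{y_k\}_{k\in\mathbb N\setminus\{k_1,\ldots,k_m\}}$ be a Sturm-Liouville orthogonal polynomial system (SL-OPS) with $m$ missing degrees. Its orthogonality weight $W$ has the form $$W(z)=\frac{W_{\mathrm B}(z)}{\eta(z)^2},\qquad W_{\mathrm B}(z)=\exp\left(\int^z\frac{s(x)}{p(x)}\,dx\right),$$ where $p$ is a real polynomial of degree at most $2$, $s$ is a real polynomial of degree at most $1$, $W_{\mathrm B}$ is the weight of a classical orthogonal polynomial system, and $\eta$ is a real polynomial of degree exactly $m$.
   Context: $\mathbb N=\{0,1,2,\ldots\}$. For a second-order operator $T=p(z)D_{zz}+q(z)D_z+r(z)$ with rational coefficients the associated weight is $W(z)=\frac1{p(z)}\exp\left(\int^z\frac{q(x)}{p(x)}dx\right)$, defined up to a nonzero multiplicative constant. SL-OPS: a sequence of real polynomials $y_k$, $\deg y_k=k$, $k\in\mathbb N\setminus\{k_1,\ldots,k_m\}$ (the $k_i$ distinct), is a Sturm-Liouville orthogonal polynomial system if: (i) the $y_k$ are the eigenpolynomials of a second-order operator $T$ with real rational coefficients (so $T[y_k]=\lambda_ky_k$ for each such $k$, and $T$ has no eigenpolynomial of degree $k_1,\ldots,k_m$); (ii) there is an open interval $I\subset\mathbb R$ such that (ii-a) the associated weight $W$ is positive, single-valued and integrable on $I$; (ii-b) $\int_Iz^jW(z)\,dz$ is finite for all $j\in\mathbb N$; (ii-c) $y(z)p(z)W(z)\to0$ at the endpoints of $I$ for every polynomial $y$; (iii) $\mathrm{span}\{y_k\}$ is dense in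 $L^2(I,W(z)dz)$. The weight $W$ on $I$ is the orthogonality weight of the SL-OPS. Classical orthogonal polynomial systems are, up to an affine change of variable, those of Hermite, Laguerre and Jacobi, with weights (up to a constant factor) $e^{-z^2}$ on $(-\infty,\infty)$; $z^\alpha e^{-z}$, $\alpha>-1$, on $(0,\infty)$; $(1-z)^\alpha(1+z)^\beta$, $\alpha,\beta>-1$, on $(-1,1)$. *)

theory Defs
  imports "HOL-Analysis.Analysis" "HOL-Computational_Algebra.Computational_Algebra"
    "HOL-Computational_Algebra.Field_as_Ring"
begin

text \<open>Rational functions with real coefficients are elements of \<^typ>\<open>real poly fract\<close>;
  numerator and denominator below are those of the reduced fraction, so that zeros and poles
  are genuine.\<close>

definition rat_eval :: "real poly fract \<Rightarrow> real \<Rightarrow> real" where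
  "rat_eval R x = poly (fst (quot_of_fract R)) x / poly (snd (quot_of_fract R)) x"

definition rat_zeros :: "real poly fract \<Rightarrow> real set" where
  "rat_zeros R = {x. poly (fst (quot_of_fract R)) x = 0}"

definition rat_poles :: "real poly fract \<Rightarrow> real set" where
  "rat_poles R = {x. poly (snd (quot_of_fract R)) x = 0}"

definition diff_op ::
  "real poly fract \<Rightarrow> real poly fract \<Rightarrow> real poly fract \<Rightarrow> real poly \<Rightarrow> real poly fract" where
  "diff_op p q r f =
     p * to_fract (pderiv (pderiv f)) + q * to_fract (pderiv f) + r * to_fract f"

definition eigenpoly ::
  "real poly fract \<Rightarrow> real poly fract \<Rightarrow> real poly fract \<Rightarrow> real poly \<Rightarrow> bool" where
  "eigenpoly p q r f \<longleftrightarrow> f \<noteq> 0 \<and> (\<exists>\<mu>. diff_op p q r f = to_fract (smult \<mu> f))"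

text \<open>\<open>W = (1/p) exp (\<integral> q/p)\<close> on the open interval \<open>I\<close>, up to a nonzero constant. The formula is
  imposed on every subinterval on which it makes literal sense. Zeros and poles
  of the coefficients inside \<open>I\<close> are not ruled out beforehand; at such points single-valuedness
  means that the branches on both sides fit together to one continuous function.\<close>

definition associated_weight ::
  "real poly fract \<Rightarrow> real poly fract \<Rightarrow> real set \<Rightarrow> (real \<Rightarrow> real) \<Rightarrow> bool" where
  "associated_weight p q I W \<longleftrightarrow>
     continuous_on I W \<and>
     (\<forall>u v. {u<..<v} \<subseteq> I \<and> {u<..<v} \<inter> (rat_zeros p \<union> rat_poles p \<union> rat_poles q) = {} \<longrightarrow>
        (\<exists>c Q. c \<noteq> 0 \<and>
           (\<forall>z\<in>{u<..<v}. (Q has_real_derivative rat_eval q z / rat_eval p z) (at z) \<and>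
                          W z = c * (1 / rat_eval p z * exp (Q z)))))"

definition weight_measure :: "real set \<Rightarrow> (real \<Rightarrow> real) \<Rightarrow> real measure" where
  "weight_measure I W = density lborel (\<lambda>z. ennreal (indicator I z * W z))"

text \<open>Density in the (real) space \<open>L\<^sup>2(M)\<close>, for a set of polynomials that belong to it.\<close>

definition dense_in_L2 :: "real measure \<Rightarrow> real poly set \<Rightarrow> bool" where
  "dense_in_L2 M S \<longleftrightarrow>
     (\<forall>f \<in> borel_measurable M. integrable M (\<lambda>z. (f z)\<^sup>2) \<longrightarrow>
        (\<forall>\<epsilon>>0. \<exists>g\<in>S. integrable M (\<lambda>z. (f z - poly g z)\<^sup>2) \<and>
                        (\<integral>z. (f z - poly g z)\<^sup>2 \<partial>M) < \<epsilon>))"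

text \<open>The interval is \<^term>\<open>einterval a b\<close>, possibly unbounded, the operator is
  \<open>p D\<^sub>z\<^sub>z + q D\<^sub>z + r\<close>, and \<open>K\<close> is the set of missing degrees; the values \<open>y k\<close> for \<open>k \<in> K\<close> are
  irrelevant.\<close>

definition SL_OPS ::
  "nat set \<Rightarrow> (nat \<Rightarrow> real poly) \<Rightarrow> real poly fract \<Rightarrow> real poly fract \<Rightarrow> real poly fract \<Rightarrow>
   ereal \<Rightarrow> ereal \<Rightarrow> (real \<Rightarrow> real) \<Rightarrow> bool" where
  "SL_OPS K y p q r a b W \<longleftrightarrow>
     finite K \<and>
     (\<forall>k. k \<notin> K \<longrightarrow> degree (y k) = k) \<and>
     p \<noteq> 0 \<and>
     (\<forall>k. k \<notin> K \<longrightarrow> eigenpoly p q r (y k)) \<and>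
     (\<forall>f. degree f \<in> K \<longrightarrow> \<not> eigenpoly p q r f) \<and>
     a < b \<and>
     associated_weight p q (einterval a b) W \<and>
     (\<forall>z\<in>einterval a b. W z > 0) \<and>
     set_integrable lborel (einterval a b) W \<and>
     (\<forall>j::nat. set_integrable lborel (einterval a b) (\<lambda>z. z ^ j * W z)) \<and>
     (\<forall>f. (((\<lambda>z. poly f z * rat_eval p z * W z) \<circ> real_of_ereal) \<longlongrightarrow> 0) (at_right a) \<and>
          (((\<lambda>z. poly f z * rat_eval p z * W z) \<circ> real_of_ereal) \<longlongrightarrow> 0) (at_left b)) \<and>
     dense_in_L2 (weight_measure (einterval a b) W) (module.span smult (y ` (- K)))"

text \<open>Weight and orthogonality interval of a standard classical family.\<close>

definition standard_classical_weight :: "real set \<Rightarrow> (real \<Rightarrow> real) \<Rightarrow> bool" where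
  "standard_classical_weight J w \<longleftrightarrow>
     (J = UNIV \<and> w = (\<lambda>x. exp (- x\<^sup>2))) \<or>
     (\<exists>\<alpha>>-1. J = {0<..} \<and> w = (\<lambda>x. x powr \<alpha> * exp (- x))) \<or>
     (\<exists>\<alpha>>-1. \<exists>\<beta>>-1. J = {-1<..<1} \<and> w = (\<lambda>x. (1 - x) powr \<alpha> * (1 + x) powr \<beta>))"

definition classical_weight :: "real set \<Rightarrow> (real \<Rightarrow> real) \<Rightarrow> bool" where
  "classical_weight I w \<longleftrightarrow>
     (\<exists>J w0 A B C. standard_classical_weight J w0 \<and> A \<noteq> 0 \<and> C > 0 \<and>
        I = {z. A * z + B \<in> J} \<and> (\<forall>z\<in>I. w z = C * w0 (A * z + B)))"

end

theory Submission
  imports Defs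
begin

text \<open>Write the coefficients over a common denominator, \<open>p = A/D\<close>, \<open>q = B/D\<close>, \<open>r = C/D\<close>, so that
\<open>T f = g\<close> reads \<open>A f'' + B f' + C f = D g\<close>. Let \<open>U\<close> be the largest space of complex polynomials
that \<open>T\<close> maps into itself. It contains all eigenpolynomials, hence has finite codimension, and the
whole theorem is read off from \<open>U\<close>.

\<^emph>\<open>The poles.\<close> Fix a point \<open>\<zeta>\<close> and let \<open>I\<close> be the set of orders of vanishing at \<open>\<zeta>\<close> of elements of
\<open>U\<close>; it misses only finitely many naturals. \<open>T\<close> changes the order by a constant, except for
orders that are roots of an indicial polynomial of degree at most two. If \<open>T\<close> lowers orders by
\<open>h > 0\<close>, then each residue class modulo \<open>h\<close> has a least element in \<open>I\<close>, which must be a root; so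
\<open>h \<le> 2\<close>. This makes \<open>p\<close> a polynomial and the poles of \<open>q\<close> simple, and where \<open>p(\<zeta>) \<noteq> 0\<close> the two
roots have different parity, which forces the residue of \<open>q/p\<close> to be \<open>-2c(\<zeta>)\<close> with \<open>c(\<zeta>)\<close> the number
of missing orders (\<open>local_structure\<close>). With \<open>\<eta> = \<Prod> (z - \<zeta>)^c(\<zeta>)\<close>, taken over the zeros of \<open>A\<close>, the
function \<open>Q = q + 2 p \<eta>'/\<eta>\<close> is therefore a polynomial (\<open>denominator_structure\<close>). Comparing
leading coefficients gives \<open>deg p \<le> 2\<close> and \<open>deg Q \<le> 1\<close>.

\<^emph>\<open>The weight.\<close> \<open>Y = p W \<eta>\<^sup>2\<close> satisfies the classical Pearson equation \<open>p Y' = Q Y\<close>, and \<open>Y\<close> times any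
polynomial tends to 0 at the ends of the interval. A nonzero solution has a nonzero limit at a point
where \<open>p \<noteq> 0\<close>, and it decays faster than all powers at infinity only if \<open>Q/p\<close> is not \<open>O(1/z)\<close>. So finite ends are zeros of \<open>p\<close>, and the degrees 0, 1, 2 of \<open>p\<close> leave exactly the weights
of Hermite, Laguerre and Jacobi for \<open>W \<eta>\<^sup>2 = Y/p\<close> (\<open>weight_is_classical\<close>); in particular \<open>\<eta>\<close> has no
zero in the interval.

\<^emph>\<open>The degree of \<open>\<eta>\<close>.\<close> It is the sum of the numbers \<open>c(\<zeta>)\<close>. Membership in \<open>U\<close> can be tested
locally at the zeros of \<open>A\<close> (\<open>inv_space_local\<close>), and conditions at different points are independent
by the Chinese remainder theorem, so this sum is the codimension of \<open>U\<close>
(\<open>sum_local_codimensions\<close>), which is also the number of degrees that do not occur in \<open>U\<close>. All degrees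
with an eigenpolynomial occur. Conversely \<open>T\<close> is triangular on \<open>U\<close> with respect to the degree, so a
degree of \<open>U\<close> without an eigenpolynomial would give polynomials with \<open>(T - \<mu>) f = g \<noteq> 0\<close> and
\<open>(T - \<mu>) g = 0\<close>; then \<open>p W (f' g - f g')\<close> has derivative \<open>W g\<^sup>2\<close> and limit 0 at both ends, which
is absurd (\<open>no_generalized_eigenpolynomial\<close>). So exactly the \<open>m\<close> exceptional degrees are missing.\<close>

section \<open>Counting the degrees and the orders that occur in a space of polynomials\<close>

text \<open>Choosing one element for every jump of a filtration with at most one-dimensional steps gives a basis.
Degrees and orders of vanishing are both jumps of such filtrations, so this compares their numbers.\<close>
lemma (in vector_space) card_filtration_jumps_eq_dim:
  fixes F :: "nat \<Rightarrow> 'b set"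
  assumes V: "subspace V" and F: "\<And>j. subspace (F j)" and dec: "\<And>j. F (Suc j) \<subseteq> F j"
    and top: "V \<subseteq> F 0" and bot: "V \<inter> F N \<subseteq> {0}"
    and line: "\<And>j f g. f \<in> F j \<Longrightarrow> g \<in> F j \<Longrightarrow> g \<notin> F (Suc j) \<Longrightarrow> \<exists>c. f - scale c g \<in> F (Suc j)"
  shows "card {j. j < N \<and> (\<exists>f\<in>V. f \<in> F j \<and> f \<notin> F (Suc j))} = dim V"
proof -
  define J where "J = {j. j < N \<and> (\<exists>f\<in>V. f \<in> F j \<and> f \<notin> F (Suc j))}"
  have "\<exists>B. finite B \<and> B \<subseteq> V \<inter> F i \<and> independent B \<and> V \<inter> F i \<subseteq> span B \<and> card B = card {j\<in>J. i \<le> j}"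
    if "i \<le> N" for i
    using that
  proof (induction rule: inc_induct)
    case base
    have "{j\<in>J. N \<le> j} = {}" by (auto simp: J_def)
    then have "card {j\<in>J. N \<le> j} = 0" by (simp only: card.empty)
    with bot show ?case by (intro exI[of _ "{}"]) (auto simp: independent_empty)
  next
    case (step n)
    then obtain B where B: "finite B" "B \<subseteq> V \<inter> F (Suc n)" "independent B"
      "V \<inter> F (Suc n) \<subseteq> span B" "card B = card {j\<in>J. Suc n \<le> j}" by blast
    have fin: "finite {j\<in>J. Suc n \<le> j}" by (auto simp: J_def)
    show ?case
    proof (cases "n \<in> J")
      case False
      then have eq: "V \<inter> F n = V \<inter> F (Suc n)" using dec step.hyps by (auto simp: J_def)
      have "{j\<in>J. n \<le> j} = {j\<in>J. Suc n \<le> j}" using False by (auto simp: Suc_le_eq order_le_less)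
      with B eq show ?thesis by metis
    next
      case True
      then obtain b where b: "b \<in> V" "b \<in> F n" "b \<notin> F (Suc n)" by (auto simp: J_def)
      have "span B \<subseteq> F (Suc n)" using span_minimal[OF _ F] B(2) by auto
      with b have nb: "b \<notin> span B" by auto
      have ins: "{j\<in>J. n \<le> j} = insert n {j\<in>J. Suc n \<le> j}"
        using True by auto
      have "V \<inter> F n \<subseteq> span (insert b B)"
      proof
        fix f assume f: "f \<in> V \<inter> F n"
        then obtain c where "f - scale c b \<in> F (Suc n)" using line b by blast
        moreover have "f - scale c b \<in> V"
          using f b V by (auto intro!: subspace_diff subspace_scale)
        ultimately have "f - scale c b \<in> span B" using B by blast
        then show "f \<in> span (insert b B)" by (auto simp: span_insert)
      qed
      moreover have "independent (insert b B)" using nb B by (simp add: independent_insertI)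
      moreover have "card (insert b B) = card {j\<in>J. n \<le> j}"
        unfolding ins using B nb fin span_base by (subst card_insert_disjoint) auto
      moreover have "insert b B \<subseteq> V \<inter> F n" using B(2) b dec[of n] by auto
      ultimately show ?thesis using B(1) by (intro exI[of _ "insert b B"]) auto
    qed
  qed
  moreover have "V \<inter> F 0 = V" "{j\<in>J. 0 \<le> j} = J" using top by auto
  ultimately obtain B where "B \<subseteq> V" "independent B" "V \<subseteq> span B" "card B = card J"
    by (metis le0)
  then show ?thesis using basis_card_eq_dim[of B V] by (simp add: J_def)
qed

definition poly_subspace :: "complex poly set \<Rightarrow> bool" where
  "poly_subspace U \<longleftrightarrow> 0 \<in> U \<and> (\<forall>f\<in>U. \<forall>g\<in>U. f + g \<in> U) \<and> (\<forall>c. \<forall>f\<in>U. smult c f \<in> U)"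

lemma poly_subspace_diff: "poly_subspace U \<Longrightarrow> f \<in> U \<Longrightarrow> g \<in> U \<Longrightarrow> f - g \<in> U"
  unfolding poly_subspace_def by (metis diff_conv_add_uminus smult_1_left smult_minus_left)

text \<open>Dividing successively by \<open>z - \<xi> 0\<close>, \<open>z - \<xi> 1\<close>, \<open>\<dots>\<close> is a filtration of the polynomials. A constant \<open>\<xi>\<close>
measures the order at one point; a \<open>\<xi>\<close> that runs through several points measures the orders at all of
them at once.\<close>
definition chain_prod :: "(nat \<Rightarrow> complex) \<Rightarrow> nat \<Rightarrow> complex poly" where
  "chain_prod \<xi> j = (\<Prod>i<j. [:- \<xi> i, 1:])"

definition chain_vals :: "(nat \<Rightarrow> complex) \<Rightarrow> complex poly set \<Rightarrow> nat set" where
  "chain_vals \<xi> U = {j. \<exists>f\<in>U. chain_prod \<xi> j dvd f \<and> \<not> chain_prod \<xi> (Suc j) dvd f}"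

definition degrees :: "complex poly set \<Rightarrow> nat set" where
  "degrees U = degree ` (U - {0})"

lemma chain_prod_nonzero [simp]: "chain_prod \<xi> j \<noteq> 0"
  by (simp add: chain_prod_def)

lemma degree_chain_prod [simp]: "degree (chain_prod \<xi> j) = j"
  unfolding chain_prod_def by (subst degree_prod_eq_sum_degree) auto

lemma chain_prod_dvd: "i \<le> j \<Longrightarrow> chain_prod \<xi> i dvd chain_prod \<xi> j"
  unfolding chain_prod_def by (rule prod_dvd_prod_subset) auto

lemma vector_space_smult: "vector_space (smult :: complex \<Rightarrow> complex poly \<Rightarrow> complex poly)"
  by unfold_locales (simp_all add: smult_add_right smult_add_left)

text \<open>Both sides count a basis: the left one for the filtration by divisibility, the right one for the
filtration by degree, which is reversed to make it decreasing.\<close>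
lemma card_chain_vals_eq_card_degrees:
  assumes U: "poly_subspace U" and deg: "\<And>f. f \<in> U \<Longrightarrow> degree f < N"
  shows "card (chain_vals \<xi> U) = card (degrees U)"
proof -
  interpret vs: vector_space "smult :: complex \<Rightarrow> complex poly \<Rightarrow> complex poly"
    by (rule vector_space_smult)
  have subU: "vs.subspace U" using U by (auto simp: vs.subspace_def poly_subspace_def)
  have "chain_vals \<xi> U \<subseteq> {..<N}"
    using deg dvd_imp_degree_le[of "chain_prod \<xi> _"]
    by (fastforce simp: chain_vals_def)
  then have 1: "chain_vals \<xi> U = {j. j < N \<and> (\<exists>f\<in>U. f \<in> {f. chain_prod \<xi> j dvd f} \<and> f \<notin> {f. chain_prod \<xi> (Suc j) dvd f})}"
    by (auto simp: chain_vals_def)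
  have c1: "card (chain_vals \<xi> U) = vs.dim U"
    unfolding 1
  proof (rule vs.card_filtration_jumps_eq_dim[OF subU, where F="\<lambda>j. {f. chain_prod \<xi> j dvd f}"])
    show "vs.subspace {f. chain_prod \<xi> j dvd f}" for j
      by (auto simp: vs.subspace_def intro: dvd_smult)
    show "{f. chain_prod \<xi> (Suc j) dvd f} \<subseteq> {f. chain_prod \<xi> j dvd f}" for j
      using chain_prod_dvd[of j "Suc j"] by (auto intro: dvd_trans)
    show "U \<subseteq> {f. chain_prod \<xi> 0 dvd f}" by (auto simp: chain_prod_def)
    show "U \<inter> {f. chain_prod \<xi> N dvd f} \<subseteq> {0}"
      using deg dvd_imp_degree_le[of "chain_prod \<xi> N"] by (fastforce)
    show "\<exists>c. f - smult c g \<in> {f. chain_prod \<xi> (Suc j) dvd f}"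
      if fg: "f \<in> {f. chain_prod \<xi> j dvd f}" "g \<in> {f. chain_prod \<xi> j dvd f}" "g \<notin> {f. chain_prod \<xi> (Suc j) dvd f}" for j f g
    proof -
      obtain u v where u: "f = chain_prod \<xi> j * u" and v: "g = chain_prod \<xi> j * v"
        using fg by (auto elim!: dvdE)
      have S: "chain_prod \<xi> (Suc j) = chain_prod \<xi> j * [:- \<xi> j, 1:]"
        by (simp add: chain_prod_def)
      have "poly v (\<xi> j) \<noteq> 0" using fg(3) unfolding S v poly_eq_0_iff_dvd by (auto simp del: mult_pCons_right)
      then have "poly (u - smult (poly u (\<xi> j) / poly v (\<xi> j)) v) (\<xi> j) = 0" by simp
      then have "chain_prod \<xi> (Suc j) dvd chain_prod \<xi> j * (u - smult (poly u (\<xi> j) / poly v (\<xi> j)) v)"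
        unfolding S poly_eq_0_iff_dvd by (auto simp del: mult_pCons_right)
      then show ?thesis unfolding u v by (auto simp: algebra_simps)
    qed
  qed
  define G where "G = (\<lambda>j. {f :: complex poly. f = 0 \<or> degree f < N - j})"
  have c2: "card {j. j < N \<and> (\<exists>f\<in>U. f \<in> G j \<and> f \<notin> G (Suc j))} = vs.dim U"
  proof (rule vs.card_filtration_jumps_eq_dim[OF subU])
    show "vs.subspace (G j)" for j
      by (auto simp: vs.subspace_def G_def intro: degree_add_less dest: order.strict_trans1[OF degree_smult_le])
    show "G (Suc j) \<subseteq> G j" for j by (auto simp: G_def)
    show "U \<subseteq> G 0" "U \<inter> G N \<subseteq> {0}" using deg by (auto simp: G_def)
    show "\<exists>c. f - smult c g \<in> G (Suc j)" if fg: "f \<in> G j" "g \<in> G j" "g \<notin> G (Suc j)" for j f g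
    proof -
      let ?d = "N - Suc j"
      have g: "degree g = ?d" "g \<noteq> 0" and j: "j < N" and f: "degree f \<le> ?d"
        using fg by (auto simp: G_def)
      let ?h = "f - smult (coeff f ?d / lead_coeff g) g"
      have h: "degree ?h \<le> ?d" using f g by (intro degree_diff_le) (auto)
      have "coeff g ?d \<noteq> 0" using g by (metis leading_coeff_0_iff)
      then have h0: "coeff ?h ?d = 0" using g(1) by simp
      have "?h = 0 \<or> degree ?h < ?d"
      proof (cases "degree ?h = ?d")
        case True
        with h0 have "lead_coeff ?h = 0" by simp
        then have "?h = 0" by (simp only: leading_coeff_0_iff)
        then show ?thesis by blast
      qed (use h in linarith)
      then show ?thesis unfolding G_def by blast
    qed
  qed
  have "bij_betw (\<lambda>j. N - Suc j) {j. j < N \<and> (\<exists>f\<in>U. f \<in> G j \<and> f \<notin> G (Suc j))} (degrees U)"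
  proof (rule bij_betw_byWitness[where f'="\<lambda>d. N - Suc d"])
    show "(\<lambda>j. N - Suc j) ` {j. j < N \<and> (\<exists>f\<in>U. f \<in> G j \<and> f \<notin> G (Suc j))} \<subseteq> degrees U"
    proof safe
      fix j f assume "j < N" "f \<in> U" "f \<in> G j" "f \<notin> G (Suc j)"
      then have "degree f = N - Suc j" "f \<noteq> 0" by (auto simp: G_def)
      with \<open>f \<in> U\<close> show "N - Suc j \<in> degrees U" unfolding degrees_def by force
    qed
    show "(\<lambda>d. N - Suc d) ` degrees U \<subseteq> {j. j < N \<and> (\<exists>f\<in>U. f \<in> G j \<and> f \<notin> G (Suc j))}"
      unfolding degrees_def
    proof safe
      fix f assume "f \<in> U" "f \<noteq> 0"
      then have "degree f < N" using deg by auto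
      then show "N - Suc (degree f) < N" by simp
      show "\<exists>g\<in>U. g \<in> G (N - Suc (degree f)) \<and> g \<notin> G (Suc (N - Suc (degree f)))"
        using \<open>f \<in> U\<close> \<open>f \<noteq> 0\<close> \<open>degree f < N\<close> by (intro bexI[of _ f]) (auto simp: G_def)
    qed
  qed (auto simp: degrees_def dest!: deg)
  then have "card {j. j < N \<and> (\<exists>f\<in>U. f \<in> G j \<and> f \<notin> G (Suc j))} = card (degrees U)"
    by (rule bij_betw_same_card)
  with c1 c2 show ?thesis by simp
qed

lemma poly_subspace_trunc: "poly_subspace U \<Longrightarrow> poly_subspace {f \<in> U. degree f < N \<or> f = 0}"
  unfolding poly_subspace_def by (auto intro: degree_add_less dest: order.strict_trans1[OF degree_smult_le])

text \<open>Spaces of infinite dimension are handled through their elements of degree below \<open>N\<close>.\<close>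
lemma card_chain_vals_below:
  assumes U: "poly_subspace U" and N: "N > 0"
  shows "card (chain_vals \<xi> {f \<in> U. degree f < N \<or> f = 0}) = card (degrees U \<inter> {..<N})"
proof -
  have lt: "degree f < N" if "f \<in> {f \<in> U. degree f < N \<or> f = 0}" for f
    using that N by auto
  have "card (chain_vals \<xi> {f \<in> U. degree f < N \<or> f = 0}) = card (degrees {f \<in> U. degree f < N \<or> f = 0})"
    by (rule card_chain_vals_eq_card_degrees[OF poly_subspace_trunc[OF U] lt])
  moreover have "degrees {f \<in> U. degree f < N \<or> f = 0} = degrees U \<inter> {..<N}"
    by (auto simp: degrees_def)
  ultimately show ?thesis by (rule trans[OF _ arg_cong[of _ _ card]])
qed

lemma chain_vals_trunc_subset:
  "chain_vals \<xi> {f \<in> U. degree f < N \<or> f = 0} \<subseteq> chain_vals \<xi> U \<inter> {..<N}"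
  using dvd_imp_degree_le[of "chain_prod \<xi> _"] by (fastforce simp: chain_vals_def)

text \<open>Truncation at degree \<open>N\<close> can lose values of the chain, but it never loses degrees below \<open>N\<close>; hence
an inequality only.\<close>
lemma missing_chain_vals_le:
  assumes U: "poly_subspace U" and fin: "finite (- degrees U)"
  shows "finite (- chain_vals \<xi> U)" "card (- chain_vals \<xi> U) \<le> card (- degrees U)"
proof -
  have *: "card ({..<N} - chain_vals \<xi> U) \<le> card (- degrees U)" for N
  proof (cases "N = 0")
    case False
    let ?J = "chain_vals \<xi> {f \<in> U. degree f < N \<or> f = 0}"
    have "card ({..<N} - chain_vals \<xi> U) \<le> card ({..<N} - ?J)"
      using chain_vals_trunc_subset[of \<xi> U N] by (intro card_mono) auto
    also have "\<dots> = N - card ?J"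
      using chain_vals_trunc_subset[of \<xi> U N] by (subst card_Diff_subset) (auto intro: finite_subset[of _ "{..<N}"])
    also have "\<dots> = N - card (degrees U \<inter> {..<N})"
      using False by (subst card_chain_vals_below[OF U]) auto
    also have "\<dots> = card ({..<N} - degrees U \<inter> {..<N})" by (subst card_Diff_subset) auto
    also have "\<dots> \<le> card (- degrees U)" using fin by (intro card_mono) auto
    finally show ?thesis .
  qed auto
  show 1: "finite (- chain_vals \<xi> U)"
  proof (rule ccontr)
    assume "infinite (- chain_vals \<xi> U)"
    then obtain T where T: "finite T" "card T = Suc (card (- degrees U))" "T \<subseteq> - chain_vals \<xi> U"
      using infinite_arbitrarily_large by metis
    then obtain N where "T \<subseteq> {..<N}" by (meson finite_nat_bounded)
    with T have "card T \<le> card ({..<N} - chain_vals \<xi> U)" by (intro card_mono) auto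
    with *[of N] T show False by simp
  qed
  then obtain N where "- chain_vals \<xi> U \<subseteq> {..<N}" by (meson finite_nat_bounded)
  then have "- chain_vals \<xi> U = {..<N} - chain_vals \<xi> U" by auto
  with *[of N] show "card (- chain_vals \<xi> U) \<le> card (- degrees U)" by simp
qed

text \<open>If \<open>U\<close> contains a full ideal of the chain, elements can be reduced modulo its generator without
changing their value, so truncation loses nothing.\<close>
lemma missing_chain_vals_eq:
  assumes U: "poly_subspace U" and fin: "finite (- degrees U)"
    and ideal: "\<And>f. chain_prod \<xi> n dvd f \<Longrightarrow> f \<in> U"
  shows "card (- chain_vals \<xi> U) = card (- degrees U)"
proof (rule antisym)
  obtain N0 where N0: "- degrees U \<subseteq> {..<N0}" using finite_nat_bounded[OF fin] by blast
  define N where "N = max (Suc n) N0"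
  have N: "n < N" "N0 \<le> N" by (auto simp: N_def)
  let ?J = "chain_vals \<xi> {f \<in> U. degree f < N \<or> f = 0}"
  have sub: "chain_vals \<xi> U \<inter> {..<N} \<subseteq> ?J"
  proof
    fix j assume "j \<in> chain_vals \<xi> U \<inter> {..<N}"
    then obtain f where f: "f \<in> U" "chain_prod \<xi> j dvd f" "\<not> chain_prod \<xi> (Suc j) dvd f" and j: "j < N"
      by (auto simp: chain_vals_def)
    show "j \<in> ?J"
    proof (cases "j < n")
      case True
      let ?g = "f mod chain_prod \<xi> n"
      have "chain_prod \<xi> n * (f div chain_prod \<xi> n) \<in> U" by (rule ideal) simp
      then have "f - chain_prod \<xi> n * (f div chain_prod \<xi> n) \<in> U" by (rule poly_subspace_diff[OF U f(1)])
      then have "?g \<in> U" by (simp add: minus_mult_div_eq_mod)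
      moreover have "degree ?g < N \<or> ?g = 0"
        using degree_mod_less[of "chain_prod \<xi> n" f] N by auto
      moreover have "chain_prod \<xi> j dvd ?g"
        using f(2) chain_prod_dvd[of j n] True by (simp add: dvd_mod)
      moreover have "\<not> chain_prod \<xi> (Suc j) dvd ?g"
        using f(3) chain_prod_dvd[of "Suc j" n \<xi>] True by (simp add: dvd_mod_iff)
      ultimately show ?thesis by (auto simp: chain_vals_def)
    next
      case False
      have "chain_prod \<xi> j \<in> U" using False by (intro ideal chain_prod_dvd) auto
      moreover have "\<not> chain_prod \<xi> (Suc j) dvd chain_prod \<xi> j"
        using dvd_imp_degree_le[of "chain_prod \<xi> (Suc j)" "chain_prod \<xi> j"] by auto
      ultimately show ?thesis using j by (auto simp: chain_vals_def intro!: bexI[of _ "chain_prod \<xi> j"])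
    qed
  qed
  have "card (- degrees U) = card ({..<N} - degrees U \<inter> {..<N})"
    using N0 N by (intro arg_cong[of _ _ card]) auto
  also have "\<dots> = N - card (degrees U \<inter> {..<N})" by (subst card_Diff_subset) auto
  also have "\<dots> = N - card ?J" using N by (subst card_chain_vals_below[OF U]) auto
  also have "\<dots> = card ({..<N} - ?J)"
    using chain_vals_trunc_subset[of \<xi> U N] by (subst card_Diff_subset) (auto intro: finite_subset[of _ "{..<N}"])
  also have "\<dots> \<le> card (- chain_vals \<xi> U)"
    using sub missing_chain_vals_le(1)[OF U fin] by (intro card_mono) auto
  finally show "card (- degrees U) \<le> card (- chain_vals \<xi> U)" .
qed (rule missing_chain_vals_le[OF U fin])

section \<open>The operator at a point\<close>
lemma of_nat_poly_smult: "of_nat n * p = smult (of_nat n) p" for p :: "complex poly"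
  by (simp add: of_nat_poly)

text \<open>The Euler operator \<open>t d/dt\<close> with \<open>t = z - \<zeta>\<close> keeps track of the factor \<open>t ^ n\<close> without the
truncated exponents \<open>n - 1\<close> and \<open>n - 2\<close>.\<close>
lemma euler_derivative:
  fixes u :: "complex poly"
  shows "[:-\<zeta>, 1:] * pderiv ([:-\<zeta>, 1:] ^ n * u) = [:-\<zeta>, 1:] ^ n * (of_nat n * u + [:-\<zeta>, 1:] * pderiv u)"
proof -
  let ?t = "[:-\<zeta>, 1:] :: complex poly"
  have "pderiv ?t = 1" by (simp add: pderiv_pCons)
  then have "?t * pderiv (?t ^ n) = of_nat n * ?t ^ n"
  proof (cases n)
    case (Suc k)
    have "pderiv (?t ^ Suc k) = smult (of_nat (Suc k)) (?t ^ k)"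
      using \<open>pderiv ?t = 1\<close> by (simp only: pderiv_power_Suc mult_1_right)
    then show ?thesis unfolding Suc of_nat_poly_smult by (simp only: power_Suc mult_smult_right)
  qed simp
  moreover have "?t * pderiv (?t ^ n * u) = ?t ^ n * (?t * pderiv u) + u * (?t * pderiv (?t ^ n))"
    unfolding pderiv_mult distrib_left by (simp only: mult.left_commute)
  ultimately show ?thesis by (simp only: distrib_left ac_simps)
qed

lemma euler_derivative2:
  fixes u :: "complex poly" and \<zeta> :: complex and n :: nat
  defines "t \<equiv> [:-\<zeta>, 1:]"
  defines "v \<equiv> of_nat n * u + t * pderiv u"
  shows "t\<^sup>2 * pderiv (pderiv (t ^ n * u)) = t ^ n * (of_nat n * v + t * pderiv v - v)"
proof -
  have 1: "t * pderiv (t ^ n * u) = t ^ n * v" unfolding v_def t_def by (rule euler_derivative)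
  have "t * pderiv (t * pderiv (t ^ n * u)) = t * pderiv (t ^ n * u) + t\<^sup>2 * pderiv (pderiv (t ^ n * u))"
    unfolding pderiv_mult[of t] by (simp add: t_def pderiv_pCons power2_eq_square algebra_simps del: mult_pCons_left mult_pCons_right)
  then have "t\<^sup>2 * pderiv (pderiv (t ^ n * u)) = t * pderiv (t ^ n * v) - t ^ n * v"
    unfolding 1 by (simp add: algebra_simps)
  also have "t * pderiv (t ^ n * v) = t ^ n * (of_nat n * v + t * pderiv v)"
    unfolding t_def by (rule euler_derivative)
  finally show ?thesis by (simp add: algebra_simps)
qed

lemma order_power_mult:
  fixes X :: "complex poly"
  assumes "poly X \<zeta> \<noteq> 0"
  shows "order \<zeta> ([:-\<zeta>, 1:] ^ k * X) = k"
proof -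
  have "X \<noteq> 0" using assms by auto
  then show ?thesis using assms by (subst order_mult) (auto simp: order_power_n_n order_0I)
qed

text \<open>The factor that \<open>a t\<^sup>2 d\<^sup>2/dt\<^sup>2 + b t d/dt + c\<close> attaches to \<open>t ^ n\<close>. The same polynomial governs leading
coefficients at infinity and hence the eigenvalues.\<close>
definition indicial :: "complex \<Rightarrow> complex \<Rightarrow> complex \<Rightarrow> nat \<Rightarrow> complex" where
  "indicial a b c n = of_nat n * (of_nat n - 1) * a + of_nat n * b + c"

text \<open>After multiplication by \<open>t\<^sup>2\<close> all three terms of the operator are divisible by \<open>t ^ E\<close>, and the next
coefficient is the value of the indicial polynomial at the order of \<open>f\<close>.\<close>
lemma order_shift:
  fixes A B C D f g :: "complex poly" and \<zeta> :: complex
  defines "t \<equiv> [:-\<zeta>, 1:]"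
  assumes eq: "A * pderiv (pderiv f) + B * pderiv f + C * f = D * g"
    and A: "A = t ^ E * A1" and B: "t * B = t ^ E * B1" and C: "t\<^sup>2 * C = t ^ E * C1"
    and D: "D \<noteq> 0" and f: "f \<noteq> 0"
    and ind: "indicial (poly A1 \<zeta>) (poly B1 \<zeta>) (poly C1 \<zeta>) (order \<zeta> f) \<noteq> 0"
  shows "g \<noteq> 0" "order \<zeta> g + order \<zeta> D + 2 = order \<zeta> f + E"
proof -
  define n where "n = order \<zeta> f"
  obtain u where u: "f = t ^ n * u" "poly u \<zeta> \<noteq> 0"
    using order_decomp[OF f, of \<zeta>] unfolding t_def n_def by (auto simp: poly_eq_0_iff_dvd)
  define v where "v = of_nat n * u + t * pderiv u"
  define X where "X = A1 * (of_nat n * v + t * pderiv v - v) + B1 * v + C1 * u"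
  have t0: "poly t \<zeta> = 0" by (simp add: t_def)
  have "t\<^sup>2 * (D * g) = A * (t\<^sup>2 * pderiv (pderiv f)) + (t * B) * (t * pderiv f) + (t\<^sup>2 * C) * f"
    unfolding eq[symmetric] by (simp add: algebra_simps power2_eq_square)
  also have "\<dots> = t ^ E * A1 * (t ^ n * (of_nat n * v + t * pderiv v - v)) + (t ^ E * B1) * (t ^ n * v) + (t ^ E * C1) * (t ^ n * u)"
    unfolding A B C u(1) using euler_derivative[of \<zeta> n u] euler_derivative2[of \<zeta> n u]
    by (simp add: t_def[symmetric] v_def)
  also have "\<dots> = t ^ (n + E) * X" by (simp add: X_def algebra_simps power_add)
  finally have main: "t\<^sup>2 * (D * g) = t ^ (n + E) * X" .
  have "poly X \<zeta> = poly u \<zeta> * indicial (poly A1 \<zeta>) (poly B1 \<zeta>) (poly C1 \<zeta>) n"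
    by (simp add: X_def v_def t0 indicial_def algebra_simps)
  with u ind have X: "poly X \<zeta> \<noteq> 0" by (simp add: n_def)
  then have "X \<noteq> 0" by auto
  moreover have "t \<noteq> 0" by (simp add: t_def)
  ultimately show g: "g \<noteq> 0" using main by auto
  have "order \<zeta> (t\<^sup>2 * (D * g)) = n + E"
    unfolding main unfolding t_def by (rule order_power_mult[OF X])
  moreover have "order \<zeta> (t\<^sup>2 * (D * g)) = 2 + (order \<zeta> D + order \<zeta> g)"
    using D g \<open>t \<noteq> 0\<close> by (simp add: order_mult order_power_n_n t_def del: mult_pCons_left mult_pCons_right)
  ultimately show "order \<zeta> g + order \<zeta> D + 2 = order \<zeta> f + E" by (simp add: n_def)
qed

lemma indicial_two_roots:
  assumes "indicial a b c i = 0" "indicial a b c j = 0" "i \<noteq> j"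
  shows "b = (1 - of_nat (i + j)) * a"
proof -
  have "(of_nat i - of_nat j) * ((of_nat (i + j) - 1) * a + b) = 0"
    using assms(1,2) unfolding indicial_def by (simp add: algebra_simps) algebra
  moreover have "(of_nat i :: complex) - of_nat j \<noteq> 0" using assms(3) by simp
  ultimately have "(of_nat (i + j) - 1) * a + b = 0" by simp
  then show ?thesis by (simp add: algebra_simps add_eq_0_iff2)
qed

lemma indicial_roots_degenerate:
  assumes "indicial 0 b c i = 0" "indicial 0 b c j = 0" "i \<noteq> j"
  shows "b = 0 \<and> c = 0"
  using indicial_two_roots[OF assms] assms(1) by (simp add: indicial_def)

lemma indicial_three_roots:
  assumes "indicial a b c i = 0" "indicial a b c j = 0" "indicial a b c k = 0" "distinct [i, j, k]"
  shows "a = 0 \<and> b = 0 \<and> c = 0"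
proof -
  have "(1 - of_nat (i + j)) * a = (1 - of_nat (i + k)) * a"
    using indicial_two_roots[OF assms(1,2)] indicial_two_roots[OF assms(1,3)] assms(4) by simp
  then have "(of_nat k - of_nat j) * a = 0" by (simp add: algebra_simps)
  then have "a = 0" using assms(4) by simp
  then show ?thesis using indicial_roots_degenerate[of b c i j] assms by simp
qed

text \<open>The least element of \<open>I\<close> in a residue class modulo \<open>h\<close> cannot be lowered by \<open>h\<close>, so it is
exceptional.\<close>
lemma residue_class_root:
  fixes I :: "nat set" and R :: "nat \<Rightarrow> bool"
  assumes fin: "finite (- I)" and shift: "\<And>n. n \<in> I \<Longrightarrow> \<not> R n \<Longrightarrow> h \<le> n \<and> n - h \<in> I"
    and r: "r < h"
  shows "\<exists>n\<in>I. R n \<and> n mod h = r"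
proof -
  obtain N where N: "- I \<subseteq> {..<N}" using finite_nat_bounded[OF fin] by blast
  have "N \<le> N * h + r" using r by (cases h) auto
  then have ex: "N * h + r \<in> I \<and> (N * h + r) mod h = r" using r N by auto
  define n where "n = (LEAST n. n \<in> I \<and> n mod h = r)"
  have n: "n \<in> I \<and> n mod h = r" unfolding n_def by (rule LeastI[of _ "N * h + r"]) (rule ex)
  have "R n"
  proof (rule ccontr)
    assume "\<not> R n"
    with shift n have *: "h \<le> n" "n - h \<in> I" by auto
    then have "(n - h) mod h = r" using n by (simp add: le_mod_geq)
    with * have "n \<le> n - h" unfolding n_def by (intro Least_le) auto
    with * r show False by simp
  qed
  with n show ?thesis by blast
qed

text \<open>\<open>I\<close> consists of the even numbers from \<open>i\<close> on and the odd numbers from \<open>j\<close> on: a gap above \<open>i\<close> or \<open>j\<close>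
would propagate upwards for ever, contradicting that only finitely many numbers are missing.\<close>
lemma card_missing_of_shift_by_two:
  fixes I :: "nat set"
  assumes fin: "finite (- I)" and i: "i \<in> I" "even i" and j: "j \<in> I" "odd j"
    and shift: "\<And>n. n \<in> I \<Longrightarrow> n \<noteq> i \<Longrightarrow> n \<noteq> j \<Longrightarrow> 2 \<le> n \<and> n - 2 \<in> I"
  shows "i + j = 2 * card (- I) + 1"
proof -
  have up: "n + 2 * k \<notin> I" if "n \<notin> I" "even n \<and> i < n \<or> odd n \<and> j < n" for n k
    using that(1)
  proof (induction k)
    case (Suc k)
    then have "n + 2 * k \<notin> I" by simp
    moreover have "n + 2 * Suc k \<noteq> i" "n + 2 * Suc k \<noteq> j" using that(2) i j by auto
    ultimately show ?case using shift[of "n + 2 * Suc k"] by auto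
  qed simp
  have inI: "n \<in> I" if "even n \<and> i \<le> n \<or> odd n \<and> j \<le> n" for n
  proof (rule ccontr)
    assume n: "n \<notin> I"
    with that i j have "even n \<and> i < n \<or> odd n \<and> j < n" by (metis order_le_less)
    with up[OF n] have "range (\<lambda>k. n + 2 * k) \<subseteq> - I" by auto
    with fin have "finite (range (\<lambda>k. n + 2 * k))" by (rule rev_finite_subset)
    moreover have "inj (\<lambda>k. n + 2 * k)" by (auto intro: injI)
    ultimately show False using finite_imageD infinite_UNIV_nat by blast
  qed
  have notI: "n \<notin> I" if "even n \<and> n < i \<or> odd n \<and> n < j" for n
    using that
  proof (induction n rule: less_induct)
    case (less n)
    show ?case
    proof
      assume "n \<in> I"
      with shift[of n] less.prems i j have "2 \<le> n" "n - 2 \<in> I" by auto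
      moreover have "even (n - 2) \<and> n - 2 < i \<or> odd (n - 2) \<and> n - 2 < j"
        using less.prems \<open>2 \<le> n\<close> by auto
      ultimately show False using less.IH[of "n - 2"] by auto
    qed
  qed
  have eq: "- I = (\<lambda>k. 2 * k) ` {..<i div 2} \<union> (\<lambda>k. 2 * k + 1) ` {..<j div 2}"
  proof (intro set_eqI iffI)
    fix n assume "n \<in> - I"
    then have "even n \<and> n < i \<or> odd n \<and> n < j" using inI[of n] by (metis ComplD not_less)
    then show "n \<in> (\<lambda>k. 2 * k) ` {..<i div 2} \<union> (\<lambda>k. 2 * k + 1) ` {..<j div 2}"
    proof
      assume "even n \<and> n < i"
      then show ?thesis using i by (auto elim!: evenE)
    next
      assume "odd n \<and> n < j"
      then show ?thesis using j by (auto elim!: oddE)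
    qed
  next
    fix n assume "n \<in> (\<lambda>k. 2 * k) ` {..<i div 2} \<union> (\<lambda>k. 2 * k + 1) ` {..<j div 2}"
    then show "n \<in> - I" using notI i j by (auto elim!: evenE oddE)
  qed
  have "card (- I) = i div 2 + j div 2"
    unfolding eq by (subst card_Un_disjoint) (auto simp: card_image inj_on_def, presburger)
  then show ?thesis using i j by presburger
qed

definition orders_at :: "complex \<Rightarrow> complex poly set \<Rightarrow> nat set" where
  "orders_at \<zeta> U = order \<zeta> ` (U - {0})"

text \<open>The second claim says that \<open>q/p\<close> has residue \<open>-2c\<close> at \<open>\<zeta>\<close> if \<open>p\<close> does not vanish there, with \<open>c\<close> the
number of missing orders; the third that \<open>q\<close> has no pole at a zero of \<open>p\<close>. The hypothesis \<open>inv\<close>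
makes the set of orders stable under the shift by \<open>h\<close>, apart from the roots of the indicial
polynomial. The bound \<open>h \<le> 2\<close> comes from the number of these roots, and it improves to \<open>h \<le> 1\<close> where
the quadratic term of the indicial polynomial vanishes.\<close>
lemma local_structure:
  fixes A B C D :: "complex poly" and \<zeta> :: complex
  defines "t \<equiv> [:-\<zeta>, 1:]"
  assumes A: "A \<noteq> 0" and D: "D \<noteq> 0" and fin: "finite (- orders_at \<zeta> U)"
    and inv: "\<And>f. f \<in> U \<Longrightarrow> \<exists>g\<in>U. A * pderiv (pderiv f) + B * pderiv f + C * f = D * g"
  shows "order \<zeta> D \<le> order \<zeta> A"
    and "order \<zeta> A = order \<zeta> D \<Longrightarrow> t ^ Suc (order \<zeta> A) dvd t * B + smult (2 * of_nat (card (- orders_at \<zeta> U))) A"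
    and "order \<zeta> D < order \<zeta> A \<Longrightarrow> t ^ order \<zeta> D dvd B"
proof -
  let ?I = "orders_at \<zeta> U" and ?\<delta> = "order \<zeta> D"
  \<comment> \<open>\<open>E\<close> is the exact common order of \<open>A\<close>, \<open>t B\<close> and \<open>t\<^sup>2 C\<close>, the three terms in Euler form.\<close>
  define G where "G E \<longleftrightarrow> t ^ E dvd A \<and> t ^ E dvd t * B \<and> t ^ E dvd t\<^sup>2 * C" for E
  define E where "E = (GREATEST E. G E)"
  have bnd: "E' \<le> order \<zeta> A" if "G E'" for E'
    using that A by (simp add: G_def t_def order_divides)
  have "G 0" by (simp add: G_def)
  then have GE: "G E" unfolding E_def by (rule GreatestI_nat) (rule bnd)
  have EA: "E \<le> order \<zeta> A" by (rule bnd[OF GE])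
  have nG: "\<not> G (Suc E)"
  proof
    assume "G (Suc E)"
    then have "Suc E \<le> E" unfolding E_def by (rule Greatest_le_nat) (rule bnd)
    then show False by simp
  qed
  obtain A1 B1 C1 where A1: "A = t ^ E * A1" and B1: "t * B = t ^ E * B1" and C1: "t\<^sup>2 * C = t ^ E * C1"
    using GE unfolding G_def by (auto elim!: dvdE)
  let ?a = "poly A1 \<zeta>" and ?b = "poly B1 \<zeta>" and ?c = "poly C1 \<zeta>"
  have t: "t \<noteq> 0" by (simp add: t_def)
  have nz: "\<not> (?a = 0 \<and> ?b = 0 \<and> ?c = 0)"
  proof
    assume "?a = 0 \<and> ?b = 0 \<and> ?c = 0"
    then have "t dvd A1" "t dvd B1" "t dvd C1" by (simp_all add: t_def poly_eq_0_iff_dvd)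
    then have "G (Suc E)" unfolding G_def A1 B1 C1 power_Suc2 by (auto intro: mult_dvd_mono)
    with nG show False ..
  qed
  have a0: "?a = 0" if "E < order \<zeta> A"
  proof -
    have "t ^ Suc E dvd A" using that A by (simp add: t_def order_divides del: power_Suc)
    then have "t dvd A1" unfolding A1 power_Suc2 using t by (simp del: power_Suc)
    then show ?thesis by (simp add: t_def poly_eq_0_iff_dvd)
  qed
  define R where "R = (\<lambda>n. indicial ?a ?b ?c n = 0)"
  have shift0: "\<exists>k\<in>?I. k + ?\<delta> + 2 = n + E" if n: "n \<in> ?I" "\<not> R n" for n
  proof -
    obtain f where f: "f \<in> U" "f \<noteq> 0" "n = order \<zeta> f" using n(1) by (auto simp: orders_at_def)
    obtain g where g: "g \<in> U" "A * pderiv (pderiv f) + B * pderiv f + C * f = D * g"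
      using inv[OF f(1)] by blast
    have "g \<noteq> 0" "order \<zeta> g + ?\<delta> + 2 = order \<zeta> f + E"
      using order_shift[OF g(2) A1[unfolded t_def] B1[unfolded t_def] C1[unfolded t_def] D f(2)] n(2) f(3)
      by (auto simp: R_def)
    with g f show ?thesis by (auto simp: orders_at_def)
  qed
  \<comment> \<open>The amount by which orders drop; truncation to 0 is harmless, as only \<open>h > 0\<close> is of interest.\<close>
  define h where "h = ?\<delta> + 2 - E"
  have shift: "h \<le> n \<and> n - h \<in> ?I" if nI: "n \<in> ?I" "\<not> R n" and Eh: "E \<le> ?\<delta> + 2" for n
  proof -
    obtain k where k: "k \<in> ?I" "k + ?\<delta> + 2 = n + E" using shift0[OF nI] by blast
    then have "k + h = n" using Eh by (simp add: h_def)
    then show ?thesis using k by auto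
  qed
  have cls: "\<exists>n\<in>?I. R n \<and> n mod h = r" if "r < h" for r
  proof (rule residue_class_root[OF fin _ that])
    show "h \<le> n \<and> n - h \<in> ?I" if "n \<in> ?I" "\<not> R n" for n
      using shift[OF that] \<open>r < h\<close> by (simp add: h_def)
  qed
  have h2: "h \<le> 2"
  proof (rule ccontr)
    assume "\<not> h \<le> 2"
    then obtain i j k where "R i" "i mod h = 0" "R j" "j mod h = 1" "R k" "k mod h = 2"
      using cls[of 0] cls[of 1] cls[of 2] by auto
    then have "R i" "R j" "R k" "distinct [i, j, k]" by auto
    with indicial_three_roots nz show False unfolding R_def by blast
  qed
  have h1: "h \<le> 1" if "?a = 0"
  proof (rule ccontr)
    assume "\<not> h \<le> 1"
    then obtain i j where "R i" "i mod h = 0" "R j" "j mod h = 1" using cls[of 0] cls[of 1] by auto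
    then have "R i" "R j" "i \<noteq> j" by auto
    with indicial_roots_degenerate[of ?b ?c i j] nz that show False unfolding R_def by auto
  qed
  have \<delta>E: "?\<delta> \<le> E" using h2 by (simp add: h_def)
  with EA show "?\<delta> \<le> order \<zeta> A" by simp
  show "t ^ ?\<delta> dvd B" if "?\<delta> < order \<zeta> A"
  proof -
    have "?\<delta> < E"
    proof (rule ccontr)
      assume "\<not> ?\<delta> < E"
      with \<delta>E have "E = ?\<delta>" by simp
      with a0 that h1 show False by (simp add: h_def)
    qed
    then have "t ^ Suc ?\<delta> dvd t * B" using GE unfolding G_def
      by (meson Suc_leI dvd_trans le_imp_power_dvd)
    then show ?thesis using t by (simp add: power_Suc)
  qed
  show "t ^ Suc (order \<zeta> A) dvd t * B + smult (2 * of_nat (card (- ?I))) A" if "order \<zeta> A = ?\<delta>"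
  proof -
    have E: "E = ?\<delta>" "h = 2" using EA \<delta>E that by (auto simp: h_def)
    obtain i j where ij: "i \<in> ?I" "R i" "i mod 2 = 0" "j \<in> ?I" "R j" "j mod 2 = 1"
      using cls[of 0] cls[of 1] E by auto
    then have ne: "i \<noteq> j" by auto
    have only: "n = i \<or> n = j" if "R n" for n
      using indicial_three_roots[of ?a ?b ?c i j n] nz ij ne that unfolding R_def by auto
    \<comment> \<open>The sum of the roots is determined by the residue and by the number of missing orders.\<close>
    have "i + j = 2 * card (- ?I) + 1"
    proof (rule card_missing_of_shift_by_two[OF fin])
      show "2 \<le> n \<and> n - 2 \<in> ?I" if "n \<in> ?I" "n \<noteq> i" "n \<noteq> j" for n
        using shift[of n] only[of n] that E by auto
    qed (use ij in \<open>auto simp: even_iff_mod_2_eq_zero odd_iff_mod_2_eq_one\<close>)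
    then have sum: "of_nat (i + j) = 2 * of_nat (card (- ?I)) + (1 :: complex)"
      by (simp only: of_nat_add of_nat_mult of_nat_numeral of_nat_1)
    have "?b = (1 - of_nat (i + j)) * ?a"
      using indicial_two_roots ij ne unfolding R_def by blast
    then have b: "?b + 2 * of_nat (card (- ?I)) * ?a = 0" unfolding sum by (simp add: algebra_simps)
    have eq: "t * B + smult (2 * of_nat (card (- ?I))) A = t ^ E * (B1 + smult (2 * of_nat (card (- ?I))) A1)"
      unfolding B1 by (simp add: A1 algebra_simps)
    have "t dvd B1 + smult (2 * of_nat (card (- ?I))) A1"
      unfolding t_def poly_eq_0_iff_dvd[symmetric] using b by simp
    then show ?thesis unfolding eq that E(1)[symmetric] power_Suc2 by (intro mult_dvd_mono) auto
  qed
qed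

section \<open>The largest invariant space and its local description\<close>
definition poly_op :: "complex poly \<Rightarrow> complex poly \<Rightarrow> complex poly \<Rightarrow> complex poly \<Rightarrow> complex poly" where
  "poly_op A B C f = A * pderiv (pderiv f) + B * pderiv f + C * f"

text \<open>\<open>T f\<close> is a polynomial again exactly if \<open>D\<close> divides \<open>A f'' + B f' + C f\<close>; the sequence \<open>g\<close> lists the
iterates of \<open>T\<close> on \<open>f\<close>. This is the largest space of polynomials that is invariant under \<open>T\<close>.\<close>
definition inv_space :: "complex poly \<Rightarrow> complex poly \<Rightarrow> complex poly \<Rightarrow> complex poly \<Rightarrow> complex poly set" where
  "inv_space A B C D = {f. \<exists>g :: nat \<Rightarrow> complex poly. g 0 = f \<and> (\<forall>n. poly_op A B C (g n) = D * g (Suc n))}"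

lemma poly_op_add: "poly_op A B C (f + g) = poly_op A B C f + poly_op A B C g"
  by (simp add: poly_op_def pderiv_add algebra_simps)

lemma poly_op_diff: "poly_op A B C (f - g) = poly_op A B C f - poly_op A B C g"
  by (simp add: poly_op_def pderiv_diff algebra_simps)

lemma poly_op_smult: "poly_op A B C (smult c f) = smult c (poly_op A B C f)"
  by (simp add: poly_op_def pderiv_smult smult_add_right)

lemma inv_space_coinduct:
  assumes f: "f \<in> X" and X: "\<And>f. f \<in> X \<Longrightarrow> \<exists>g\<in>X. poly_op A B C f = D * g"
  shows "f \<in> inv_space A B C D"
proof -
  obtain h where h: "\<And>f. f \<in> X \<Longrightarrow> h f \<in> X \<and> poly_op A B C f = D * h f" using X by metis
  have "(h ^^ n) f \<in> X" for n using f h by (induction n) auto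
  with h have "\<forall>n. poly_op A B C ((h ^^ n) f) = D * (h ^^ Suc n) f" by simp
  then show ?thesis unfolding inv_space_def by (intro CollectI exI[of _ "\<lambda>n. (h ^^ n) f"]) simp
qed

lemma inv_space_invariant:
  assumes "f \<in> inv_space A B C D"
  shows "\<exists>g\<in>inv_space A B C D. poly_op A B C f = D * g"
proof -
  obtain g where "g 0 = f" "\<forall>n. poly_op A B C (g n) = D * g (Suc n)"
    using assms by (auto simp: inv_space_def)
  then show ?thesis
    by (intro bexI[of _ "g 1"]) (auto simp: inv_space_def intro!: exI[of _ "\<lambda>n. g (Suc n)"])
qed

lemma poly_subspace_inv_space: "poly_subspace (inv_space A B C D)"
  unfolding poly_subspace_def
proof (intro conjI ballI allI)
  show "0 \<in> inv_space A B C D"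
    by (rule inv_space_coinduct[of 0 "{0}"]) (auto simp: poly_op_def)
  show "f + g \<in> inv_space A B C D" if f: "f \<in> inv_space A B C D" and g: "g \<in> inv_space A B C D" for f g
  proof -
    obtain f' g' where "f' 0 = f" "\<forall>n. poly_op A B C (f' n) = D * f' (Suc n)"
      "g' 0 = g" "\<forall>n. poly_op A B C (g' n) = D * g' (Suc n)"
      using f g by (auto simp: inv_space_def)
    then show ?thesis
      by (auto simp: inv_space_def poly_op_add algebra_simps intro!: exI[of _ "\<lambda>n. f' n + g' n"])
  qed
  show "smult c f \<in> inv_space A B C D" if f: "f \<in> inv_space A B C D" for c f
  proof -
    obtain f' where "f' 0 = f" "\<forall>n. poly_op A B C (f' n) = D * f' (Suc n)"
      using f by (auto simp: inv_space_def)
    then show ?thesis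
      by (auto simp: inv_space_def poly_op_smult intro!: exI[of _ "\<lambda>n. smult c (f' n)"])
  qed
qed

lemma inv_space_eigen:
  assumes "poly_op A B C f = D * smult \<mu> f"
  shows "f \<in> inv_space A B C D"
proof (rule inv_space_coinduct[of f "range (\<lambda>c. smult c f)"])
  show "f \<in> range (\<lambda>c. smult c f)" by (rule range_eqI[of _ _ 1], simp)
  show "\<exists>k\<in>range (\<lambda>c. smult c f). poly_op A B C g = D * k" if g: "g \<in> range (\<lambda>c. smult c f)" for g
  proof -
    obtain c where "g = smult c f" using g by auto
    then have "poly_op A B C g = D * smult (c * \<mu>) f" using assms by (simp add: poly_op_smult)
    then show ?thesis by blast
  qed
qed

lemma order_eq_iff_dvd:
  "f \<noteq> 0 \<and> order \<zeta> f = j \<longleftrightarrow> [:-\<zeta>, 1:] ^ j dvd f \<and> \<not> [:-\<zeta>, 1:] ^ Suc j dvd f"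
  by (cases "f = 0") (auto simp: order_divides simp del: power_Suc)

lemma orders_at_eq_chain_vals: "orders_at \<zeta> U = chain_vals (\<lambda>_. \<zeta>) U"
proof (intro set_eqI)
  fix j
  have "j \<in> orders_at \<zeta> U \<longleftrightarrow> (\<exists>f\<in>U. f \<noteq> 0 \<and> order \<zeta> f = j)"
    by (auto simp: orders_at_def)
  also have "\<dots> \<longleftrightarrow> j \<in> chain_vals (\<lambda>_. \<zeta>) U"
    unfolding order_eq_iff_dvd chain_vals_def by (simp only: chain_prod_def prod_constant card_lessThan mem_Collect_eq)
  finally show "j \<in> orders_at \<zeta> U \<longleftrightarrow> j \<in> chain_vals (\<lambda>_. \<zeta>) U" .
qed

lemma finite_missing_orders:
  assumes "poly_subspace U" "finite (- degrees U)"
  shows "finite (- orders_at \<zeta> U)"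
  using missing_chain_vals_le(1)[OF assms] by (simp add: orders_at_eq_chain_vals)

text \<open>Over the complex numbers divisibility can be checked root by root, by splitting off linear factors.\<close>
lemma dvd_if_order_dvd:
  fixes D F :: "complex poly"
  assumes "D \<noteq> 0" "\<And>\<zeta>. [:-\<zeta>, 1:] ^ order \<zeta> D dvd F"
  shows "D dvd F"
proof (cases "F = 0")
  case False
  with assms have "D \<noteq> 0" "F \<noteq> 0" "\<And>\<zeta>. order \<zeta> D \<le> order \<zeta> F" by (auto simp: order_divides)
  then show ?thesis
  proof (induction "degree D" arbitrary: D F)
    case 0
    then have "D dvd 1" by (simp add: is_unit_iff_degree)
    then show ?case by (rule unit_imp_dvd)
  next
    case (Suc n)
    obtain \<zeta> where z: "poly D \<zeta> = 0"
      using fundamental_theorem_of_algebra[of D] Suc.hyps(2) by (auto simp: constant_degree)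
    then obtain D' where D': "D = [:-\<zeta>, 1:] * D'" by (auto simp: poly_eq_0_iff_dvd)
    have "order \<zeta> D \<noteq> 0" using z Suc.prems by (simp add: order_root)
    with Suc.prems(3)[of \<zeta>] have "order \<zeta> F \<noteq> 0" by linarith
    then have "poly F \<zeta> = 0" by (simp add: order_root)
    then obtain F' where F': "F = [:-\<zeta>, 1:] * F'" by (auto simp: poly_eq_0_iff_dvd)
    have nz: "D' \<noteq> 0" "F' \<noteq> 0" using Suc.prems D' F' by auto
    have "degree D = Suc (degree D')" unfolding D' using nz by (subst degree_mult_eq) auto
    then have n: "n = degree D'" using Suc.hyps(2) by simp
    have "order x D' \<le> order x F'" for x
      using Suc.prems(3)[of x] order_mult[OF Suc.prems(1)[unfolded D'], of x] order_mult[OF Suc.prems(2)[unfolded F'], of x]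
      unfolding D' F' by linarith
    with Suc.hyps(1)[OF n nz] have "D' dvd F'" by blast
    then show ?case unfolding D' F' by (rule mult_dvd_mono[OF dvd_refl])
  qed
qed simp

lemma power_dvd_pderiv:
  fixes f :: "complex poly"
  assumes "t ^ Suc k dvd f"
  shows "t ^ k dvd pderiv f"
proof -
  obtain w where "f = t ^ Suc k * w" using assms by blast
  then have "pderiv f = t ^ Suc k * pderiv w + w * (smult (of_nat (Suc k)) (t ^ k) * pderiv t)"
    by (simp only: pderiv_mult pderiv_power_Suc)
  also have "t ^ k dvd \<dots>"
    by (rule dvd_add[OF dvd_mult2[OF le_imp_power_dvd] dvd_mult[OF dvd_mult2[OF dvd_smult[OF dvd_refl]]]]) simp
  finally show ?thesis .
qed

lemma power_dvd_poly_op: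
  assumes "t ^ (k + 2) dvd f"
  shows "t ^ k dvd poly_op A B C f"
proof -
  have 1: "t ^ Suc k dvd pderiv f" using assms by (intro power_dvd_pderiv) simp
  then have "t ^ k dvd pderiv (pderiv f)" by (rule power_dvd_pderiv)
  moreover have "t ^ k dvd pderiv f" using 1 by (rule power_le_dvd) simp
  moreover have "t ^ k dvd f" using assms by (rule power_le_dvd) simp
  ultimately show ?thesis unfolding poly_op_def by (intro dvd_add dvd_mult)
qed

text \<open>Membership of \<open>f\<close> in the closure of \<open>U\<close> in the ring of formal power series at \<open>\<zeta>\<close>.\<close>
definition in_closure :: "complex poly set \<Rightarrow> complex \<Rightarrow> complex poly \<Rightarrow> bool" where
  "in_closure U \<zeta> f \<longleftrightarrow> (\<forall>N. \<exists>u\<in>U. [:-\<zeta>, 1:] ^ N dvd f - u)"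

text \<open>\<open>T\<close> loses a bounded amount of precision at each zero of \<open>D\<close>, so it is continuous for the adic topology
there. Hence \<open>T f\<close> is regular at that point and again in the closure, and the polynomials that are
in the closure everywhere form an invariant space, which \<open>U\<close> must contain.\<close>
lemma inv_space_local:
  assumes D: "D \<noteq> 0"
    and f: "\<And>\<zeta>. poly D \<zeta> = 0 \<Longrightarrow> in_closure (inv_space A B C D) \<zeta> f"
  shows "f \<in> inv_space A B C D"
proof -
  let ?U = "inv_space A B C D"
  define X where "X = {f. \<forall>\<zeta>. poly D \<zeta> = 0 \<longrightarrow> in_closure ?U \<zeta> f}"
  show ?thesis
  proof (rule inv_space_coinduct[of f X])
    show "f \<in> X" using f by (simp add: X_def)
    fix f assume f: "f \<in> X"
    have approx: "\<exists>g\<in>?U. [:-\<zeta>, 1:] ^ (N + order \<zeta> D) dvd poly_op A B C f - D * g" if root: "poly D \<zeta> = 0" for N \<zeta>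
    proof -
      obtain u where u: "u \<in> ?U" "[:-\<zeta>, 1:] ^ (N + order \<zeta> D + 2) dvd f - u"
        using f root unfolding X_def in_closure_def by blast
      obtain g where g: "g \<in> ?U" "poly_op A B C u = D * g" using inv_space_invariant[OF u(1)] by blast
      show ?thesis using power_dvd_poly_op[OF u(2), of A B C] g by (auto simp: poly_op_diff)
    qed
    have ordD: "[:-\<zeta>, 1:] ^ order \<zeta> D dvd D" for \<zeta> by (rule order_1)
    have "D dvd poly_op A B C f"
    proof (rule dvd_if_order_dvd[OF D])
      fix \<zeta>
      show "[:-\<zeta>, 1:] ^ order \<zeta> D dvd poly_op A B C f"
      proof (cases "poly D \<zeta> = 0")
        case True
        then obtain g where "[:-\<zeta>, 1:] ^ order \<zeta> D dvd poly_op A B C f - D * g"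
          using approx[of \<zeta> 0] by auto
        moreover have "[:-\<zeta>, 1:] ^ order \<zeta> D dvd D * g" using ordD by (rule dvd_mult2)
        ultimately have "[:-\<zeta>, 1:] ^ order \<zeta> D dvd (poly_op A B C f - D * g) + D * g" by (rule dvd_add)
        then show ?thesis by simp
      qed (simp add: order_0I)
    qed
    then obtain g where g: "poly_op A B C f = D * g" by blast
    have "g \<in> X"
      unfolding X_def in_closure_def
    proof (intro CollectI allI impI)
      fix \<zeta> N assume "poly D \<zeta> = 0"
      then obtain h where h: "h \<in> ?U" "[:-\<zeta>, 1:] ^ (N + order \<zeta> D) dvd D * (g - h)"
        using approx[of \<zeta> N] g by (auto simp: algebra_simps)
      have "g - h = 0 \<or> N \<le> order \<zeta> (g - h)"
        using h(2) D by (cases "g - h = 0") (simp_all add: order_divides order_mult)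
      then have "[:-\<zeta>, 1:] ^ N dvd g - h" by (simp add: order_divides)
      with h(1) show "\<exists>u\<in>?U. [:-\<zeta>, 1:] ^ N dvd g - u" by blast
    qed
    with g show "\<exists>g\<in>X. poly_op A B C f = D * g" by blast
  qed
qed

text \<open>Successive approximation: if all orders from \<open>N0\<close> on occur, the lowest term of a remainder can always
be removed by an element of \<open>U\<close>.\<close>
lemma in_closure_of_high_order:
  assumes U: "poly_subspace U" and N0: "\<And>n. N0 \<le> n \<Longrightarrow> n \<in> orders_at \<zeta> U"
    and f: "[:-\<zeta>, 1:] ^ N0 dvd f"
  shows "in_closure U \<zeta> f"
proof -
  let ?t = "[:-\<zeta>, 1:] :: complex poly"
  have step: "\<exists>u\<in>U. ?t ^ N dvd f - u" if "N0 \<le> N" for N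
    using that
  proof (induction rule: dec_induct)
    case base
    show ?case using f U by (auto simp: poly_subspace_def intro!: bexI[of _ 0])
  next
    case (step N)
    then obtain u w where u: "u \<in> U" and w: "f - u = ?t ^ N * w" by blast
    obtain v where v: "v \<in> U" "v \<noteq> 0" "order \<zeta> v = N" using N0[of N] step.hyps by (auto simp: orders_at_def)
    obtain x where x: "v = ?t ^ N * x" "poly x \<zeta> \<noteq> 0"
      using order_decomp[OF v(2), of \<zeta>] v(3) by (auto simp: poly_eq_0_iff_dvd)
    define c where "c = poly w \<zeta> / poly x \<zeta>"
    have "?t dvd w - smult c x" using x(2) by (simp flip: poly_eq_0_iff_dvd add: c_def)
    then have "?t ^ Suc N dvd ?t ^ N * (w - smult c x)" unfolding power_Suc2 by (intro mult_dvd_mono) auto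
    also have "?t ^ N * (w - smult c x) = f - (u + smult c v)"
      using w unfolding x(1) by (simp add: algebra_simps del: mult_pCons_left mult_pCons_right)
    finally show ?case using u v U by (intro bexI[of _ "u + smult c v"]) (auto simp: poly_subspace_def)
  qed
  show ?thesis unfolding in_closure_def
  proof
    fix N
    obtain u where "u \<in> U" "?t ^ max N N0 dvd f - u" using step[of "max N N0"] by auto
    then show "\<exists>u\<in>U. ?t ^ N dvd f - u" using power_le_dvd[of ?t "max N N0" _ N] by auto
  qed
qed

lemma in_closure_add:
  assumes U: "poly_subspace U" and "in_closure U \<zeta> f" "g \<in> U"
  shows "in_closure U \<zeta> (f + g)"
  unfolding in_closure_def
proof
  fix N
  obtain u where "u \<in> U" "[:-\<zeta>, 1:] ^ N dvd f - u" using assms by (auto simp: in_closure_def)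
  then show "\<exists>u\<in>U. [:-\<zeta>, 1:] ^ N dvd f + g - u"
    using U assms(3) by (intro bexI[of _ "u + g"]) (auto simp: poly_subspace_def)
qed

section \<open>Independence of the local conditions\<close>
lemma order_linear: "order \<zeta> [:- a, 1:] = (if a = \<zeta> then 1 else 0)" for \<zeta> :: complex
  using order_power_n_n[of \<zeta> 1] by (auto simp: order_0I)

lemma order_chain_prod: "order \<zeta> (chain_prod \<xi> j) = card {i. i < j \<and> \<xi> i = \<zeta>}"
proof (induction j)
  case (Suc j)
  have "chain_prod \<xi> (Suc j) = chain_prod \<xi> j * [:- \<xi> j, 1:]" by (simp add: chain_prod_def)
  moreover have nz: "chain_prod \<xi> j * [:- \<xi> j, 1:] \<noteq> 0" unfolding mult_eq_0_iff by simp
  ultimately have "order \<zeta> (chain_prod \<xi> (Suc j)) = card {i. i < j \<and> \<xi> i = \<zeta>} + (if \<xi> j = \<zeta> then 1 else 0)"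
    using order_mult[OF nz, of \<zeta>] by (simp only: Suc.IH order_linear)
  moreover have "{i. i < Suc j \<and> \<xi> i = \<zeta>} = (if \<xi> j = \<zeta> then insert j {i. i < j \<and> \<xi> i = \<zeta>} else {i. i < j \<and> \<xi> i = \<zeta>})"
    by (auto simp: less_Suc_eq)
  ultimately show ?case by simp
qed (simp add: chain_prod_def)

lemma chain_prod_dvd_iff:
  assumes "f \<noteq> 0"
  shows "chain_prod \<xi> j dvd f \<longleftrightarrow> (\<forall>\<zeta>. card {i. i < j \<and> \<xi> i = \<zeta>} \<le> order \<zeta> f)"
proof
  assume "chain_prod \<xi> j dvd f"
  then have "order \<zeta> (chain_prod \<xi> j) \<le> order \<zeta> f" for \<zeta> by (rule dvd_imp_order_le[OF assms])
  then show "\<forall>\<zeta>. card {i. i < j \<and> \<xi> i = \<zeta>} \<le> order \<zeta> f" by (simp add: order_chain_prod)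
next
  assume "\<forall>\<zeta>. card {i. i < j \<and> \<xi> i = \<zeta>} \<le> order \<zeta> f"
  then have "[:-\<zeta>, 1:] ^ order \<zeta> (chain_prod \<xi> j) dvd f" for \<zeta>
    unfolding order_divides order_chain_prod by blast
  then show "chain_prod \<xi> j dvd f" by (rule dvd_if_order_dvd[OF chain_prod_nonzero])
qed

lemma coprime_linear_powers:
  fixes a b :: complex
  assumes "a \<noteq> b"
  shows "coprime ([:-a, 1:] ^ m) ([:-b, 1:] ^ n)"
proof -
  have "coprime [:-a, 1:] [:-b, 1:]"
  proof (rule coprimeI)
    fix c assume "c dvd [:-a, 1:]" "c dvd [:-b, 1:]"
    then have "c dvd [:-a, 1:] - [:-b, 1:]" by (rule dvd_diff)
    then have "c dvd [:b - a:]" by simp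
    moreover have "[:b - a:] dvd 1" using assms by (simp add: is_unit_iff_degree)
    ultimately show "is_unit c" by (rule dvd_trans)
  qed
  then show ?thesis by simp
qed

text \<open>Chinese remainder theorem: a local behaviour of \<open>U\<close> at one point can be prescribed together with
a high order of vanishing at the others, and the result stays in \<open>U\<close> because \<open>U\<close> is locally determined.\<close>
lemma local_interpolation:
  assumes U: "poly_subspace U" and Z: "finite Z" "\<zeta> \<in> Z"
    and N0: "\<And>x n. x \<in> Z \<Longrightarrow> N0 \<le> n \<Longrightarrow> n \<in> orders_at x U"
    and loc: "\<And>f. (\<And>x. x \<in> Z \<Longrightarrow> in_closure U x f) \<Longrightarrow> f \<in> U"
    and u: "u \<in> U"
  shows "\<exists>f\<in>U. [:-\<zeta>, 1:] ^ N0 dvd f - u \<and> (\<forall>x\<in>Z - {\<zeta>}. [:-x, 1:] ^ N0 dvd f)"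
proof -
  define G where "G = (\<Prod>x\<in>Z - {\<zeta>}. [:-x, 1:] ^ N0)"
  have "coprime ([:-\<zeta>, 1:] ^ N0) G"
    unfolding G_def by (rule prod_coprime_right, rule coprime_linear_powers) auto
  then obtain a b where ab: "a * [:-\<zeta>, 1:] ^ N0 + b * G = 1"
    using bezout_coefficients_fst_snd[of "[:-\<zeta>, 1:] ^ N0" G] unfolding coprime_iff_gcd_eq_1 by metis
  define f where "f = b * G * u"
  have "f - u = (b * G - 1) * u" by (simp add: f_def left_diff_distrib)
  also have "b * G - 1 = - a * [:-\<zeta>, 1:] ^ N0"
    unfolding ab[symmetric] by (simp only: add_diff_cancel_right diff_add_eq_diff_diff_swap diff_self diff_0 minus_mult_left)
  finally have 1: "[:-\<zeta>, 1:] ^ N0 dvd f - u" by simp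
  have 2: "[:-x, 1:] ^ N0 dvd f" if "x \<in> Z - {\<zeta>}" for x
    using dvd_prodI[of "Z - {\<zeta>}" x "\<lambda>x. [:-x, 1:] ^ N0"] that Z
    unfolding f_def G_def by (auto intro: dvd_mult dvd_mult2)
  have "f \<in> U"
  proof (rule loc)
    fix x assume x: "x \<in> Z"
    show "in_closure U x f"
    proof (cases "x = \<zeta>")
      case True
      have "in_closure U x (f - u)" using N0[OF x] 1 unfolding True by (rule in_closure_of_high_order[OF U])
      then have "in_closure U x ((f - u) + u)" using u by (rule in_closure_add[OF U])
      then show ?thesis by simp
    next
      case False
      with x have "[:-x, 1:] ^ N0 dvd f" by (intro 2) auto
      with N0[OF x] show ?thesis by (rule in_closure_of_high_order[OF U])
    qed
  qed
  with 1 2 show ?thesis by blast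
qed

text \<open>All orders from some \<open>N0\<close> on occur at each point of \<open>Z\<close>. A chain that visits every point of \<open>Z\<close> exactly \<open>N0\<close>
times in a row decomposes into blocks; by interpolation the values missing in a block are the
orders missing at its point, and past the blocks nothing is missing.\<close>
lemma sum_local_codimensions:
  assumes U: "poly_subspace U" and fin: "finite (- degrees U)" and Z: "finite Z"
    and loc: "\<And>f. (\<And>x. x \<in> Z \<Longrightarrow> in_closure U x f) \<Longrightarrow> f \<in> U"
  shows "card (- degrees U) = (\<Sum>\<zeta>\<in>Z. card (- orders_at \<zeta> U))"
proof -
  have finI: "finite (- orders_at x U)" for x by (rule finite_missing_orders[OF U fin])
  then have "finite (\<Union>x\<in>Z. - orders_at x U)" using Z by blast
  then obtain N1 where N1: "(\<Union>x\<in>Z. - orders_at x U) \<subseteq> {..<N1}" using finite_nat_bounded by blast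
  define N0 where "N0 = Suc N1"
  have miss: "n < N0" if "x \<in> Z" "n \<notin> orders_at x U" for x n
    using that N1 by (force simp: N0_def)
  then have N0: "n \<in> orders_at x U" if "x \<in> Z" "N0 \<le> n" for x n using that by (meson not_less)
  have N0_pos: "N0 > 0" by (simp add: N0_def)
  obtain zs where zs: "set zs = Z" "distinct zs" using finite_distinct_list[OF Z] by blast
  define k where "k = length zs"
  \<comment> \<open>Position \<open>i * N0 + l\<close> is the \<open>l\<close>-th visit of the \<open>i\<close>-th point; the continuation by 0 is arbitrary.\<close>
  define \<xi> where "\<xi> = (\<lambda>j. if j < k * N0 then zs ! (j div N0) else 0)"
  have idx: "i * N0 + l < k * N0" if "i < k" "l < N0" for i l
  proof -
    have "i * N0 + l < Suc i * N0" using that by simp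
    also have "\<dots> \<le> k * N0" using that by (intro mult_le_mono1) auto
    finally show ?thesis .
  qed
  have \<xi>: "\<xi> (i * N0 + l) = zs ! i" if "i < k" "l < N0" for i l
    using that idx by (simp add: \<xi>_def)
  have count: "card {j'. j' < i * N0 + l \<and> \<xi> j' = zs ! i'} = (if i' < i then N0 else if i' = i then l else 0)"
    if il: "i < k" "l \<le> N0" "i' < k" for i l i'
  proof -
    have "{j'. j' < i * N0 + l \<and> \<xi> j' = zs ! i'} = (\<lambda>l'. i' * N0 + l') ` {l'. l' < N0 \<and> i' * N0 + l' < i * N0 + l}"
    proof (intro set_eqI iffI)
      fix j' assume j': "j' \<in> {j'. j' < i * N0 + l \<and> \<xi> j' = zs ! i'}"
      define i2 l2 where "i2 = j' div N0" and "l2 = j' mod N0"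
      have l2: "l2 < N0" using N0_pos by (simp add: l2_def)
      have e: "j' = i2 * N0 + l2" by (simp add: i2_def l2_def)
      have "i * N0 + l \<le> Suc i * N0" using il by simp
      also have "\<dots> \<le> k * N0" using il by (intro mult_le_mono1) auto
      finally have "j' < k * N0" using j' by auto
      then have "i2 < k" unfolding i2_def by (rule less_mult_imp_div_less)
      then have "zs ! i2 = zs ! i'" using \<xi>[OF _ l2] e j' by auto
      then have "i2 = i'" using zs(2) \<open>i2 < k\<close> il(3) by (simp add: nth_eq_iff_index_eq k_def)
      then show "j' \<in> (\<lambda>l'. i' * N0 + l') ` {l'. l' < N0 \<and> i' * N0 + l' < i * N0 + l}"
        using e l2 j' by auto
    next
      fix j' assume "j' \<in> (\<lambda>l'. i' * N0 + l') ` {l'. l' < N0 \<and> i' * N0 + l' < i * N0 + l}"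
      then show "j' \<in> {j'. j' < i * N0 + l \<and> \<xi> j' = zs ! i'}" using \<xi> il by auto
    qed
    then have "card {j'. j' < i * N0 + l \<and> \<xi> j' = zs ! i'} = card {l'. l' < N0 \<and> i' * N0 + l' < i * N0 + l}"
      by (simp add: card_image)
    also have "{l'. l' < N0 \<and> i' * N0 + l' < i * N0 + l} = {..<(if i' < i then N0 else if i' = i then l else 0)}"
    proof (cases i' i rule: linorder_cases)
      case less
      then have "Suc i' * N0 \<le> i * N0" by (intro mult_le_mono1) auto
      then have "i' * N0 + l' < i * N0 + l" if "l' < N0" for l' using that by simp
      with less show ?thesis by auto
    next
      case equal
      with il show ?thesis by auto
    next
      case greater
      then have "Suc i * N0 \<le> i' * N0" by (intro mult_le_mono1) auto
      then have "\<not> i' * N0 + l' < i * N0 + l" for l' using il by simp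
      with greater show ?thesis by auto
    qed
    finally show ?thesis by simp
  qed
  have ideal: "f \<in> U" if f: "chain_prod \<xi> (k * N0) dvd f" for f
  proof (rule loc)
    fix x assume x: "x \<in> Z"
    then obtain i where i: "i < k" "x = zs ! i" using zs by (metis in_set_conv_nth k_def)
    then have "k \<noteq> 0" by auto
    then have "k * N0 = (k - 1) * N0 + N0" by (cases k) auto
    then have "N0 \<le> card {j. j < k * N0 \<and> \<xi> j = x}"
      using count[of "k - 1" N0 i] i \<open>k \<noteq> 0\<close> by auto
    then have "[:-x, 1:] ^ N0 dvd chain_prod \<xi> (k * N0)" by (simp add: order_divides order_chain_prod)
    then have "[:-x, 1:] ^ N0 dvd f" using f by (rule dvd_trans)
    with N0[OF x] show "in_closure U x f" by (rule in_closure_of_high_order[OF U])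
  qed
  have block: "i * N0 + l \<in> chain_vals \<xi> U \<longleftrightarrow> l \<in> orders_at (zs ! i) U" if il: "i < k" "l < N0" for i l
  proof
    let ?j = "i * N0 + l"
    have Sj: "{j'. j' < Suc ?j \<and> \<xi> j' = \<zeta>} = (if \<zeta> = zs ! i then insert ?j {j'. j' < ?j \<and> \<xi> j' = \<zeta>} else {j'. j' < ?j \<and> \<xi> j' = \<zeta>})" for \<zeta>
      using \<xi>[OF il] by (auto simp: less_Suc_eq)
    have cS: "card {j'. j' < Suc ?j \<and> \<xi> j' = \<zeta>} = card {j'. j' < ?j \<and> \<xi> j' = \<zeta>} + (if \<zeta> = zs ! i then 1 else 0)" for \<zeta>
      unfolding Sj by simp
    have ci: "card {j'. j' < ?j \<and> \<xi> j' = zs ! i} = l" using count[of i l i] il by simp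
    {
      assume "?j \<in> chain_vals \<xi> U"
      then obtain f where f: "f \<in> U" "chain_prod \<xi> ?j dvd f" "\<not> chain_prod \<xi> (Suc ?j) dvd f"
        by (auto simp: chain_vals_def)
      then have nz: "f \<noteq> 0" by auto
      have le: "card {j'. j' < ?j \<and> \<xi> j' = \<zeta>} \<le> order \<zeta> f" for \<zeta>
        using f(2) chain_prod_dvd_iff[OF nz] by blast
      obtain \<zeta> where "order \<zeta> f < card {j'. j' < Suc ?j \<and> \<xi> j' = \<zeta>}"
        using f(3) chain_prod_dvd_iff[OF nz, of \<xi> "Suc ?j"] by (auto simp: not_le)
      with le[of \<zeta>] have "order (zs ! i) f = l" unfolding cS by (auto split: if_splits simp: ci)
      with f nz show "l \<in> orders_at (zs ! i) U" by (auto simp: orders_at_def)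
    }
    {
      assume "l \<in> orders_at (zs ! i) U"
      then obtain u where u: "u \<in> U" "u \<noteq> 0" "order (zs ! i) u = l" by (auto simp: orders_at_def)
      have "zs ! i \<in> Z" using il zs k_def by auto
      from local_interpolation[OF U Z this N0 loc u(1)] obtain f where f: "f \<in> U"
        "[:-(zs ! i), 1:] ^ N0 dvd f - u" "\<And>x. x \<in> Z \<Longrightarrow> x \<noteq> zs ! i \<Longrightarrow> [:-x, 1:] ^ N0 dvd f" by blast
      have low: "[:-(zs ! i), 1:] ^ n dvd f \<longleftrightarrow> [:-(zs ! i), 1:] ^ n dvd u" if n: "n \<le> N0" for n
      proof -
        have "[:-(zs ! i), 1:] ^ n dvd f - u" using power_le_dvd[OF f(2) n] .
        then have "[:-(zs ! i), 1:] ^ n dvd (f - u) + u \<longleftrightarrow> [:-(zs ! i), 1:] ^ n dvd u" by (rule dvd_add_right_iff)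
        then show ?thesis by simp
      qed
      have ord: "f \<noteq> 0 \<and> order (zs ! i) f = l"
        unfolding order_eq_iff_dvd using low[of l] low[of "Suc l"] il u order_eq_iff_dvd[of u "zs ! i" l] by auto
      then have nz: "f \<noteq> 0" by simp
      have "chain_prod \<xi> ?j dvd f" unfolding chain_prod_dvd_iff[OF nz]
      proof
        fix \<zeta>
        show "card {j'. j' < ?j \<and> \<xi> j' = \<zeta>} \<le> order \<zeta> f"
        proof (cases "\<exists>i'<i. \<zeta> = zs ! i'")
          case True
          then obtain i' where i': "i' < i" "\<zeta> = zs ! i'" by blast
          then have "i' < k" using il by simp
          then have "\<zeta> \<in> Z" "\<zeta> \<noteq> zs ! i" using zs i' il by (auto simp: k_def nth_eq_iff_index_eq)
          with f(3) nz have "N0 \<le> order \<zeta> f" by (simp add: order_divides)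
          then show ?thesis using count[of i l i'] il i' by simp
        next
          case False
          show ?thesis
          proof (cases "\<zeta> = zs ! i")
            case True
            then show ?thesis using ord ci by simp
          next
            case False': False
            have "\<xi> j' \<noteq> \<zeta>" if j': "j' < ?j" for j'
            proof
              assume eq: "\<xi> j' = \<zeta>"
              have "j' < k * N0" using idx[OF il] j' by simp
              then have x: "\<zeta> = zs ! (j' div N0)" using eq by (simp add: \<xi>_def)
              have "j' div N0 \<le> ?j div N0" using j' by (intro div_le_mono) auto
              also have "\<dots> = i" using il by simp
              finally show False using x False False' by (auto simp: order_le_less)
            qed
            then have "{j'. j' < ?j \<and> \<xi> j' = \<zeta>} = {}" by auto
            then show ?thesis by (simp only: card.empty le0)
          qed
        qed
      qed
      moreover have "\<not> chain_prod \<xi> (Suc ?j) dvd f"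
      proof
        assume "chain_prod \<xi> (Suc ?j) dvd f"
        then have "card {j'. j' < Suc ?j \<and> \<xi> j' = zs ! i} \<le> order (zs ! i) f"
          using chain_prod_dvd_iff[OF nz] by blast
        then show False using ord cS[of "zs ! i"] ci by simp
      qed
      ultimately show "?j \<in> chain_vals \<xi> U" using f(1) by (auto simp: chain_vals_def)
    }
  qed
  have high: "j \<in> chain_vals \<xi> U" if "k * N0 \<le> j" for j
  proof -
    have "chain_prod \<xi> j \<in> U" using that by (intro ideal chain_prod_dvd) auto
    moreover have "\<not> chain_prod \<xi> (Suc j) dvd chain_prod \<xi> j"
      using dvd_imp_degree_le[of "chain_prod \<xi> (Suc j)" "chain_prod \<xi> j"] by auto
    ultimately show ?thesis by (auto simp: chain_vals_def intro!: bexI[of _ "chain_prod \<xi> j"])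
  qed
  have "- chain_vals \<xi> U = (\<lambda>(i, l). i * N0 + l) ` (SIGMA i:{..<k}. - orders_at (zs ! i) U)"
  proof (intro set_eqI iffI)
    fix j assume j: "j \<in> - chain_vals \<xi> U"
    then have jk: "j < k * N0" using high by (meson ComplD not_less)
    have "j div N0 < k" using jk by (rule less_mult_imp_div_less)
    moreover have "j mod N0 < N0" using N0_pos by simp
    ultimately have "j mod N0 \<notin> orders_at (zs ! (j div N0)) U"
      using block[of "j div N0" "j mod N0"] j by simp
    then show "j \<in> (\<lambda>(i, l). i * N0 + l) ` (SIGMA i:{..<k}. - orders_at (zs ! i) U)"
      using \<open>j div N0 < k\<close> by (intro image_eqI[of _ _ "(j div N0, j mod N0)"]) auto
  next
    fix j assume "j \<in> (\<lambda>(i, l). i * N0 + l) ` (SIGMA i:{..<k}. - orders_at (zs ! i) U)"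
    then obtain i l where il: "i < k" "l \<notin> orders_at (zs ! i) U" "j = i * N0 + l" by auto
    have "l < N0" using miss[of "zs ! i" l] il zs by (auto simp: k_def)
    then show "j \<in> - chain_vals \<xi> U" using block[of i l] il by simp
  qed
  moreover have "inj_on (\<lambda>(i, l). i * N0 + l) (SIGMA i:{..<k}. - orders_at (zs ! i) U)"
  proof (rule inj_onI, clarify)
    fix i l i' l'
    assume a: "i < k" "l \<notin> orders_at (zs ! i) U" "i' < k" "l' \<notin> orders_at (zs ! i') U"
      and e: "i * N0 + l = i' * N0 + l'"
    have "l < N0" "l' < N0" using miss[of "zs ! i" l] miss[of "zs ! i'" l'] a zs by (auto simp: k_def)
    then have "(i * N0 + l) div N0 = i" "(i' * N0 + l') div N0 = i'" by simp_all
    with e show "i = i' \<and> l = l'" by auto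
  qed
  ultimately have "card (- chain_vals \<xi> U) = card (SIGMA i:{..<k}. - orders_at (zs ! i) U)"
    by (simp add: card_image)
  also have "\<dots> = (\<Sum>i<k. card (- orders_at (zs ! i) U))" using finI by (intro card_SigmaI) auto
  also have "\<dots> = (\<Sum>\<zeta>\<in>Z. card (- orders_at \<zeta> U))"
    using zs by (intro sum.reindex_bij_betw[OF bij_betw_nth]) (auto simp: k_def)
  finally show ?thesis using missing_chain_vals_eq[OF U fin ideal] by simp
qed

section \<open>The denominator of the weight\<close>

text \<open>\<open>B \<eta> + 2 A \<eta>'\<close> over \<open>D \<eta>\<close> is \<open>q + 2 p \<eta>'/\<eta>\<close>. The exponents of \<open>\<eta>\<close> are chosen so that this has no pole:
where \<open>p \<noteq> 0\<close> the residues of the two summands cancel, and at a zero of \<open>p\<close> neither has a pole.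
Points that are not zeros of \<open>A\<close> contribute nothing, because no order is missing there.\<close>
lemma denominator_structure:
  fixes A B C D :: "complex poly"
  defines "U \<equiv> inv_space A B C D"
  defines "\<eta> \<equiv> \<Prod>\<zeta> | poly A \<zeta> = 0. [:-\<zeta>, 1:] ^ card (- orders_at \<zeta> U)"
  assumes A: "A \<noteq> 0" and D: "D \<noteq> 0" and fin: "finite (- degrees U)"
  shows "D dvd A" "\<eta> \<noteq> 0" "D * \<eta> dvd B * \<eta> + 2 * A * pderiv \<eta>" "degree \<eta> = card (- degrees U)"
proof -
  have U: "poly_subspace U" unfolding U_def by (rule poly_subspace_inv_space)
  have finI: "finite (- orders_at \<zeta> U)" for \<zeta> by (rule finite_missing_orders[OF U fin])
  have inv: "\<exists>g\<in>U. A * pderiv (pderiv f) + B * pderiv f + C * f = D * g" if "f \<in> U" for f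
    using inv_space_invariant[of f A B C D] that by (simp add: U_def poly_op_def)
  let ?c = "\<lambda>\<zeta>. card (- orders_at \<zeta> U)"
  have ord_le: "order \<zeta> D \<le> order \<zeta> A" for \<zeta> by (rule local_structure(1)[OF A D finI inv])
  show DA: "D dvd A"
    by (rule dvd_if_order_dvd[OF D]) (simp only: order_divides ord_le simp_thms)
  \<comment> \<open>A common form of the two cases \<open>p(\<zeta>) \<noteq> 0\<close> and \<open>p(\<zeta>) = 0\<close>.\<close>
  have key: "[:-\<zeta>, 1:] ^ Suc (order \<zeta> D) dvd [:-\<zeta>, 1:] * B + smult (2 * of_nat (?c \<zeta>)) A" for \<zeta>
  proof (cases "order \<zeta> A = order \<zeta> D")
    case True
    then show ?thesis using local_structure(2)[OF A D finI inv True] by (simp only:)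
  next
    case False
    with ord_le[of \<zeta>] have lt: "order \<zeta> D < order \<zeta> A" by simp
    have "[:-\<zeta>, 1:] ^ order \<zeta> D dvd B" by (rule local_structure(3)[OF A D finI inv lt])
    then have "[:-\<zeta>, 1:] ^ Suc (order \<zeta> D) dvd [:-\<zeta>, 1:] * B"
      unfolding power_Suc by (rule mult_dvd_mono[OF dvd_refl])
    moreover have "[:-\<zeta>, 1:] ^ Suc (order \<zeta> D) dvd A" using lt by (simp only: order_divides Suc_le_eq simp_thms)
    ultimately show ?thesis by (intro dvd_add dvd_smult)
  qed
  have finZ: "finite {\<zeta>. poly A \<zeta> = 0}" by (rule poly_roots_finite[OF A])
  show \<eta>0: "\<eta> \<noteq> 0" unfolding \<eta>_def using finZ by simp
  have c0: "?c \<zeta> = 0" if "poly A \<zeta> \<noteq> 0" for \<zeta>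
  proof -
    have "order \<zeta> A = 0" using that by (rule order_0I)
    then have "order \<zeta> D = 0" using ord_le[of \<zeta>] by simp
    then have "poly ([:-\<zeta>, 1:] * B + smult (2 * of_nat (?c \<zeta>)) A) \<zeta> = 0"
      unfolding poly_eq_0_iff_dvd using key[of \<zeta>] by (simp only: power_Suc power_0 mult_1_right)
    then show ?thesis using that by simp
  qed
  have ord_prod: "order \<zeta> (\<Prod>x\<in>Z. [:-x, 1:] ^ n x) = (if \<zeta> \<in> Z then n \<zeta> else 0)" if "finite Z" for \<zeta> :: complex and Z n
    using that
  proof (induction Z)
    case (insert x Z)
    have nz: "[:-x, 1:] ^ n x * (\<Prod>x\<in>Z. [:-x, 1:] ^ n x) \<noteq> 0" using insert.hyps by simp
    have "order \<zeta> ([:-x, 1:] ^ n x) = (if \<zeta> = x then n x else 0)"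
      by (cases "\<zeta> = x") (auto simp: order_power_n_n intro!: order_0I)
    then show ?case using insert order_mult[OF nz, of \<zeta>] by auto
  qed simp
  have ord\<eta>: "order \<zeta> \<eta> = ?c \<zeta>" for \<zeta>
    unfolding \<eta>_def ord_prod[OF finZ] using c0[of \<zeta>] by simp
  show "D * \<eta> dvd B * \<eta> + 2 * A * pderiv \<eta>"
  proof (rule dvd_if_order_dvd)
    show nz: "D * \<eta> \<noteq> 0" using D \<eta>0 by simp
    fix \<zeta> :: complex
    define t where "t = [:-\<zeta>, 1:]"
    have t0: "t \<noteq> 0" by (simp add: t_def)
    obtain N where N: "\<eta> = t ^ ?c \<zeta> * N" using order_1[of \<zeta> \<eta>] unfolding ord\<eta> t_def by blast
    have e: "t * pderiv \<eta> = t ^ ?c \<zeta> * (of_nat (?c \<zeta>) * N + t * pderiv N)"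
      unfolding N t_def by (rule euler_derivative)
    have "t * (B * \<eta> + 2 * A * pderiv \<eta>) = (t * B) * \<eta> + 2 * A * (t * pderiv \<eta>)"
      by (simp only: distrib_left ac_simps)
    also have "\<dots> = t ^ ?c \<zeta> * ((t * B + 2 * of_nat (?c \<zeta>) * A) * N + 2 * (t * A) * pderiv N)"
      unfolding e unfolding N by (simp only: distrib_left distrib_right ac_simps)
    also have "2 * of_nat (?c \<zeta>) * A = smult (2 * of_nat (?c \<zeta>)) A"
      by (metis mult_smult_left numeral_mult_conv_smult of_nat_poly_smult smult_smult mult.assoc)
    finally have eq: "t * (B * \<eta> + 2 * A * pderiv \<eta>) =
      t ^ ?c \<zeta> * ((t * B + smult (2 * of_nat (?c \<zeta>)) A) * N + 2 * (t * A) * pderiv N)" .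
    have "t ^ order \<zeta> D dvd A" using DA order_1[of \<zeta> D] unfolding t_def by (rule dvd_trans[rotated])
    then have tA: "t ^ Suc (order \<zeta> D) dvd t * A" unfolding power_Suc by (rule mult_dvd_mono[OF dvd_refl])
    have "t ^ Suc (order \<zeta> D) dvd (t * B + smult (2 * of_nat (?c \<zeta>)) A) * N + 2 * (t * A) * pderiv N"
      by (rule dvd_add[OF dvd_mult2[OF key[of \<zeta>, folded t_def]] dvd_mult2[OF dvd_mult[OF tA]]])
    then have "t ^ ?c \<zeta> * t ^ Suc (order \<zeta> D) dvd t * (B * \<eta> + 2 * A * pderiv \<eta>)"
      unfolding eq by (rule mult_dvd_mono[OF dvd_refl])
    also have "t ^ ?c \<zeta> * t ^ Suc (order \<zeta> D) = t * t ^ (order \<zeta> D + ?c \<zeta>)"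
      by (simp only: power_add power_Suc ac_simps)
    finally have "t ^ (order \<zeta> D + ?c \<zeta>) dvd B * \<eta> + 2 * A * pderiv \<eta>"
      using t0 by (simp only: dvd_mult_cancel_left simp_thms)
    then show "[:-\<zeta>, 1:] ^ order \<zeta> (D * \<eta>) dvd B * \<eta> + 2 * A * pderiv \<eta>"
      unfolding order_mult[OF nz] ord\<eta> t_def .
  qed
  have "card (- degrees U) = (\<Sum>\<zeta> | poly A \<zeta> = 0. ?c \<zeta>)"
  proof (rule sum_local_codimensions[OF U fin finZ])
    fix f assume f: "\<And>x. x \<in> {\<zeta>. poly A \<zeta> = 0} \<Longrightarrow> in_closure U x f"
    have "poly A \<zeta> = 0" if "poly D \<zeta> = 0" for \<zeta> using DA that by auto
    then show "f \<in> U" using f D unfolding U_def by (intro inv_space_local) auto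
  qed
  also have "\<dots> = degree \<eta>"
    unfolding \<eta>_def by (subst degree_prod_eq_sum_degree) (auto simp: degree_power_eq)
  finally show "degree \<eta> = card (- degrees U)" by simp
qed

section \<open>Descent to real polynomials\<close>
abbreviation cpoly :: "real poly \<Rightarrow> complex poly" where "cpoly \<equiv> map_poly complex_of_real"
abbreviation repoly :: "complex poly \<Rightarrow> real poly" where "repoly \<equiv> map_poly Re"
abbreviation cnjpoly :: "complex poly \<Rightarrow> complex poly" where "cnjpoly \<equiv> map_poly cnj"

lemma cpoly_add [simp]: "cpoly (f + g) = cpoly f + cpoly g"
  by (intro poly_eqI) (simp add: coeff_map_poly coeff_mult coeff_pderiv)

lemma cpoly_mult [simp]: "cpoly (f * g) = cpoly f * cpoly g"
  by (intro poly_eqI) (simp add: coeff_map_poly coeff_mult coeff_pderiv)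

lemma cpoly_pderiv [simp]: "cpoly (pderiv f) = pderiv (cpoly f)"
  by (intro poly_eqI) (simp add: coeff_map_poly coeff_mult coeff_pderiv)

lemma cpoly_eq_0_iff [simp]: "cpoly f = 0 \<longleftrightarrow> f = 0"
  by (simp add: map_poly_eq_0_iff)

lemma cnjpoly_add [simp]: "cnjpoly (f + g) = cnjpoly f + cnjpoly g"
  by (intro poly_eqI) (simp add: coeff_map_poly coeff_mult coeff_pderiv)

lemma cnjpoly_mult [simp]: "cnjpoly (f * g) = cnjpoly f * cnjpoly g"
  by (intro poly_eqI) (simp add: coeff_map_poly coeff_mult coeff_pderiv)

lemma cnjpoly_pderiv [simp]: "cnjpoly (pderiv f) = pderiv (cnjpoly f)"
  by (intro poly_eqI) (simp add: coeff_map_poly coeff_mult coeff_pderiv)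

lemma cnjpoly_eq_0_iff [simp]: "cnjpoly f = 0 \<longleftrightarrow> f = 0"
  by (simp add: map_poly_eq_0_iff)

lemma cpoly_smult [simp]: "cpoly (smult c f) = smult (complex_of_real c) (cpoly f)"
  by (intro poly_eqI) (simp add: coeff_map_poly coeff_mult coeff_pderiv)

lemma degree_cpoly [simp]: "degree (cpoly f) = degree f"
  by (simp add: degree_map_poly)

lemma cnjpoly_cpoly [simp]: "cnjpoly (cpoly a) = cpoly a"
  by (intro poly_eqI) (simp add: coeff_map_poly coeff_mult coeff_pderiv)

lemma cnjpoly_cnjpoly [simp]: "cnjpoly (cnjpoly f) = f"
  by (intro poly_eqI) (simp add: coeff_map_poly coeff_mult coeff_pderiv)

lemma repoly_add [simp]: "repoly (f + g) = repoly f + repoly g"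
  by (intro poly_eqI) (simp add: coeff_map_poly coeff_mult coeff_pderiv)

lemma repoly_cpoly_mult [simp]: "repoly (cpoly a * f) = a * repoly f"
  by (intro poly_eqI) (simp add: coeff_map_poly coeff_mult coeff_pderiv)

lemma repoly_pderiv [simp]: "repoly (pderiv f) = pderiv (repoly f)"
  by (intro poly_eqI) (simp add: coeff_map_poly coeff_mult coeff_pderiv)

lemma repoly_smult [simp]: "repoly (smult (complex_of_real c) f) = smult c (repoly f)"
  by (intro poly_eqI) (simp add: coeff_map_poly coeff_mult coeff_pderiv)

lemma repoly_cpoly [simp]: "repoly (cpoly a) = a"
  by (intro poly_eqI) (simp add: coeff_map_poly coeff_mult coeff_pderiv)

lemma cnjpoly_linear: "cnjpoly [:-\<zeta>, 1:] = [:-cnj \<zeta>, 1:]"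
  by (simp add: map_poly_pCons)

lemma cnjpoly_power: "cnjpoly (f ^ n) = cnjpoly f ^ n"
  by (induction n) simp_all

lemma cnjpoly_prod: "cnjpoly (prod f S) = (\<Prod>x\<in>S. cnjpoly (f x))"
  by (induction S rule: infinite_finite_induct) simp_all

lemma cnjpoly_fixed: "cnjpoly f = f \<Longrightarrow> cpoly (repoly f) = f"
proof (intro poly_eqI)
  fix n assume "cnjpoly f = f"
  then have "cnj (coeff f n) = coeff f n" by (metis coeff_map_poly complex_cnj_zero)
  then show "coeff (cpoly (repoly f)) n = coeff f n"
    by (simp add: coeff_map_poly complex_eq_iff)
qed

lemma order_cnjpoly:
  assumes "f \<noteq> 0"
  shows "order (cnj \<zeta>) (cnjpoly f) = order \<zeta> f"
proof -
  have *: "[:-\<zeta>, 1:] ^ j dvd f \<Longrightarrow> [:-cnj \<zeta>, 1:] ^ j dvd cnjpoly f" for j \<zeta> f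
    by (metis cnjpoly_linear cnjpoly_power cnjpoly_mult dvd_def)
  have "[:-cnj \<zeta>, 1:] ^ j dvd cnjpoly f \<longleftrightarrow> [:-\<zeta>, 1:] ^ j dvd f" for j
    using *[of \<zeta> j f] *[of "cnj \<zeta>" j "cnjpoly f"] by auto
  with assms have "j \<le> order (cnj \<zeta>) (cnjpoly f) \<longleftrightarrow> j \<le> order \<zeta> f" for j by (simp add: order_divides)
  then show ?thesis by (metis order_antisym order_refl)
qed

lemma cnjpoly_inv_space:
  assumes "f \<in> inv_space (cpoly a) (cpoly b) (cpoly c) (cpoly d)"
  shows "cnjpoly f \<in> inv_space (cpoly a) (cpoly b) (cpoly c) (cpoly d)"
proof -
  obtain g where g: "g 0 = f" "\<forall>n. poly_op (cpoly a) (cpoly b) (cpoly c) (g n) = cpoly d * g (Suc n)"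
    using assms by (auto simp: inv_space_def)
  have "poly_op (cpoly a) (cpoly b) (cpoly c) (cnjpoly h) = cnjpoly (poly_op (cpoly a) (cpoly b) (cpoly c) h)" for h
    by (simp add: poly_op_def)
  with g show ?thesis by (auto simp: inv_space_def intro!: exI[of _ "\<lambda>n. cnjpoly (g n)"])
qed

text \<open>For real coefficients the invariant space is stable under complex conjugation, so conjugate points
miss the same number of orders and \<open>\<eta>\<close> is real; taking real parts of the coefficients
then makes the quotients real.\<close>
lemma real_denominator_structure:
  fixes a b c d :: "real poly"
  defines "U \<equiv> inv_space (cpoly a) (cpoly b) (cpoly c) (cpoly d)"
  assumes a: "a \<noteq> 0" and d: "d \<noteq> 0" and fin: "finite (- degrees U)"
  obtains P Q \<eta> where "a = d * P" "\<eta> \<noteq> 0" "b * \<eta> + 2 * a * pderiv \<eta> = d * \<eta> * Q"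
    "degree \<eta> = card (- degrees U)"
proof -
  define c' where "c' = (\<lambda>\<zeta>. card (- orders_at \<zeta> U))"
  define \<eta> where "\<eta> = (\<Prod>\<zeta> | poly (cpoly a) \<zeta> = 0. [:-\<zeta>, 1:] ^ c' \<zeta>)"
  have a': "cpoly a \<noteq> 0" and d': "cpoly d \<noteq> 0" using a d by auto
  note den = denominator_structure[OF a' d' fin[unfolded U_def]]
  have st: "cpoly d dvd cpoly a" "\<eta> \<noteq> 0" "degree \<eta> = card (- degrees U)"
    "cpoly d * \<eta> dvd cpoly b * \<eta> + 2 * cpoly a * pderiv \<eta>"
    unfolding \<eta>_def c'_def U_def by (fact den)+
  have sub: "orders_at \<zeta> U \<subseteq> orders_at (cnj \<zeta>) U" for \<zeta>
  proof
    fix j assume "j \<in> orders_at \<zeta> U"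
    then obtain f where f: "f \<in> U" "f \<noteq> 0" "j = order \<zeta> f" by (auto simp: orders_at_def)
    then have "cnjpoly f \<in> U - {0}" using cnjpoly_inv_space by (auto simp: U_def)
    moreover have "j = order (cnj \<zeta>) (cnjpoly f)" using f order_cnjpoly[of f \<zeta>] by simp
    ultimately show "j \<in> orders_at (cnj \<zeta>) U" unfolding orders_at_def by blast
  qed
  have c'_cnj: "c' (cnj \<zeta>) = c' \<zeta>" for \<zeta>
    using sub[of \<zeta>] sub[of "cnj \<zeta>"] unfolding c'_def by (simp add: subset_antisym)
  have "poly (cpoly a) (cnj \<zeta>) = cnj (poly (cpoly a) \<zeta>)" for \<zeta>
    using poly_cnj[of "cpoly a" \<zeta>] by simp
  then have "cnjpoly \<eta> = \<eta>"
    unfolding \<eta>_def cnjpoly_prod cnjpoly_power cnjpoly_linear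
    by (intro prod.reindex_bij_witness[of _ cnj cnj]) (auto simp: c'_cnj)
  then have e: "cpoly (repoly \<eta>) = \<eta>" by (rule cnjpoly_fixed)
  obtain P where P: "cpoly a = cpoly d * P" using st(1) by blast
  have "a = repoly (cpoly a)" by simp
  also have "\<dots> = d * repoly P" unfolding P by simp
  finally have 1: "a = d * repoly P" .
  obtain Q where Q: "cpoly b * \<eta> + 2 * cpoly a * pderiv \<eta> = cpoly d * \<eta> * Q" using st(4) by blast
  have "b * repoly \<eta> + 2 * a * pderiv (repoly \<eta>) = repoly (cpoly (b * repoly \<eta> + (a + a) * pderiv (repoly \<eta>)))"
    by (simp only: repoly_cpoly mult_2)
  also have "cpoly (b * repoly \<eta> + (a + a) * pderiv (repoly \<eta>)) = cpoly (d * repoly \<eta>) * Q"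
    by (simp only: cpoly_add cpoly_mult cpoly_pderiv e Q[unfolded mult_2])
  finally have 2: "b * repoly \<eta> + 2 * a * pderiv (repoly \<eta>) = d * repoly \<eta> * repoly Q"
    by (simp only: repoly_cpoly_mult)
  have 3: "repoly \<eta> \<noteq> 0" using e st(2) by (metis cpoly_eq_0_iff)
  have 4: "degree (repoly \<eta>) = card (- degrees U)" using e st(3) by (metis degree_cpoly)
  from that[OF 1 3 2 4] show ?thesis .
qed

section \<open>Behaviour at infinity and eigenpolynomials in every degree\<close>
lemma coeff_mult_top:
  fixes F G :: "complex poly"
  assumes "degree F \<le> i" "degree G \<le> j"
  shows "coeff (F * G) (i + j) = coeff F i * coeff G j"
proof -
  have "coeff F k * coeff G (i + j - k) = 0" if "k \<noteq> i" "k \<le> i + j" for k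
  proof (cases "k < i")
    case True
    then have "coeff G (i + j - k) = 0" using assms by (intro coeff_eq_0) auto
    then show ?thesis by simp
  next
    case False
    then have "coeff F k = 0" using assms that by (intro coeff_eq_0) auto
    then show ?thesis by simp
  qed
  then have "(\<Sum>k\<le>i + j. coeff F k * coeff G (i + j - k)) = (\<Sum>k\<in>{i}. coeff F k * coeff G (i + j - k))"
    by (intro sum.mono_neutral_right) auto
  then show ?thesis by (simp add: coeff_mult)
qed

lemma degree_pderiv_twice_le: "degree (pderiv (pderiv f)) \<le> degree f - 2" for f :: "complex poly"
  using degree_pderiv[of f] degree_pderiv[of "pderiv f"] by linarith

text \<open>At infinity \<open>T\<close> acts on leading coefficients through an indicial polynomial.\<close>
lemma poly_op_top:
  assumes A: "degree A \<le> M + 2" and B: "degree B \<le> M + 1" and C: "degree C \<le> M"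
    and f: "degree f \<le> k"
  shows "degree (poly_op A B C f) \<le> M + k"
    and "coeff (poly_op A B C f) (M + k) = indicial (coeff A (M + 2)) (coeff B (M + 1)) (coeff C M) k * coeff f k"
proof -
  have CC: "degree (C * f) \<le> M + k" "coeff (C * f) (M + k) = coeff C M * coeff f k"
    using C f degree_mult_le[of C f] coeff_mult_top[OF C f] by auto
  have BB: "degree (B * pderiv f) \<le> M + k \<and> coeff (B * pderiv f) (M + k) = of_nat k * coeff B (M + 1) * coeff f k"
  proof (cases k)
    case 0
    then have "pderiv f = 0" using f by (simp add: pderiv_eq_0_iff)
    with 0 show ?thesis by simp
  next
    case (Suc j)
    have f': "degree (pderiv f) \<le> j" using degree_pderiv[of f] f Suc by simp
    have "coeff (B * pderiv f) ((M + 1) + j) = coeff B (M + 1) * coeff (pderiv f) j" by (rule coeff_mult_top[OF B f'])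
    moreover have "degree (B * pderiv f) \<le> M + k" using degree_mult_le[of B "pderiv f"] B f' Suc by simp
    ultimately show ?thesis using Suc by (simp add: coeff_pderiv algebra_simps)
  qed
  have AA: "degree (A * pderiv (pderiv f)) \<le> M + k \<and>
      coeff (A * pderiv (pderiv f)) (M + k) = of_nat k * (of_nat k - 1) * coeff A (M + 2) * coeff f k"
  proof (cases "k < 2")
    case True
    then have "degree (pderiv f) = 0" using degree_pderiv[of f] f by simp
    then have "pderiv (pderiv f) = 0" by (simp add: pderiv_eq_0_iff)
    moreover have "(of_nat k :: complex) * (of_nat k - 1) = 0" using True by (cases k) auto
    ultimately show ?thesis by simp
  next
    case False
    then obtain j where k: "k = j + 2" by (metis add.commute le_Suc_ex not_less)
    have f': "degree (pderiv (pderiv f)) \<le> j" using degree_pderiv_twice_le[of f] f k by simp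
    have "coeff (A * pderiv (pderiv f)) ((M + 2) + j) = coeff A (M + 2) * coeff (pderiv (pderiv f)) j"
      by (rule coeff_mult_top[OF A f'])
    moreover have "degree (A * pderiv (pderiv f)) \<le> M + k"
      using degree_mult_le[of A "pderiv (pderiv f)"] A f' k by simp
    ultimately show ?thesis using k by (simp add: coeff_pderiv algebra_simps)
  qed
  show "degree (poly_op A B C f) \<le> M + k"
    unfolding poly_op_def using AA BB CC by (intro degree_add_le) auto
  show "coeff (poly_op A B C f) (M + k) = indicial (coeff A (M + 2)) (coeff B (M + 1)) (coeff C M) k * coeff f k"
    unfolding poly_op_def indicial_def using AA BB CC by (simp add: algebra_simps)
qed

lemma degree_le_if_top_coeff_0: "degree f \<le> Suc n \<Longrightarrow> coeff f (Suc n) = 0 \<Longrightarrow> degree f \<le> n" for f :: "complex poly"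
  by (metis degree_0 leading_coeff_0_iff le_Suc_eq le0)

text \<open>Otherwise \<open>T\<close> would raise the degree for all but two degrees, whereas it preserves the degrees of
infinitely many eigenpolynomials.\<close>
lemma coefficient_degree_bounds:
  assumes D: "D \<noteq> 0" and S: "infinite S"
    and eig: "\<And>k. k \<in> S \<Longrightarrow> \<exists>f \<mu>. f \<noteq> 0 \<and> degree f = k \<and> poly_op A B C f = D * smult \<mu> f"
  shows "degree A \<le> degree D + 2 \<and> degree B \<le> degree D + 1 \<and> degree C \<le> degree D"
proof -
  define G where "G M \<longleftrightarrow> degree A \<le> M + 2 \<and> degree B \<le> M + 1 \<and> degree C \<le> M" for M
  define M where "M = (LEAST M. G M)"
  have "G (degree A + degree B + degree C)" by (simp add: G_def)
  then have GM: "G M" unfolding M_def by (rule LeastI)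
  have "M \<le> degree D"
  proof (rule ccontr)
    assume "\<not> M \<le> degree D"
    then obtain M' where M': "M = Suc M'" "degree D \<le> M'" by (cases M) auto
    have root: "indicial (coeff A (M + 2)) (coeff B (M + 1)) (coeff C M) k = 0" if k: "k \<in> S" for k
    proof -
      obtain f \<mu> where f: "f \<noteq> 0" "degree f = k" "poly_op A B C f = D * smult \<mu> f" using eig[OF k] by blast
      have "degree (D * smult \<mu> f) \<le> degree D + k"
        using degree_mult_le[of D "smult \<mu> f"] degree_smult_le[of \<mu> f] f(2) by linarith
      then have "coeff (poly_op A B C f) (M + k) = 0" unfolding f(3) using M' by (intro coeff_eq_0) simp
      moreover have "coeff f k \<noteq> 0" using f by auto
      ultimately show ?thesis using poly_op_top(2)[of A M B C f k] GM f(2) by (simp add: G_def)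
    qed
    obtain T where T: "T \<subseteq> S" "card T = 3" using infinite_arbitrarily_large[OF S, of 3] by blast
    then obtain i j k where "T = {i, j, k}" "i \<noteq> j" "i \<noteq> k" "j \<noteq> k" by (auto simp: card_3_iff)
    with T root have "coeff A (M + 2) = 0 \<and> coeff B (M + 1) = 0 \<and> coeff C M = 0"
      by (intro indicial_three_roots[of _ _ _ i j k]) auto
    then have "G M'" using GM M' by (auto simp: G_def intro!: degree_le_if_top_coeff_0)
    then have "M \<le> M'" unfolding M_def by (rule Least_le)
    with M' show False by simp
  qed
  with GM show ?thesis by (auto simp: G_def)
qed

text \<open>Linear algebra of a triangular operator without generalized eigenvectors of rank two. By induction
the part of \<open>U\<close> of degree below \<open>k\<close> is spanned by eigenpolynomials, hence is the sum of the kernel and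
the image of \<open>T - ev k\<close>. Start from any \<open>f\<close> of degree \<open>k\<close>: \<open>(T - ev k) f\<close> has smaller degree, and
subtracting from \<open>f\<close> a preimage of its image part leaves an element that \<open>(T - ev k)\<^sup>2\<close> kills.\<close>
lemma eigen_in_every_degree:
  fixes A B C D :: "complex poly"
  defines "U \<equiv> inv_space A B C D"
  defines "ev \<equiv> \<lambda>k. indicial (coeff A (degree D + 2)) (coeff B (degree D + 1)) (coeff C (degree D)) k / lead_coeff D"
  assumes D: "D \<noteq> 0"
    and deg: "degree A \<le> degree D + 2" "degree B \<le> degree D + 1" "degree C \<le> degree D"
    and simple: "\<And>k f g. poly_op A B C f = D * (smult (ev k) f + g) \<Longrightarrow> poly_op A B C g = D * smult (ev k) g \<Longrightarrow> g = 0"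
    and k: "k \<in> degrees U"
  shows "\<exists>e. e \<in> U \<and> e \<noteq> 0 \<and> degree e = k \<and> poly_op A B C e = D * smult (ev k) e"
  using k
proof (induction k rule: less_induct)
  case (less k)
  note smaller = less.IH
  have U: "poly_subspace U" unfolding U_def by (rule poly_subspace_inv_space)
  have Ud: "f - g \<in> U" if "f \<in> U" "g \<in> U" for f g using poly_subspace_diff[OF U that] .
  have Us: "smult c f \<in> U" if "f \<in> U" for c f using U that by (auto simp: poly_subspace_def)
  have Ua: "f + g \<in> U" if "f \<in> U" "g \<in> U" for f g using U that by (auto simp: poly_subspace_def)
  have U0: "0 \<in> U" using U by (auto simp: poly_subspace_def)
  \<comment> \<open>\<open>h = k0 + (T - ev k) s\<close> with \<open>k0\<close> in the kernel of \<open>T - ev k\<close>\<close>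
  define good where "good h \<longleftrightarrow> (\<exists>s k0. s \<in> U \<and> k0 \<in> U \<and> (s = 0 \<or> degree s < k) \<and>
    poly_op A B C s = D * (smult (ev k) s + (h - k0)) \<and> poly_op A B C k0 = D * smult (ev k) k0)" for h
  have good: "good h" if "h \<in> U" "h = 0 \<or> degree h < k" for h
    using that
  proof (induction "degree h" arbitrary: h rule: less_induct)
    case (less h)
    show ?case
    proof (cases "h = 0")
      case True
      then show ?thesis using U0 by (auto simp: good_def poly_op_def intro!: exI[of _ 0])
    next
      case False
      let ?j = "degree h"
      have j: "?j \<in> degrees U" "?j < k" using False less.prems by (auto simp: degrees_def)
      from less.prems(2) False have jk: "?j < k" by simp
      obtain e where e: "e \<in> U" "e \<noteq> 0" "degree e = ?j" "poly_op A B C e = D * smult (ev ?j) e"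
        using smaller[OF jk j(1)] by blast
      define c where "c = lead_coeff h / lead_coeff e"
      define h' where "h' = h - smult c e"
      have h'U: "h' \<in> U" unfolding h'_def using less.prems e by (intro Ud Us)
      have "degree h' \<le> ?j" unfolding h'_def using e(3) by (intro degree_diff_le) (auto intro: order.trans[OF degree_smult_le])
      moreover have "coeff e ?j \<noteq> 0" using e(2,3) by (metis leading_coeff_0_iff)
      then have "coeff h' ?j = 0" using e(3) by (simp add: h'_def c_def)
      ultimately have h'lt: "h' = 0 \<or> degree h' < ?j"
        by (metis le_neq_implies_less leading_coeff_0_iff)
      have "good h'"
      proof (cases "h' = 0")
        case True
        then show ?thesis using U0 by (auto simp: good_def poly_op_def intro!: exI[of _ 0])
      next
        case False
        with h'lt show ?thesis using less.hyps[of h'] h'U jk by simp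
      qed
      then obtain s k0 where s: "s \<in> U" "k0 \<in> U" "s = 0 \<or> degree s < k"
        "poly_op A B C s = D * (smult (ev k) s + (h' - k0))" "poly_op A B C k0 = D * smult (ev k) k0"
        by (auto simp: good_def)
      show ?thesis
      proof (cases "ev ?j = ev k")
        case True
        have "poly_op A B C (k0 + smult c e) = D * smult (ev k) (k0 + smult c e)"
          unfolding poly_op_add poly_op_smult s(5) e(4) True by (simp add: algebra_simps smult_add_right)
        moreover have "h' - k0 = h - (k0 + smult c e)" by (simp add: h'_def)
        ultimately show ?thesis unfolding good_def
          using s e by (intro exI[of _ s] exI[of _ "k0 + smult c e"]) (auto intro!: Ua Us)
      next
        case False
        define x where "x = c / (ev ?j - ev k)"
        have x: "x * ev ?j = c + x * ev k" using False by (simp add: x_def field_simps)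
        have "smult x (smult (ev ?j) e) = smult c e + smult (ev k) (smult x e)"
          by (simp add: x smult_add_left mult.commute)
        then have "poly_op A B C (s + smult x e) = D * (smult (ev k) (s + smult x e) + (h - k0))"
          unfolding poly_op_add poly_op_smult s(4) e(4) mult_smult_right[symmetric]
          by (simp only: h'_def smult_add_right distrib_left[symmetric]) (simp add: algebra_simps)
        moreover have "degree (s + smult x e) < k \<or> s + smult x e = 0"
        proof -
          have "degree (smult x e) < k" using e jk by (auto intro: order.strict_trans1[OF degree_smult_le])
          then show ?thesis using s(3) by (auto intro: degree_add_less)
        qed
        ultimately show ?thesis unfolding good_def
          using s e by (intro exI[of _ "s + smult x e"] exI[of _ k0]) (auto intro!: Ua Us)
      qed
    qed
  qed
  obtain f where f: "f \<in> U" "f \<noteq> 0" "degree f = k" using less.prems by (auto simp: degrees_def)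
  obtain g where g: "g \<in> U" "poly_op A B C f = D * g" using inv_space_invariant[of f A B C D] f(1) by (auto simp: U_def)
  define h where "h = g - smult (ev k) f"
  have top: "degree (D * g) \<le> degree D + k"
    "coeff (D * g) (degree D + k) = ev k * lead_coeff D * coeff f k"
    using poly_op_top[OF deg, of f k] f(3) D unfolding g(2) by (auto simp: ev_def)
  have gk: "degree g \<le> k"
    using top(1) D by (cases "g = 0") (auto simp: degree_mult_eq)
  have "coeff g k = ev k * coeff f k"
    using top(2) D unfolding coeff_mult_top[OF order_refl gk] by simp
  then have "coeff h k = 0" by (simp add: h_def)
  moreover have "degree h \<le> k" unfolding h_def using gk f(3) by (intro degree_diff_le) (auto intro: order.trans[OF degree_smult_le])
  ultimately have "h = 0 \<or> degree h < k" by (metis le_neq_implies_less leading_coeff_0_iff)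
  moreover have "h \<in> U" unfolding h_def by (intro Ud Us g f)
  ultimately have "good h" by (rule good[rotated])
  then obtain s k0 where s: "s \<in> U" "s = 0 \<or> degree s < k" "poly_op A B C s = D * (smult (ev k) s + (h - k0))"
    "poly_op A B C k0 = D * smult (ev k) k0" by (auto simp: good_def)
  define e where "e = f - s"
  have "g = smult (ev k) f + h" by (simp add: h_def)
  then have "poly_op A B C e = D * (smult (ev k) e + k0)"
    unfolding e_def poly_op_diff g(2) s(3) by (simp add: algebra_simps smult_diff_right)
  moreover from simple[OF this s(4)] have "k0 = 0" .
  moreover have "coeff e k = coeff f k" using s(2) by (auto simp: e_def coeff_eq_0)
  then have "coeff e k \<noteq> 0" using f by auto
  then have "e \<noteq> 0" "k \<le> degree e" by (auto simp: le_degree)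
  moreover have "degree e \<le> k" unfolding e_def using f s(2) by (intro degree_diff_le) auto
  moreover have "e \<in> U" unfolding e_def by (intro Ud f s)
  ultimately show ?case by auto
qed

text \<open>The real part of \<open>- \<i> f\<close> is the imaginary part of \<open>f\<close>.\<close>
lemma complex_poly_eq_0_parts:
  assumes "repoly f = 0" "repoly (smult (- \<i>) f) = 0"
  shows "f = 0"
proof (rule poly_eqI)
  fix n
  have "Re (coeff f n) = 0" "Re (- \<i> * coeff f n) = 0"
    using arg_cong[OF assms(1), of "\<lambda>p. coeff p n"] arg_cong[OF assms(2), of "\<lambda>p. coeff p n"]
    by (simp_all add: coeff_map_poly)
  then show "coeff f n = coeff 0 n" by (simp add: complex_eq_iff)
qed

lemma repoly_poly_op:
  "repoly (poly_op (cpoly a) (cpoly b) (cpoly c) f) = a * pderiv (pderiv (repoly f)) + b * pderiv (repoly f) + c * repoly f"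
  by (simp add: poly_op_def)

text \<open>The eigenvalues are real, so real and imaginary parts of a generalized eigenpolynomial are generalized
eigenpolynomials again; a complex eigenpolynomial that is made monic has a real part of the same
degree.\<close>
lemma real_eigen_in_every_degree:
  fixes a b c d :: "real poly"
  assumes d: "d \<noteq> 0"
    and deg: "degree a \<le> degree d + 2" "degree b \<le> degree d + 1" "degree c \<le> degree d"
    and simple: "\<And>\<mu> f g. a * pderiv (pderiv f) + b * pderiv f + c * f = d * (smult \<mu> f + g) \<Longrightarrow>
      a * pderiv (pderiv g) + b * pderiv g + c * g = d * smult \<mu> g \<Longrightarrow> g = 0"
    and k: "k \<in> degrees (inv_space (cpoly a) (cpoly b) (cpoly c) (cpoly d))"
  shows "\<exists>e \<mu>. e \<noteq> 0 \<and> degree e = k \<and> a * pderiv (pderiv e) + b * pderiv e + c * e = d * smult \<mu> e"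
proof -
  let ?L = "poly_op (cpoly a) (cpoly b) (cpoly c)"
  define ev where "ev j = (of_nat j * (of_nat j - 1) * coeff a (degree d + 2) + of_nat j * coeff b (degree d + 1)
    + coeff c (degree d)) / lead_coeff d" for j
  have ev: "indicial (coeff (cpoly a) (degree (cpoly d) + 2)) (coeff (cpoly b) (degree (cpoly d) + 1))
      (coeff (cpoly c) (degree (cpoly d))) j / lead_coeff (cpoly d) = complex_of_real (ev j)" for j
    by (simp add: ev_def indicial_def coeff_map_poly)
  have smul: "repoly (smult (complex_of_real x) f + g) = smult x (repoly f) + repoly g" for x f g by simp
  have part: "repoly g = 0"
    if "?L f = cpoly d * (smult (complex_of_real x) f + g)" "?L g = cpoly d * smult (complex_of_real x) g" for f g x
  proof (rule simple)
    show "a * pderiv (pderiv (repoly f)) + b * pderiv (repoly f) + c * repoly f = d * (smult x (repoly f) + repoly g)"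
      unfolding repoly_poly_op[symmetric] that(1) by simp
    show "a * pderiv (pderiv (repoly g)) + b * pderiv (repoly g) + c * repoly g = d * smult x (repoly g)"
      unfolding repoly_poly_op[symmetric] that(2) by (simp only: repoly_cpoly_mult repoly_smult)
  qed
  have "\<exists>e. e \<in> inv_space (cpoly a) (cpoly b) (cpoly c) (cpoly d) \<and> e \<noteq> 0 \<and> degree e = k \<and>
      ?L e = cpoly d * smult (complex_of_real (ev k)) e"
    unfolding ev[symmetric]
  proof (rule eigen_in_every_degree[OF _ _ _ _ _ k])
    fix j f g
    assume 1: "?L f = cpoly d * (smult (indicial (coeff (cpoly a) (degree (cpoly d) + 2)) (coeff (cpoly b) (degree (cpoly d) + 1))
      (coeff (cpoly c) (degree (cpoly d))) j / lead_coeff (cpoly d)) f + g)"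
      and 2: "?L g = cpoly d * smult (indicial (coeff (cpoly a) (degree (cpoly d) + 2)) (coeff (cpoly b) (degree (cpoly d) + 1))
      (coeff (cpoly c) (degree (cpoly d))) j / lead_coeff (cpoly d)) g"
    note 1 = 1[unfolded ev] and 2 = 2[unfolded ev]
    have "repoly g = 0" by (rule part[OF 1 2])
    moreover have "repoly (smult (- \<i>) g) = 0"
    proof (rule part)
      show "?L (smult (- \<i>) f) = cpoly d * (smult (complex_of_real (ev j)) (smult (- \<i>) f) + smult (- \<i>) g)"
        unfolding poly_op_smult 1 by (simp only: mult_smult_right[symmetric] smult_add_right smult_smult mult.commute)
      show "?L (smult (- \<i>) g) = cpoly d * smult (complex_of_real (ev j)) (smult (- \<i>) g)"
        unfolding poly_op_smult 2 by (simp only: mult_smult_right[symmetric] smult_smult mult.commute)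
    qed
    ultimately show "g = 0" by (rule complex_poly_eq_0_parts)
  qed (use d deg in simp_all)
  then obtain e where e: "e \<noteq> 0" "degree e = k" "?L e = cpoly d * smult (complex_of_real (ev k)) e" by blast
  define e1 where "e1 = smult (1 / lead_coeff e) e"
  have e1: "?L e1 = cpoly d * smult (complex_of_real (ev k)) e1"
    unfolding e1_def poly_op_smult e(3) by (simp only: mult_smult_right[symmetric] smult_smult mult.commute)
  have "coeff (repoly e1) k = 1" using e by (auto simp: e1_def coeff_map_poly)
  moreover have "degree (repoly e1) \<le> k"
    using e by (intro degree_le) (auto simp: e1_def coeff_map_poly coeff_eq_0)
  moreover from calculation(1) have "k \<le> degree (repoly e1)" "repoly e1 \<noteq> 0" by (auto intro: le_degree)
  ultimately have "degree (repoly e1) = k" "repoly e1 \<noteq> 0" by auto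
  moreover have "a * pderiv (pderiv (repoly e1)) + b * pderiv (repoly e1) + c * repoly e1 = d * smult (ev k) (repoly e1)"
    unfolding repoly_poly_op[symmetric] e1 by (simp only: repoly_cpoly_mult repoly_smult)
  ultimately show ?thesis by blast
qed

section \<open>Linear differential equations of first order\<close>
lemma proportional_solutions:
  fixes Y E \<rho> :: "real \<Rightarrow> real"
  assumes S: "convex S" "open S"
    and Y: "\<And>z. z \<in> S \<Longrightarrow> (Y has_real_derivative \<rho> z * Y z) (at z)"
    and E: "\<And>z. z \<in> S \<Longrightarrow> (E has_real_derivative \<rho> z * E z) (at z)" "\<And>z. z \<in> S \<Longrightarrow> E z \<noteq> 0"
  shows "\<exists>k. \<forall>z\<in>S. Y z = k * E z"
proof -
  have "((\<lambda>z. Y z / E z) has_real_derivative 0) (at z within S)" if "z \<in> S" for z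
  proof -
    have "((\<lambda>z. Y z / E z) has_real_derivative (\<rho> z * Y z * E z - Y z * (\<rho> z * E z)) / (E z * E z)) (at z)"
      by (rule DERIV_divide[OF Y E]) (use that E in auto)
    then show ?thesis by (simp add: algebra_simps has_field_derivative_at_within)
  qed
  from has_field_derivative_zero_constant[OF S(1) this] obtain k where "\<forall>z\<in>S. Y z / E z = k" by blast
  then show ?thesis using E(2) by (intro exI[of _ k]) (auto simp: field_simps)
qed

text \<open>\<open>Y\<close> is a nonzero multiple of the exponential of an antiderivative of \<open>\<rho>\<close>, which stays continuous and
positive up to the ends of the interval.\<close>
lemma regular_boundary:
  fixes Y \<rho> :: "real \<Rightarrow> real"
  assumes lu: "l < u" and \<rho>: "continuous_on {l..u} \<rho>"
    and Y: "\<And>z. z \<in> {l<..<u} \<Longrightarrow> (Y has_real_derivative \<rho> z * Y z) (at z)"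
    and nz: "\<And>z. z \<in> {l<..<u} \<Longrightarrow> Y z \<noteq> 0"
  shows "\<not> (Y \<longlongrightarrow> 0) (at_right l)" "\<not> (Y \<longlongrightarrow> 0) (at_left u)"
proof -
  obtain G where G: "\<And>z. z \<in> {l..u} \<Longrightarrow> (G has_vector_derivative \<rho> z) (at z within {l..u})"
    using antiderivative_continuous[OF \<rho>] by blast
  have Gd: "(G has_real_derivative \<rho> z) (at z)" if "z \<in> {l<..<u}" for z
    using G[of z] that by (simp add: has_real_derivative_iff_has_vector_derivative at_within_Icc_at)
  have "continuous_on {l..u} G"
    by (rule continuous_on_vector_derivative[OF G])
  then have cE: "continuous_on {l..u} (\<lambda>z. exp (G z))" by (intro continuous_intros)
  have "((\<lambda>z. exp (G z)) has_real_derivative \<rho> z * exp (G z)) (at z)" if "z \<in> {l<..<u}" for z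
    using Gd[OF that] by (auto intro!: derivative_eq_intros)
  then obtain k where k: "\<And>z. z \<in> {l<..<u} \<Longrightarrow> Y z = k * exp (G z)"
    using proportional_solutions[of "{l<..<u}" Y \<rho> "\<lambda>z. exp (G z)"] Y by auto
  have "(l + u) / 2 \<in> {l<..<u}" using lu by auto
  then have k0: "k \<noteq> 0" using k nz by fastforce
  have "((\<lambda>z. exp (G z)) \<longlongrightarrow> exp (G l)) (at_right l)" "((\<lambda>z. exp (G z)) \<longlongrightarrow> exp (G u)) (at_left u)"
    by (rule continuous_on_Icc_at_rightD[OF cE lu], rule continuous_on_Icc_at_leftD[OF cE lu])
  then have lims: "((\<lambda>z. k * exp (G z)) \<longlongrightarrow> k * exp (G l)) (at_right l)" "((\<lambda>z. k * exp (G z)) \<longlongrightarrow> k * exp (G u)) (at_left u)"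
    by (auto intro: tendsto_mult_left)
  have "eventually (\<lambda>z. k * exp (G z) = Y z) (at_right l)"
    using eventually_at_right_real[OF lu] by eventually_elim (auto simp: k)
  then have "(Y \<longlongrightarrow> k * exp (G l)) (at_right l)" using lims(1) by (rule Lim_transform_eventually[rotated])
  then show "\<not> (Y \<longlongrightarrow> 0) (at_right l)" using k0 tendsto_unique[of "at_right l" Y "k * exp (G l)" 0] by auto
  have "eventually (\<lambda>z. k * exp (G z) = Y z) (at_left u)"
    using eventually_at_left_real[OF lu] by eventually_elim (auto simp: k)
  then have "(Y \<longlongrightarrow> k * exp (G u)) (at_left u)" using lims(2) by (rule Lim_transform_eventually[rotated])
  then show "\<not> (Y \<longlongrightarrow> 0) (at_left u)" using k0 tendsto_unique[of "at_left u" Y "k * exp (G u)" 0] by auto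
qed

text \<open>\<open>((z - x0) ^ n * Y z)\<^sup>2\<close> is positive and has logarithmic derivative \<open>2 (n/(z - x0) + \<rho> z) \<ge> 0\<close>, so it
cannot tend to 0. The square avoids a discussion of the sign of \<open>Y\<close>.\<close>
lemma no_rapid_decay:
  fixes Y \<rho> :: "real \<Rightarrow> real"
  assumes Y: "\<And>z. z > M \<Longrightarrow> (Y has_real_derivative \<rho> z * Y z) (at z)"
    and nz: "\<And>z. z > M \<Longrightarrow> Y z \<noteq> 0" and M: "M \<ge> x0"
    and \<rho>: "\<And>z. z > M \<Longrightarrow> \<rho> z \<ge> - real n / (z - x0)"
  shows "\<not> ((\<lambda>z. (z - x0) ^ n * Y z) \<longlongrightarrow> 0) at_top"
proof
  assume lim: "((\<lambda>z. (z - x0) ^ n * Y z) \<longlongrightarrow> 0) at_top"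
  define F where "F = (\<lambda>z. ((z - x0) ^ n * Y z)\<^sup>2)"
  have "(F \<longlongrightarrow> 0\<^sup>2) at_top" unfolding F_def by (rule tendsto_power[OF lim])
  then have F0: "(F \<longlongrightarrow> 0) at_top" by simp
  have F': "(F has_real_derivative 2 * F z * (real n / (z - x0) + \<rho> z)) (at z)" if z: "z > M" for z
  proof -
    have zx: "z - x0 > 0" using z M by simp
    have 1: "((\<lambda>z. (z - x0) ^ n) has_real_derivative real n / (z - x0) * (z - x0) ^ n) (at z)"
    proof -
      have "((\<lambda>z. (z - x0) ^ n) has_real_derivative real n * (z - x0) ^ (n - 1)) (at z)"
        by (auto intro!: derivative_eq_intros)
      moreover have "real n * (z - x0) ^ (n - 1) = real n / (z - x0) * (z - x0) ^ n"
        using zx by (cases n) auto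
      ultimately show ?thesis by simp
    qed
    have "((\<lambda>z. (z - x0) ^ n * Y z) has_real_derivative (real n / (z - x0) + \<rho> z) * ((z - x0) ^ n * Y z)) (at z)"
      by (rule DERIV_cong[OF DERIV_mult[OF 1 Y[OF z]]]) (simp add: algebra_simps)
    from DERIV_power[OF this, of 2] show ?thesis unfolding F_def
      by (rule DERIV_cong) (simp add: power2_eq_square algebra_simps)
  qed
  have "F (M + 1) > 0" using nz[of "M + 1"] M by (simp add: F_def)
  moreover have "F (M + 1) \<le> 0"
  proof (rule tendsto_lowerbound[OF F0])
    show "eventually (\<lambda>z. F (M + 1) \<le> F z) at_top"
      using eventually_ge_at_top[of "M + 1"]
    proof eventually_elim
      fix z assume z: "M + 1 \<le> z"
      show "F (M + 1) \<le> F z"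
      proof (rule DERIV_nonneg_imp_nondecreasing[OF z])
        fix x assume x: "M + 1 \<le> x" "x \<le> z"
        have "2 * F x * (real n / (x - x0) + \<rho> x) \<ge> 0"
          using \<rho>[of x] x by (intro mult_nonneg_nonneg) (auto simp: F_def)
        then show "\<exists>y. (F has_real_derivative y) (at x) \<and> 0 \<le> y" using F'[of x] x by auto
      qed
    qed
  qed simp
  ultimately show False by simp
qed

lemma no_rapid_decay_bot:
  fixes Y \<rho> :: "real \<Rightarrow> real"
  assumes Y: "\<And>z. z < M \<Longrightarrow> (Y has_real_derivative \<rho> z * Y z) (at z)"
    and nz: "\<And>z. z < M \<Longrightarrow> Y z \<noteq> 0" and M: "M \<le> x0"
    and \<rho>: "\<And>z. z < M \<Longrightarrow> \<rho> z \<le> - real n / (z - x0)"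
  shows "\<not> ((\<lambda>z. (z - x0) ^ n * Y z) \<longlongrightarrow> 0) at_bot"
proof
  assume "((\<lambda>z. (z - x0) ^ n * Y z) \<longlongrightarrow> 0) at_bot"
  then have "((\<lambda>z. (-1) ^ n * ((- z - x0) ^ n * Y (- z))) \<longlongrightarrow> (-1) ^ n * 0) at_top"
    unfolding filterlim_at_bot_mirror by (rule tendsto_mult_left)
  moreover have "(-1) ^ n * ((- z - x0) ^ n * Y (- z)) = (z - - x0) ^ n * Y (- z)" for z
    by (simp add: mult.assoc[symmetric] power_mult_distrib[symmetric] add.commute)
  ultimately have "((\<lambda>z. (z - - x0) ^ n * Y (- z)) \<longlongrightarrow> 0) at_top" by simp
  moreover have "\<not> ((\<lambda>z. (z - - x0) ^ n * Y (- z)) \<longlongrightarrow> 0) at_top"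
  proof (rule no_rapid_decay[where M="- M" and \<rho>="\<lambda>z. - \<rho> (- z)"])
    fix z assume z: "- M < z"
    have "((\<lambda>z. Y (- z)) has_real_derivative \<rho> (- z) * Y (- z) * (- 1)) (at z)"
      by (rule DERIV_chain2[of Y]) (use Y[of "- z"] z in \<open>auto intro!: derivative_eq_intros\<close>)
    then show "((\<lambda>z. Y (- z)) has_real_derivative - \<rho> (- z) * Y (- z)) (at z)" by simp
    have "\<rho> (- z) \<le> - real n / (- z - x0)" using \<rho>[of "- z"] z by simp
    also have "- z - x0 = - (z - - x0)" by simp
    also have "- real n / - (z - - x0) = real n / (z - - x0)" by (rule minus_divide_divide)
    finally show "- real n / (z - - x0) \<le> - \<rho> (- z)" by simp
    show "Y (- z) \<noteq> 0" using nz[of "- z"] z by simp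
  qed (use M in simp)
  ultimately show False by contradiction
qed

text \<open>For \<open>\<beta> \<le> 0\<close> the power is at least 1 near \<open>t = 0\<close>, and \<open>g\<close> itself would tend to 0.\<close>
lemma positive_exponent:
  fixes g t :: "real \<Rightarrow> real"
  assumes g: "(g \<longlongrightarrow> L) F" "L \<noteq> 0" and t: "(t \<longlongrightarrow> 0) F" "eventually (\<lambda>z. t z > 0) F"
    and F: "F \<noteq> bot" and lim: "((\<lambda>z. g z * t z powr \<beta>) \<longlongrightarrow> 0) F"
  shows "\<beta> > 0"
proof (rule ccontr)
  assume "\<not> \<beta> > 0"
  have "eventually (\<lambda>z. t z < 1) F" using t(1) by (rule order_tendstoD) simp
  with t(2) have "eventually (\<lambda>z. norm (g z) \<le> norm (g z * t z powr \<beta>)) F"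
  proof eventually_elim
    fix z assume "0 < t z" "t z < 1"
    then have "1 \<le> t z powr \<beta>" using \<open>\<not> \<beta> > 0\<close> powr_mono'[of \<beta> 0 "t z"] by simp
    then have "\<bar>g z\<bar> * 1 \<le> \<bar>g z\<bar> * t z powr \<beta>" by (intro mult_left_mono) auto
    then show "norm (g z) \<le> norm (g z * t z powr \<beta>)" by (simp add: abs_mult)
  qed
  then have "(g \<longlongrightarrow> 0) F" using tendsto_norm_zero[OF lim] by (rule Lim_null_comparison)
  with g F show False using tendsto_unique by blast
qed

section \<open>The weights that satisfy a Pearson equation\<close>
lemma poly_degree_le_1:
  assumes "degree (f :: real poly) \<le> 1"
  shows "poly f z = coeff f 0 + coeff f 1 * z"
proof -
  have "f = [:coeff f 0, coeff f 1:]"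
    using assms by (intro poly_eqI) (auto simp: coeff_pCons coeff_eq_0 split: nat.splits)
  then have "poly f z = poly [:coeff f 0, coeff f 1:] z" by (rule arg_cong)
  then show ?thesis by simp
qed

lemma poly_degree_le_2:
  assumes "degree (f :: real poly) \<le> 2"
  shows "poly f z = coeff f 0 + coeff f 1 * z + coeff f 2 * z\<^sup>2"
proof -
  have "f = [:coeff f 0, coeff f 1, coeff f 2:]"
    using assms by (intro poly_eqI) (auto simp: coeff_pCons coeff_eq_0 numeral_2_eq_2 split: nat.splits)
  then have "poly f z = poly [:coeff f 0, coeff f 1, coeff f 2:] z" by (rule arg_cong)
  then show ?thesis by (simp add: algebra_simps power2_eq_square)
qed

lemma at_left_ereal_nontrivial: "-\<infinity> < (b::ereal) \<Longrightarrow> at_left b \<noteq> bot"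
  by (cases b) (auto simp: at_left_ereal at_left_PInf filtermap_bot_iff)

lemma at_right_ereal_nontrivial: "(a::ereal) < \<infinity> \<Longrightarrow> at_right a \<noteq> bot"
  by (cases a) (auto simp: at_right_ereal at_right_MInf filtermap_bot_iff)

text \<open>The analytic situation once \<open>p\<close> is known to be a polynomial \<open>P\<close> and \<open>q = Q - 2 P \<eta>'/\<eta>\<close>: the assumption
\<open>ode\<close> is the equation \<open>(p W)' = q W\<close> wherever it makes sense. Zeros of \<open>P\<close> and \<open>\<eta>\<close> inside the
interval are not excluded in advance.\<close>
locale pearson =
  fixes P Q \<eta> :: "real poly" and W :: "real \<Rightarrow> real" and a b :: ereal
  assumes P0: "P \<noteq> 0" and \<eta>0: "\<eta> \<noteq> 0" and degP: "degree P \<le> 2" and degQ: "degree Q \<le> 1"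
    and ab: "a < b"
    and cont: "continuous_on (einterval a b) W"
    and pos: "\<And>z. z \<in> einterval a b \<Longrightarrow> W z > 0"
    and ode: "\<And>z. z \<in> einterval a b \<Longrightarrow> poly P z \<noteq> 0 \<Longrightarrow> poly \<eta> z \<noteq> 0 \<Longrightarrow>
      ((\<lambda>z. poly P z * W z) has_real_derivative
        W z * (poly Q z - 2 * poly P z * poly (pderiv \<eta>) z / poly \<eta> z)) (at z)"
    and lim_a: "\<And>f. (((\<lambda>z. poly f z * poly P z * W z) \<circ> real_of_ereal) \<longlongrightarrow> 0) (at_right a)"
    and lim_b: "\<And>f. (((\<lambda>z. poly f z * poly P z * W z) \<circ> real_of_ereal) \<longlongrightarrow> 0) (at_left b)"
begin

abbreviation "I \<equiv> einterval a b"

definition Y :: "real \<Rightarrow> real" where "Y z = poly P z * W z * (poly \<eta> z)\<^sup>2"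

definition \<rho> :: "real \<Rightarrow> real" where "\<rho> z = poly Q z / poly P z"

lemma Y_nonzero: "z \<in> I \<Longrightarrow> poly P z \<noteq> 0 \<Longrightarrow> poly \<eta> z \<noteq> 0 \<Longrightarrow> Y z \<noteq> 0"
  using pos[of z] by (simp add: Y_def)

lemma Y_deriv:
  assumes "z \<in> I" "poly P z \<noteq> 0" "poly \<eta> z \<noteq> 0"
  shows "(Y has_real_derivative \<rho> z * Y z) (at z)"
proof -
  have "((\<lambda>z. (poly \<eta> z)\<^sup>2) has_real_derivative 2 * poly \<eta> z * poly (pderiv \<eta>) z) (at z)"
    by (auto intro!: derivative_eq_intros)
  from DERIV_mult[OF ode[OF assms] this] show ?thesis
    unfolding Y_def[abs_def]
    by (rule DERIV_cong) (use assms in \<open>simp add: \<rho>_def field_simps power2_eq_square\<close>)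
qed

lemma Y_lim:
  "((\<lambda>z. (real_of_ereal z - x0) ^ n * Y (real_of_ereal z)) \<longlongrightarrow> 0) (at_right a)"
  "((\<lambda>z. (real_of_ereal z - x0) ^ n * Y (real_of_ereal z)) \<longlongrightarrow> 0) (at_left b)"
  using lim_a[of "[:-x0, 1:] ^ n * \<eta>\<^sup>2"] lim_b[of "[:-x0, 1:] ^ n * \<eta>\<^sup>2"]
  by (simp_all add: Y_def o_def algebra_simps)

lemma Y_lim_finite:
  "a = ereal x \<Longrightarrow> (Y \<longlongrightarrow> 0) (at_right x)" "b = ereal x \<Longrightarrow> (Y \<longlongrightarrow> 0) (at_left x)"
  using Y_lim[of 0 0] ereal_tendsto_simps1(1,2)[of Y 0 x] by (simp_all add: o_def)

lemma Y_lim_infinite: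
  "b = \<infinity> \<Longrightarrow> ((\<lambda>z. (z - x0) ^ n * Y z) \<longlongrightarrow> 0) at_top"
  "a = -\<infinity> \<Longrightarrow> ((\<lambda>z. (z - x0) ^ n * Y z) \<longlongrightarrow> 0) at_bot"
  using Y_lim[of x0 n] ereal_tendsto_simps1(3,4)[of "\<lambda>z. (z - x0) ^ n * Y z" 0] by (simp_all add: o_def)

lemma finite_roots: "finite {z. poly P z = 0 \<or> poly \<eta> z = 0}"
  using poly_roots_finite[OF P0] poly_roots_finite[OF \<eta>0] by (simp add: Collect_disj_eq)

lemma punctured_neighbourhood:
  obtains \<delta> where "\<delta> > 0" "\<And>z. z \<noteq> x \<Longrightarrow> \<bar>z - x\<bar> < \<delta> \<Longrightarrow> poly P z \<noteq> 0 \<and> poly \<eta> z \<noteq> 0"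
proof -
  obtain \<delta> where \<delta>: "\<delta> > 0" "\<And>z. z \<in> {z. poly P z = 0 \<or> poly \<eta> z = 0} \<Longrightarrow> z \<noteq> x \<Longrightarrow> \<delta> \<le> dist x z"
    using finite_set_avoid[OF finite_roots, of x] by blast
  show ?thesis
  proof (rule that[OF \<delta>(1)])
    fix z assume "z \<noteq> x" "\<bar>z - x\<bar> < \<delta>"
    then show "poly P z \<noteq> 0 \<and> poly \<eta> z \<noteq> 0" using \<delta>(2)[of z] by (auto simp: dist_real_def)
  qed
qed

text \<open>\<open>\<rho>\<close> is continuous at \<open>x\<close>, even if \<open>\<eta>\<close> vanishes there: the factor \<open>\<eta>\<^sup>2\<close> in \<open>Y\<close> removes that singularity.\<close>
lemma no_decay_at_regular_point:
  assumes x: "poly P x \<noteq> 0" and \<epsilon>: "\<epsilon> > 0"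
  shows "{x<..<x + \<epsilon>} \<subseteq> I \<Longrightarrow> \<not> (Y \<longlongrightarrow> 0) (at_right x)"
    and "{x - \<epsilon><..<x} \<subseteq> I \<Longrightarrow> \<not> (Y \<longlongrightarrow> 0) (at_left x)"
proof -
  obtain \<delta> where \<delta>: "\<delta> > 0" "\<And>z. z \<noteq> x \<Longrightarrow> \<bar>z - x\<bar> < \<delta> \<Longrightarrow> poly P z \<noteq> 0 \<and> poly \<eta> z \<noteq> 0"
    using punctured_neighbourhood[of x] by blast
  define h where "h = min \<delta> \<epsilon> / 2"
  have h: "h > 0" "h < \<delta>" "h < \<epsilon>" using \<delta>(1) \<epsilon> by (auto simp: h_def)
  have nz: "poly P z \<noteq> 0" if "\<bar>z - x\<bar> \<le> h" for z using \<delta>(2)[of z] that h x by (cases "z = x") auto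
  have "\<not> (Y \<longlongrightarrow> 0) (at_right x)" if I: "{x<..<x + \<epsilon>} \<subseteq> I"
  proof (rule regular_boundary(1)[where u="x + h" and \<rho>=\<rho>])
    show "continuous_on {x..x + h} \<rho>" unfolding \<rho>_def[abs_def] using nz by (intro continuous_intros) auto
    fix z assume z: "z \<in> {x<..<x + h}"
    then have "z \<in> I" using I h by auto
    moreover have "poly P z \<noteq> 0 \<and> poly \<eta> z \<noteq> 0" using z h by (intro \<delta>(2)) auto
    ultimately show "(Y has_real_derivative \<rho> z * Y z) (at z)" "Y z \<noteq> 0" using Y_deriv Y_nonzero by auto
  qed (use h in auto)
  then show "{x<..<x + \<epsilon>} \<subseteq> I \<Longrightarrow> \<not> (Y \<longlongrightarrow> 0) (at_right x)" .
  have "\<not> (Y \<longlongrightarrow> 0) (at_left x)" if I: "{x - \<epsilon><..<x} \<subseteq> I"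
  proof (rule regular_boundary(2)[where l="x - h" and \<rho>=\<rho>])
    show "continuous_on {x - h..x} \<rho>" unfolding \<rho>_def[abs_def] using nz by (intro continuous_intros) auto
    fix z assume z: "z \<in> {x - h<..<x}"
    then have "z \<in> I" using I h by auto
    moreover have "poly P z \<noteq> 0 \<and> poly \<eta> z \<noteq> 0" using z h by (intro \<delta>(2)) auto
    ultimately show "(Y has_real_derivative \<rho> z * Y z) (at z)" "Y z \<noteq> 0" using Y_deriv Y_nonzero by auto
  qed (use h in auto)
  then show "{x - \<epsilon><..<x} \<subseteq> I \<Longrightarrow> \<not> (Y \<longlongrightarrow> 0) (at_left x)" .
qed

text \<open>At a zero of \<open>\<eta>\<close> the continuity of \<open>W\<close> would make \<open>Y\<close> vanish, which a nonzero solution cannot do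
where \<open>P \<noteq> 0\<close>.\<close>
lemma eta_nonzero:
  assumes x: "x \<in> I" "poly P x \<noteq> 0"
  shows "poly \<eta> x \<noteq> 0"
proof
  assume \<eta>x: "poly \<eta> x = 0"
  obtain \<epsilon> where \<epsilon>: "\<epsilon> > 0" "ball x \<epsilon> \<subseteq> I" using x(1) open_einterval open_contains_ball by blast
  have "continuous_on I Y" unfolding Y_def[abs_def] by (intro continuous_intros cont)
  then have "isCont Y x" using x(1) by (simp add: continuous_on_eq_continuous_at)
  then have "(Y \<longlongrightarrow> 0) (at x)" using \<eta>x by (simp add: isCont_def Y_def)
  then have "(Y \<longlongrightarrow> 0) (at_right x)" by (simp add: filterlim_at_split)
  moreover have "{x<..<x + \<epsilon>} \<subseteq> I" using \<epsilon>(2) by (auto simp: ball_def dist_real_def subset_eq)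
  ultimately show False using no_decay_at_regular_point(1)[OF x(2) \<epsilon>(1)] by blast
qed

lemma finite_endpoint_root:
  "a = ereal x \<Longrightarrow> poly P x = 0" "b = ereal x \<Longrightarrow> poly P x = 0"
proof -
  obtain c where c: "c \<in> I" using einterval_nonempty[OF ab] by blast
  show "poly P x = 0" if "a = ereal x"
  proof (rule ccontr)
    assume nz: "poly P x \<noteq> 0"
    have "{x<..<x + (c - x)} \<subseteq> I" using c that by (auto simp: einterval_def) (meson ereal_less_eq(3) less_le_trans order.strict_trans less_ereal.simps(1))
    moreover have "c - x > 0" using c that by (auto simp: einterval_def)
    ultimately show False using no_decay_at_regular_point(1)[OF nz] Y_lim_finite(1)[OF that] by blast
  qed
  show "poly P x = 0" if "b = ereal x"
  proof (rule ccontr)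
    assume nz: "poly P x \<noteq> 0"
    have "{x - (x - c)<..<x} \<subseteq> I" using c that by (auto simp: einterval_def) (meson ereal_less_eq(3) less_le_trans order.strict_trans less_ereal.simps(1))
    moreover have "x - c > 0" using c that by (auto simp: einterval_def)
    ultimately show False using no_decay_at_regular_point(2)[OF nz] Y_lim_finite(2)[OF that] by blast
  qed
qed

lemma bounded_roots: obtains M where "\<And>z. poly P z = 0 \<or> poly \<eta> z = 0 \<Longrightarrow> \<bar>z\<bar> \<le> M"
  using finite_imp_bounded[OF finite_roots] unfolding bounded_iff by auto

text \<open>The boundary condition for all polynomial multiples makes \<open>Y\<close> decay faster than every power.\<close>
lemma infinite_endpoint:
  "b = \<infinity> \<Longrightarrow> \<exists>z>M. \<rho> z < - real n / (z - x0)"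
  "a = -\<infinity> \<Longrightarrow> \<exists>z<M. \<rho> z > - real n / (z - x0)"
proof -
  obtain c where c: "c \<in> I" using einterval_nonempty[OF ab] by blast
  obtain R where R: "\<And>z. poly P z = 0 \<or> poly \<eta> z = 0 \<Longrightarrow> \<bar>z\<bar> \<le> R" by (rule bounded_roots) blast
  show "\<exists>z>M. \<rho> z < - real n / (z - x0)" if b: "b = \<infinity>"
  proof (rule ccontr)
    assume H: "\<not> (\<exists>z>M. \<rho> z < - real n / (z - x0))"
    define M' where "M' = max (max M c) (max R x0)"
    have in_I: "z \<in> I" if "z > M'" for z
    proof -
      have "a < ereal c" using c by (simp add: einterval_def)
      also have "ereal c < ereal z" using that by (simp add: M'_def)
      finally show ?thesis using b by (simp add: einterval_def)
    qed
    have nz: "poly P z \<noteq> 0 \<and> poly \<eta> z \<noteq> 0" if "z > M'" for z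
      using R[of z] that by (auto simp: M'_def)
    have "\<not> ((\<lambda>z. (z - x0) ^ n * Y z) \<longlongrightarrow> 0) at_top"
    proof (rule no_rapid_decay[where M=M' and \<rho>=\<rho>])
      fix z assume z: "M' < z"
      show "(Y has_real_derivative \<rho> z * Y z) (at z)" "Y z \<noteq> 0"
        using Y_deriv Y_nonzero in_I[OF z] nz[OF z] by auto
      have "M < z" using z by (simp add: M'_def)
      with H show "- real n / (z - x0) \<le> \<rho> z" by (meson not_le)
    qed (simp add: M'_def)
    with Y_lim_infinite(1)[OF b] show False by blast
  qed
  show "\<exists>z<M. \<rho> z > - real n / (z - x0)" if a: "a = -\<infinity>"
  proof (rule ccontr)
    assume H: "\<not> (\<exists>z<M. \<rho> z > - real n / (z - x0))"
    define M' where "M' = min (min M c) (min (- R) x0)"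
    have in_I: "z \<in> I" if "z < M'" for z
    proof -
      have "ereal z < ereal c" using that by (simp add: M'_def)
      also have "ereal c < b" using c by (simp add: einterval_def)
      finally show ?thesis using a by (simp add: einterval_def)
    qed
    have nz: "poly P z \<noteq> 0 \<and> poly \<eta> z \<noteq> 0" if "z < M'" for z
      using R[of z] that by (auto simp: M'_def)
    have "\<not> ((\<lambda>z. (z - x0) ^ n * Y z) \<longlongrightarrow> 0) at_bot"
    proof (rule no_rapid_decay_bot[where M=M' and \<rho>=\<rho>])
      fix z assume z: "z < M'"
      show "(Y has_real_derivative \<rho> z * Y z) (at z)" "Y z \<noteq> 0"
        using Y_deriv Y_nonzero in_I[OF z] nz[OF z] by auto
      have "z < M" using z by (simp add: M'_def)
      with H show "\<rho> z \<le> - real n / (z - x0)" by (meson not_le)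
    qed (simp add: M'_def)
    with Y_lim_infinite(2)[OF a] show False by blast
  qed
qed

lemma Y_over_P: "z \<in> I \<Longrightarrow> poly P z \<noteq> 0 \<Longrightarrow> W z * (poly \<eta> z)\<^sup>2 = Y z / poly P z"
  by (simp add: Y_def)

lemma convex_I: "convex I"
proof -
  have "is_interval I"
    unfolding is_interval_1 einterval_def
    by (auto intro: order.strict_trans2[of a]) (meson ereal_less_eq(3) order.strict_trans1)
  then show ?thesis by (simp add: is_interval_convex_1)
qed

lemma Y_proportional:
  assumes nz: "\<And>z. z \<in> I \<Longrightarrow> poly P z \<noteq> 0"
    and E: "\<And>z. z \<in> I \<Longrightarrow> (E has_real_derivative \<rho> z * E z) (at z)" "\<And>z. z \<in> I \<Longrightarrow> E z \<noteq> 0"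
  obtains k where "\<And>z. z \<in> I \<Longrightarrow> Y z = k * E z" "k \<noteq> 0"
proof -
  obtain k where k: "\<And>z. z \<in> I \<Longrightarrow> Y z = k * E z"
    using proportional_solutions[OF convex_I open_einterval _ E, of Y] Y_deriv eta_nonzero nz by blast
  obtain c where c: "c \<in> I" using einterval_nonempty[OF ab] by blast
  have "k \<noteq> 0" using k[OF c] Y_nonzero[OF c nz[OF c] eta_nonzero[OF c nz[OF c]]] by auto
  with k that show ?thesis by blast
qed

text \<open>Frees the three cases below from tracking signs of the integration constants.\<close>
lemma positive_constant:
  assumes nz: "\<And>z. z \<in> I \<Longrightarrow> poly P z \<noteq> 0"
    and w: "\<And>z. z \<in> I \<Longrightarrow> W z * (poly \<eta> z)\<^sup>2 = C * w z" "\<And>z. z \<in> I \<Longrightarrow> w z > 0"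
  shows "C > 0"
proof -
  obtain c where c: "c \<in> I" using einterval_nonempty[OF ab] by blast
  have "W c * (poly \<eta> c)\<^sup>2 > 0" using pos[OF c] eta_nonzero[OF c nz[OF c]] by simp
  then show ?thesis using w[OF c] by (simp add: zero_less_mult_iff not_less_iff_gr_or_eq)
qed

abbreviation "is_classical \<equiv> (\<forall>z\<in>I. poly P z \<noteq> 0) \<and> classical_weight I (\<lambda>z. W z * (poly \<eta> z)\<^sup>2)"

text \<open>\<open>P\<close> has no zero to serve as a finite end, so the interval is the whole line; \<open>\<rho>\<close> is linear, and decay
at both ends requires a negative slope.\<close>
lemma hermite_case:
  assumes deg: "degree P = 0"
  shows "is_classical"
proof -
  obtain c where Pc: "P = [:c:]" using deg by (rule degree_eq_zeroE)
  then have c: "c \<noteq> 0" "\<And>z. poly P z = c" using P0 by auto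
  define \<alpha> \<beta> where "\<alpha> = coeff Q 1 / c" and "\<beta> = coeff Q 0 / c"
  have \<rho>: "\<rho> z = \<alpha> * z + \<beta>" for z
    using poly_degree_le_1[OF degQ, of z] c by (simp add: \<rho>_def \<alpha>_def \<beta>_def field_simps)
  have a: "a = -\<infinity>" using finite_endpoint_root(1) c ab by (cases a) auto
  have b: "b = \<infinity>" using finite_endpoint_root(2) c ab by (cases b) auto
  have "\<alpha> < 0"
  proof (rule ccontr)
    assume "\<not> \<alpha> < 0"
    then consider "\<alpha> > 0" | "\<alpha> = 0" "\<beta> \<ge> 0" | "\<alpha> = 0" "\<beta> < 0" by linarith
    then show False
    proof cases
      case 1
      obtain z where z: "z > - \<beta> / \<alpha>" "\<rho> z < 0" using infinite_endpoint(1)[OF b, of "- \<beta> / \<alpha>" 0 0] by auto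
      have "\<alpha> * z > - \<beta>" using z(1) 1 by (simp add: field_simps)
      with z(2) show False by (simp add: \<rho>)
    next
      case 2
      then show False using infinite_endpoint(1)[OF b, of 0 0 0] by (auto simp: \<rho>)
    next
      case 3
      then show False using infinite_endpoint(2)[OF a, of 0 0 0] by (auto simp: \<rho>)
    qed
  qed
  define E where "E z = exp (\<alpha> * z\<^sup>2 / 2 + \<beta> * z)" for z
  have nz: "poly P z \<noteq> 0" for z using c by simp
  have E': "(E has_real_derivative \<rho> z * E z) (at z)" for z
    unfolding E_def[abs_def] \<rho> by (auto intro!: derivative_eq_intros simp: algebra_simps)
  obtain k where k: "\<And>z. z \<in> I \<Longrightarrow> Y z = k * E z"
    by (rule Y_proportional[OF nz E']) (auto simp: E_def)
  define A B where "A = sqrt (- \<alpha> / 2)" and "B = - \<beta> / (2 * A)"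
  have A: "A > 0" "A\<^sup>2 = - \<alpha> / 2" using \<open>\<alpha> < 0\<close> by (auto simp: A_def)
  have AB: "2 * (A * B) = - \<beta>" using A by (simp add: B_def)
  \<comment> \<open>Completion of the square fixes the affine change of variable.\<close>
  have sq: "\<alpha> * z\<^sup>2 / 2 + \<beta> * z = B\<^sup>2 + - (A * z + B)\<^sup>2" for z
  proof -
    have "(A * z + B)\<^sup>2 = A\<^sup>2 * z\<^sup>2 + 2 * (A * B) * z + B\<^sup>2" by (simp add: power2_eq_square algebra_simps)
    then show ?thesis unfolding A(2) AB by simp
  qed
  have w: "W z * (poly \<eta> z)\<^sup>2 = (k / c * exp (B\<^sup>2)) * exp (- (A * z + B)\<^sup>2)" if "z \<in> I" for z
    using Y_over_P[OF that nz] k[OF that] c by (simp only: E_def sq exp_add) simp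
  have "k / c * exp (B\<^sup>2) > 0" by (rule positive_constant[OF nz w]) auto
  moreover have "I = {z. A * z + B \<in> UNIV}" using a b by simp
  moreover have "standard_classical_weight UNIV (\<lambda>x. exp (- x\<^sup>2))" by (simp add: standard_classical_weight_def)
  moreover have "A \<noteq> 0" using A by simp
  ultimately have "classical_weight I (\<lambda>z. W z * (poly \<eta> z)\<^sup>2)"
    unfolding classical_weight_def using w by blast
  with nz show ?thesis by blast
qed

text \<open>With \<open>\<zeta>\<close> the zero of \<open>P\<close> one has \<open>\<rho> = \<alpha> + \<beta>/(z - \<zeta>)\<close>. An infinite end forces the sign of \<open>\<alpha>\<close>, with
opposite signs for the two ends, so exactly one end is infinite and the other is \<open>\<zeta>\<close>. The variable
\<open>t = - \<alpha> (z - \<zeta>)\<close> is positive on the interval for both orientations, and decay at \<open>\<zeta>\<close> gives \<open>\<beta> > 0\<close>.\<close>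
lemma laguerre_case:
  assumes deg: "degree P = 1"
  shows "is_classical"
proof -
  define c \<zeta> where "c = coeff P 1" and "\<zeta> = - coeff P 0 / coeff P 1"
  have c: "c \<noteq> 0" using deg P0 leading_coeff_0_iff[of P] by (simp add: c_def)
  have P: "poly P z = c * (z - \<zeta>)" for z
    using poly_degree_le_1[of P z] deg c by (simp add: c_def \<zeta>_def algebra_simps)
  define \<alpha> \<beta> where "\<alpha> = coeff Q 1 / c" and "\<beta> = (coeff Q 0 + coeff Q 1 * \<zeta>) / c"
  have \<rho>: "\<rho> z = \<alpha> + \<beta> / (z - \<zeta>)" if "z \<noteq> \<zeta>" for z
  proof -
    have "poly Q z = c * (\<alpha> * (z - \<zeta>) + \<beta>)"
      using poly_degree_le_1[OF degQ, of z] c by (simp add: \<alpha>_def \<beta>_def field_simps)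
    moreover have "z - \<zeta> \<noteq> 0" using that by simp
    ultimately show ?thesis using c by (simp add: \<rho>_def P add_divide_distrib)
  qed
  define n where "n = nat \<lceil>- \<beta>\<rceil>"
  have n: "- real n \<le> \<beta>" unfolding n_def by linarith
  have top: "\<alpha> < 0" if b: "b = \<infinity>"
  proof (rule ccontr)
    assume "\<not> \<alpha> < 0"
    obtain z where z: "z > \<zeta>" "\<rho> z < - real n / (z - \<zeta>)" using infinite_endpoint(1)[OF b, of \<zeta> n \<zeta>] by auto
    have "- real n / (z - \<zeta>) \<le> \<beta> / (z - \<zeta>)" using n z(1) by (intro divide_right_mono) auto
    with z \<open>\<not> \<alpha> < 0\<close> show False by (simp add: \<rho>)
  qed
  have bot: "\<alpha> > 0" if a: "a = -\<infinity>"
  proof (rule ccontr)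
    assume "\<not> \<alpha> > 0"
    obtain z where z: "z < \<zeta>" "\<rho> z > - real n / (z - \<zeta>)" using infinite_endpoint(2)[OF a, of \<zeta> n \<zeta>] by auto
    have "\<beta> / (z - \<zeta>) \<le> - real n / (z - \<zeta>)" using n z(1) by (intro divide_right_mono_neg) auto
    with z \<open>\<not> \<alpha> > 0\<close> show False by (simp add: \<rho>)
  qed
  have fin: "x = \<zeta>" if "a = ereal x \<or> b = ereal x" for x
    using finite_endpoint_root[of x] that c by (auto simp: P)
  consider "a = ereal \<zeta>" "b = \<infinity>" "\<alpha> < 0" | "a = -\<infinity>" "b = ereal \<zeta>" "\<alpha> > 0"
    using ab top bot fin by (cases a; cases b) auto
  then have main: "\<alpha> \<noteq> 0 \<and> I = {z. 0 < - \<alpha> * (z - \<zeta>)} \<and>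
      (\<exists>F. F \<noteq> bot \<and> (Y \<longlongrightarrow> 0) F \<and> ((\<lambda>z. z) \<longlongrightarrow> \<zeta>) F \<and> eventually (\<lambda>z. z \<in> I) F)"
  proof cases
    case 1
    have I: "I = {\<zeta><..}" using 1 by simp
    have "eventually (\<lambda>z. z \<in> I) (at_right \<zeta>)" unfolding I by (simp add: eventually_at_filter)
    moreover have "I = {z. 0 < - \<alpha> * (z - \<zeta>)}" unfolding I using 1(3) by (auto simp: mult_less_0_iff)
    ultimately show ?thesis using Y_lim_finite(1)[OF 1(1)] 1(3)
      by (intro conjI exI[of _ "at_right \<zeta>"]) (auto intro: tendsto_ident_at)
  next
    case 2
    have I: "I = {..<\<zeta>}" using 2 by simp
    have "eventually (\<lambda>z. z \<in> I) (at_left \<zeta>)" unfolding I by (simp add: eventually_at_filter)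
    moreover have "I = {z. 0 < - \<alpha> * (z - \<zeta>)}" unfolding I using 2(3) by (auto simp: mult_less_0_iff)
    ultimately show ?thesis using Y_lim_finite(2)[OF 2(2)] 2(3)
      by (intro conjI exI[of _ "at_left \<zeta>"]) (auto intro: tendsto_ident_at)
  qed
  then obtain F where \<alpha>: "\<alpha> \<noteq> 0" and I: "I = {z. 0 < - \<alpha> * (z - \<zeta>)}" and F: "F \<noteq> bot" "(Y \<longlongrightarrow> 0) F"
    "((\<lambda>z. z) \<longlongrightarrow> \<zeta>) F" "eventually (\<lambda>z. z \<in> I) F" by blast
  define t where "t z = - \<alpha> * (z - \<zeta>)" for z
  have t: "t z > 0" "z \<noteq> \<zeta>" if "z \<in> I" for z using that I by (auto simp: t_def)
  have nz: "poly P z \<noteq> 0" if "z \<in> I" for z using t(2)[OF that] c by (simp add: P)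
  define E where "E z = exp (\<alpha> * z) * t z powr \<beta>" for z
  have E': "(E has_real_derivative \<rho> z * E z) (at z)" if z: "z \<in> I" for z
  proof -
    have "((\<lambda>z. t z powr \<beta>) has_real_derivative \<beta> * t z powr (\<beta> - 1) * (- \<alpha>)) (at z)"
      by (rule DERIV_chain2[where g=t, OF has_real_derivative_powr[OF t(1)[OF z]]])
        (auto simp: t_def[abs_def] intro!: derivative_eq_intros)
    moreover have "((\<lambda>z. exp (\<alpha> * z)) has_real_derivative exp (\<alpha> * z) * \<alpha>) (at z)"
      by (auto intro!: derivative_eq_intros)
    ultimately have "(E has_real_derivative exp (\<alpha> * z) * \<alpha> * t z powr \<beta> + \<beta> * t z powr (\<beta> - 1) * (- \<alpha>) * exp (\<alpha> * z)) (at z)"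
      unfolding E_def[abs_def] by (rule DERIV_mult[rotated])
    moreover have "exp (\<alpha> * z) * \<alpha> * t z powr \<beta> + \<beta> * t z powr (\<beta> - 1) * (- \<alpha>) * exp (\<alpha> * z) = \<rho> z * E z"
      using t[OF z] \<alpha> by (simp add: \<rho> E_def powr_diff t_def field_simps)
    ultimately show ?thesis by simp
  qed
  have E0: "E z \<noteq> 0" if "z \<in> I" for z using t(1)[OF that] by (simp add: E_def)
  obtain k where k: "\<And>z. z \<in> I \<Longrightarrow> Y z = k * E z" "k \<noteq> 0"
    using Y_proportional[OF nz E' E0] by blast
  have "\<beta> > 0"
  proof (rule positive_exponent)
    show "((\<lambda>z. k * exp (\<alpha> * z)) \<longlongrightarrow> k * exp (\<alpha> * \<zeta>)) F" by (intro tendsto_intros F)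
    have "(t \<longlongrightarrow> - \<alpha> * (\<zeta> - \<zeta>)) F" unfolding t_def[abs_def] by (intro tendsto_intros F)
    then show "(t \<longlongrightarrow> 0) F" by simp
    show "eventually (\<lambda>z. t z > 0) F" using F(4) by eventually_elim (rule t)
    have "eventually (\<lambda>z. Y z = k * exp (\<alpha> * z) * t z powr \<beta>) F"
      using F(4) by eventually_elim (simp add: k E_def)
    then show "((\<lambda>z. k * exp (\<alpha> * z) * t z powr \<beta>) \<longlongrightarrow> 0) F" by (rule Lim_transform_eventually[OF F(2)])
  qed (use k F in auto)
  define C where "C = - k * \<alpha> / c * exp (\<alpha> * \<zeta>)"
  have w: "W z * (poly \<eta> z)\<^sup>2 = C * (t z powr (\<beta> - 1) * exp (- t z))" if z: "z \<in> I" for z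
  proof -
    have "exp (\<alpha> * z) = exp (\<alpha> * \<zeta>) * exp (- t z)" by (simp add: t_def exp_add[symmetric] algebra_simps)
    moreover have "W z * (poly \<eta> z)\<^sup>2 = k * (exp (\<alpha> * z) * t z powr \<beta>) / (c * (z - \<zeta>))"
      using Y_over_P[OF z nz[OF z]] k(1)[OF z] by (simp add: E_def P)
    moreover have "t z powr \<beta> = t z powr (\<beta> - 1) * t z" using t(1)[OF z] by (simp add: powr_diff)
    ultimately have "W z * (poly \<eta> z)\<^sup>2 = k * (exp (\<alpha> * \<zeta>) * exp (- t z) * (t z powr (\<beta> - 1) * t z)) / (c * (z - \<zeta>))"
      by simp
    also have "\<dots> = k * exp (\<alpha> * \<zeta>) * exp (- t z) * t z powr (\<beta> - 1) * (t z / (c * (z - \<zeta>)))" by simp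
    also have "t z / (c * (z - \<zeta>)) = - \<alpha> / c" using t(2)[OF z] by (simp add: t_def)
    finally show ?thesis by (simp add: C_def)
  qed
  have w0: "t z powr (\<beta> - 1) * exp (- t z) > 0" if "z \<in> I" for z using t(1)[OF that] by simp
  have "C > 0" by (rule positive_constant[OF nz w w0])
  moreover have "standard_classical_weight {0<..} (\<lambda>x. x powr (\<beta> - 1) * exp (- x))"
    unfolding standard_classical_weight_def using \<open>\<beta> > 0\<close> by (intro disjI2 disjI1 exI[of _ "\<beta> - 1"]) auto
  moreover have lin: "- \<alpha> * z + \<alpha> * \<zeta> = t z" for z by (simp add: t_def algebra_simps)
  moreover have "I = {z. - \<alpha> * z + \<alpha> * \<zeta> \<in> {0<..}}" unfolding lin I by (simp add: t_def)
  ultimately have "classical_weight I (\<lambda>z. W z * (poly \<eta> z)\<^sup>2)"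
    unfolding classical_weight_def using w \<alpha>
    by (intro exI[of _ "{0<..}"] exI[of _ "\<lambda>x. x powr (\<beta> - 1) * exp (- x)"] exI[of _ "- \<alpha>"] exI[of _ "\<alpha> * \<zeta>"] exI[of _ C]) auto
  with nz show ?thesis by blast
qed

lemma quadratic_asymptotics:
  assumes deg: "degree P = 2"
  obtains n M where "M > 0" "\<And>z. \<bar>z\<bar> > M \<Longrightarrow> \<bar>\<rho> z\<bar> \<le> real n / \<bar>z\<bar>"
proof -
  define c where "c = \<bar>coeff P 2\<bar>"
  have c: "c > 0" using deg P0 leading_coeff_0_iff[of P] by (simp add: c_def)
  define A B where "A = \<bar>coeff Q 0\<bar> + \<bar>coeff Q 1\<bar>" and "B = \<bar>coeff P 0\<bar> + \<bar>coeff P 1\<bar>"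
  have A0: "A \<ge> 0" by (simp add: A_def)
  define M where "M = max 1 (2 * B / c)"
  define n where "n = nat \<lceil>2 * A / c\<rceil>"
  have n: "2 * A / c \<le> real n" unfolding n_def by linarith
  have "\<bar>\<rho> z\<bar> \<le> real n / \<bar>z\<bar>" if z: "\<bar>z\<bar> > M" for z
  proof -
    have z1: "\<bar>z\<bar> > 1" and zB: "2 * B / c < \<bar>z\<bar>" using z by (auto simp: M_def)
    then have z2: "2 * B < c * \<bar>z\<bar>" using c by (simp add: field_simps)
    have lin: "\<bar>x + y * z\<bar> \<le> (\<bar>x\<bar> + \<bar>y\<bar>) * \<bar>z\<bar>" for x y
    proof -
      have "\<bar>x + y * z\<bar> \<le> \<bar>x\<bar> * 1 + \<bar>y\<bar> * \<bar>z\<bar>" using abs_triangle_ineq[of x "y * z"] by (simp add: abs_mult)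
      also have "\<dots> \<le> \<bar>x\<bar> * \<bar>z\<bar> + \<bar>y\<bar> * \<bar>z\<bar>" using z1 by (intro add_mono mult_left_mono) auto
      finally show ?thesis by (simp add: algebra_simps)
    qed
    have Q: "\<bar>poly Q z\<bar> \<le> A * \<bar>z\<bar>" unfolding poly_degree_le_1[OF degQ] A_def by (rule lin)
    have "\<bar>coeff P 2 * z\<^sup>2\<bar> \<le> \<bar>poly P z\<bar> + \<bar>coeff P 0 + coeff P 1 * z\<bar>"
      unfolding poly_degree_le_2[OF degP] by linarith
    also have "\<bar>coeff P 0 + coeff P 1 * z\<bar> \<le> B * \<bar>z\<bar>" unfolding B_def by (rule lin)
    also have "\<bar>coeff P 2 * z\<^sup>2\<bar> = c * \<bar>z\<bar> * \<bar>z\<bar>" by (simp add: c_def abs_mult power2_eq_square)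
    finally have "c * \<bar>z\<bar> * \<bar>z\<bar> - B * \<bar>z\<bar> \<le> \<bar>poly P z\<bar>" by simp
    moreover have "2 * B * \<bar>z\<bar> \<le> c * \<bar>z\<bar> * \<bar>z\<bar>" using z2 z1 by (intro mult_right_mono) auto
    ultimately have P: "c * \<bar>z\<bar> * \<bar>z\<bar> / 2 \<le> \<bar>poly P z\<bar>" by linarith
    have pos: "0 < c * \<bar>z\<bar> * \<bar>z\<bar> / 2" using c z1 by simp
    have "\<bar>\<rho> z\<bar> = \<bar>poly Q z\<bar> / \<bar>poly P z\<bar>" by (simp add: \<rho>_def)
    also have "\<dots> \<le> (A * \<bar>z\<bar>) / (c * \<bar>z\<bar> * \<bar>z\<bar> / 2)"
      using Q P pos A0 by (intro frac_le) auto
    also have "\<dots> = (2 * A / c) / \<bar>z\<bar>" using c z1 by (simp add: field_simps)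
    also have "\<dots> \<le> real n / \<bar>z\<bar>" using n by (intro divide_right_mono) auto
    finally show ?thesis .
  qed
  moreover have "M > 0" by (simp add: M_def)
  ultimately show ?thesis using that by blast
qed

text \<open>Here \<open>\<rho> = O(1/z)\<close>, so both ends are finite and are the two zeros \<open>x < y\<close> of \<open>P\<close>. Partial fractions of
\<open>\<rho>\<close> give the exponents, which are positive because \<open>Y\<close> tends to 0 at the ends; division by \<open>P\<close> lowers
them by 1.\<close>
lemma jacobi_case:
  assumes deg: "degree P = 2"
  shows "is_classical"
proof -
  define c where "c = coeff P 2"
  have c: "c \<noteq> 0" using deg P0 leading_coeff_0_iff[of P] by (simp add: c_def)
  obtain n M where M: "M > 0" "\<And>z. \<bar>z\<bar> > M \<Longrightarrow> \<bar>\<rho> z\<bar> \<le> real n / \<bar>z\<bar>" using quadratic_asymptotics[OF deg] by blast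
  have "b \<noteq> \<infinity>"
  proof
    assume "b = \<infinity>"
    then obtain z where z: "z > M" "\<rho> z < - real n / (z - 0)" using infinite_endpoint(1) by blast
    with M(1) M(2)[of z] show False by simp
  qed
  moreover have "a \<noteq> -\<infinity>"
  proof
    assume "a = -\<infinity>"
    then obtain z where z: "z < - M" "\<rho> z > - real n / (z - 0)" using infinite_endpoint(2) by blast
    with M(1) M(2)[of z] show False by simp
  qed
  ultimately obtain x y where xy: "a = ereal x" "b = ereal y" "x < y" using ab by (cases a; cases b) auto
  have I: "I = {x<..<y}" using xy by simp
  have Px: "poly P x = 0" "poly P y = 0" using finite_endpoint_root xy by auto
  have Pz: "poly P z = c * (z - x) * (z - y)" for z
  proof -
    have e: "coeff P 0 + coeff P 1 * x + c * x\<^sup>2 = 0" "coeff P 0 + coeff P 1 * y + c * y\<^sup>2 = 0"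
      using Px unfolding poly_degree_le_2[OF degP] c_def by auto
    then have "(y - x) * (coeff P 1 + c * (x + y)) = 0" by (simp add: power2_eq_square algebra_simps)
    then have p1: "coeff P 1 = - c * (x + y)" using xy(3) by simp
    have p0: "coeff P 0 = c * x * y" using e(1) unfolding p1 by (simp add: power2_eq_square algebra_simps)
    show ?thesis unfolding poly_degree_le_2[OF degP] p0 p1 c_def[symmetric] by (simp add: power2_eq_square algebra_simps)
  qed
  have nz: "poly P z \<noteq> 0" if "z \<in> I" for z using that c by (auto simp: Pz I)
  define \<beta>1 \<beta>2 where "\<beta>1 = poly Q x / (c * (x - y))" and "\<beta>2 = poly Q y / (c * (y - x))"
  have \<rho>: "\<rho> z = \<beta>1 / (z - x) + \<beta>2 / (z - y)" if "z \<in> I" for z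
  proof -
    have "poly Q z * (y - x) = poly Q y * (z - x) - poly Q x * (z - y)"
      unfolding poly_degree_le_1[OF degQ] by (simp add: algebra_simps)
    then have "poly Q z = (poly Q y * (z - x) - poly Q x * (z - y)) / (y - x)" using xy(3) by (simp add: field_simps)
    also have "\<dots> = c * (\<beta>2 * (z - x) + \<beta>1 * (z - y))"
    proof -
      have "c * \<beta>2 = poly Q y / (y - x)" using c by (simp add: \<beta>2_def)
      moreover have "c * \<beta>1 = - poly Q x / (y - x)"
        using c minus_divide_divide[of "poly Q x" "x - y"] by (simp add: \<beta>1_def)
      ultimately show ?thesis by (simp only: distrib_left mult.assoc[symmetric]) (simp add: diff_divide_distrib)
    qed
    finally have "poly Q z = c * (\<beta>2 * (z - x) + \<beta>1 * (z - y))" .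
    moreover have "z - x \<noteq> 0" "z - y \<noteq> 0" using that by (auto simp: I)
    moreover have "c * (\<beta>2 * v + \<beta>1 * w) / (c * v * w) = \<beta>1 / v + \<beta>2 / w" if "v \<noteq> 0" "w \<noteq> 0" for v w
    proof -
      have "c * (\<beta>2 * v + \<beta>1 * w) / (c * v * w) = (\<beta>2 * v + \<beta>1 * w) / (v * w)"
        using c unfolding mult.assoc by (rule mult_divide_mult_cancel_left)
      then show ?thesis using that by (simp add: add_divide_distrib)
    qed
    ultimately show ?thesis unfolding \<rho>_def Pz by simp
  qed
  define E where "E z = (z - x) powr \<beta>1 * (y - z) powr \<beta>2" for z
  have E': "(E has_real_derivative \<rho> z * E z) (at z)" if z: "z \<in> I" for z
  proof -
    have zx: "z - x > 0" and zy: "y - z > 0" using z by (auto simp: I)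
    have 1: "((\<lambda>z. (z - x) powr \<beta>1) has_real_derivative \<beta>1 * (z - x) powr (\<beta>1 - 1) * 1) (at z)"
      by (rule DERIV_chain2[where g="\<lambda>z. z - x", OF has_real_derivative_powr[OF zx]]) (auto intro!: derivative_eq_intros)
    have 2: "((\<lambda>z. (y - z) powr \<beta>2) has_real_derivative \<beta>2 * (y - z) powr (\<beta>2 - 1) * (- 1)) (at z)"
      by (rule DERIV_chain2[where g="\<lambda>z. y - z", OF has_real_derivative_powr[OF zy]]) (auto intro!: derivative_eq_intros)
    have p1: "(z - x) powr (\<beta>1 - 1) = (z - x) powr \<beta>1 / (z - x)" using zx by (simp add: powr_diff)
    have p2: "(y - z) powr (\<beta>2 - 1) = (y - z) powr \<beta>2 / (y - z)" using zy by (simp add: powr_diff)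
    have "\<beta>2 / (z - y) = - (\<beta>2 / (y - z))" using minus_divide_right[of \<beta>2 "y - z"] by simp
    then have r: "\<rho> z = \<beta>1 * (1 / (z - x)) - \<beta>2 * (1 / (y - z))" unfolding \<rho>[OF z] by simp
    show ?thesis unfolding E_def[abs_def]
      by (rule DERIV_cong[OF DERIV_mult[OF 1 2]]) (simp add: p1 p2 r algebra_simps)
  qed
  have E0: "E z \<noteq> 0" if "z \<in> I" for z using that by (simp add: E_def I)
  obtain k where k: "\<And>z. z \<in> I \<Longrightarrow> Y z = k * E z" "k \<noteq> 0"
    using Y_proportional[OF nz E' E0] by blast
  have ev: "eventually (\<lambda>z. z \<in> I) (at_right x)" "eventually (\<lambda>z. z \<in> I) (at_left y)"
    unfolding I using eventually_at_right_real[OF xy(3)] eventually_at_left_real[OF xy(3)] by auto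
  have "\<beta>1 > 0"
  proof (rule positive_exponent[where F="at_right x" and t="\<lambda>z. z - x"])
    show "((\<lambda>z. k * (y - z) powr \<beta>2) \<longlongrightarrow> k * (y - x) powr \<beta>2) (at_right x)"
      using xy(3) by (intro tendsto_intros) auto
    have "((\<lambda>z. z - x) \<longlongrightarrow> x - x) (at_right x)" by (intro tendsto_intros)
    then show "((\<lambda>z. z - x) \<longlongrightarrow> 0) (at_right x)" by simp
    show "eventually (\<lambda>z. 0 < z - x) (at_right x)" using ev(1) by eventually_elim (auto simp: I)
    have "eventually (\<lambda>z. Y z = k * (y - z) powr \<beta>2 * (z - x) powr \<beta>1) (at_right x)"
      using ev(1) by eventually_elim (simp add: k E_def)
    then show "((\<lambda>z. k * (y - z) powr \<beta>2 * (z - x) powr \<beta>1) \<longlongrightarrow> 0) (at_right x)"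
      by (rule Lim_transform_eventually[OF Y_lim_finite(1)[OF xy(1)]])
  qed (use k xy(3) in auto)
  have "\<beta>2 > 0"
  proof (rule positive_exponent[where F="at_left y" and t="\<lambda>z. y - z"])
    show "((\<lambda>z. k * (z - x) powr \<beta>1) \<longlongrightarrow> k * (y - x) powr \<beta>1) (at_left y)"
      using xy(3) by (intro tendsto_intros) auto
    have "((\<lambda>z. y - z) \<longlongrightarrow> y - y) (at_left y)" by (intro tendsto_intros)
    then show "((\<lambda>z. y - z) \<longlongrightarrow> 0) (at_left y)" by simp
    show "eventually (\<lambda>z. 0 < y - z) (at_left y)" using ev(2) by eventually_elim (auto simp: I)
    have "eventually (\<lambda>z. Y z = k * (z - x) powr \<beta>1 * (y - z) powr \<beta>2) (at_left y)"
      using ev(2) by eventually_elim (simp add: k E_def)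
    then show "((\<lambda>z. k * (z - x) powr \<beta>1 * (y - z) powr \<beta>2) \<longlongrightarrow> 0) (at_left y)"
      by (rule Lim_transform_eventually[OF Y_lim_finite(2)[OF xy(2)]])
  qed (use k xy(3) in auto)
  \<comment> \<open>\<open>u\<close> is the affine map from \<open>(x, y)\<close> onto \<open>(-1, 1)\<close>.\<close>
  define h where "h = (y - x) / 2"
  have h: "h > 0" using xy(3) by (simp add: h_def)
  define u where "u z = (1 / h) * z + - (x + y) / (2 * h)" for z
  have up: "z - x = h * (1 + u z)" and um: "y - z = h * (1 - u z)" for z
  proof -
    have "h * u z = z - (x + y) / 2" using h by (simp add: u_def field_simps)
    then have "h * (1 + u z) = h + (z - (x + y) / 2)" "h * (1 - u z) = h - (z - (x + y) / 2)"
      by (simp_all only: distrib_left right_diff_distrib mult_1_right)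
    then show "z - x = h * (1 + u z)" "y - z = h * (1 - u z)" by (simp_all add: h_def field_simps)
  qed
  define C where "C = - k / c * h powr (\<beta>2 - 1) * h powr (\<beta>1 - 1)"
  have uI: "- 1 < u z \<and> u z < 1" if "z \<in> I" for z
  proof -
    have "0 < h * (1 + u z)" "0 < h * (1 - u z)" using that unfolding up[symmetric] um[symmetric] by (auto simp: I)
    then show ?thesis using h by (simp add: zero_less_mult_iff)
  qed
  have w: "W z * (poly \<eta> z)\<^sup>2 = C * ((1 - u z) powr (\<beta>2 - 1) * (1 + u z) powr (\<beta>1 - 1))" if z: "z \<in> I" for z
  proof -
    have zx: "z - x > 0" and zy: "y - z > 0" using z by (auto simp: I)
    have p1: "(z - x) powr \<beta>1 = (z - x) powr (\<beta>1 - 1) * (z - x)" using zx by (simp add: powr_diff)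
    have p2: "(y - z) powr \<beta>2 = (y - z) powr (\<beta>2 - 1) * (y - z)" using zy by (simp add: powr_diff)
    have "W z * (poly \<eta> z)\<^sup>2 = k * ((z - x) powr \<beta>1 * (y - z) powr \<beta>2) / (c * (z - x) * (z - y))"
      using Y_over_P[OF z nz[OF z]] k(1)[OF z] by (simp add: E_def Pz)
    also have "\<dots> = k * ((z - x) powr (\<beta>1 - 1) * (y - z) powr (\<beta>2 - 1)) * ((z - x) * (y - z) / (c * (z - x) * (z - y)))"
      unfolding p1 p2 by (simp only: times_divide_eq_right ac_simps)
    also have "(z - x) * (y - z) / (c * (z - x) * (z - y)) = - 1 / c"
    proof -
      have e: "(z - x) * (y - z) = (- 1 / c) * (c * (z - x) * (z - y))" using c by (simp add: algebra_simps)
      have nz': "c * (z - x) * (z - y) \<noteq> 0" using zx zy c by simp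
      show ?thesis by (rule nonzero_divide_eq_eq[OF nz', THEN iffD2, OF e])
    qed
    also have "(z - x) powr (\<beta>1 - 1) = h powr (\<beta>1 - 1) * (1 + u z) powr (\<beta>1 - 1)"
      unfolding up by (rule powr_mult)
    also have "(y - z) powr (\<beta>2 - 1) = h powr (\<beta>2 - 1) * (1 - u z) powr (\<beta>2 - 1)"
      unfolding um by (rule powr_mult)
    finally show ?thesis by (simp add: C_def)
  qed
  have w0: "(1 - u z) powr (\<beta>2 - 1) * (1 + u z) powr (\<beta>1 - 1) > 0" if "z \<in> I" for z using uI[OF that] by simp
  have "C > 0" by (rule positive_constant[OF nz w w0])
  moreover have "standard_classical_weight {-1<..<1} (\<lambda>x. (1 - x) powr (\<beta>2 - 1) * (1 + x) powr (\<beta>1 - 1))"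
    unfolding standard_classical_weight_def
    by (rule disjI2, rule disjI2, rule exI[of _ "\<beta>2 - 1"], rule conjI, simp add: \<open>\<beta>2 > 0\<close>,
        rule exI[of _ "\<beta>1 - 1"], simp add: \<open>\<beta>1 > 0\<close>)
  moreover have "I = {z. u z \<in> {-1<..<1}}"
  proof (intro set_eqI iffI)
    fix z assume "z \<in> {z. u z \<in> {-1<..<1}}"
    then have "0 < h * (1 + u z)" "0 < h * (1 - u z)" using h by auto
    then show "z \<in> I" unfolding up[symmetric] um[symmetric] by (simp add: I)
  qed (use uI in auto)
  ultimately have "classical_weight I (\<lambda>z. W z * (poly \<eta> z)\<^sup>2)"
    unfolding classical_weight_def u_def using w h
    by (intro exI[of _ "{-1<..<1}"] exI[of _ "\<lambda>x. (1 - x) powr (\<beta>2 - 1) * (1 + x) powr (\<beta>1 - 1)"]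
        exI[of _ "1 / h"] exI[of _ "- (x + y) / (2 * h)"] exI[of _ C]) (auto simp: u_def)
  with nz show ?thesis by blast
qed

lemma weight_is_classical: "is_classical"
proof -
  consider "degree P = 0" | "degree P = 1" | "degree P = 2" using degP by linarith
  then show ?thesis by cases (fact hermite_case laguerre_case jacobi_case)+
qed

lemma log_weight_deriv:
  assumes nz: "\<And>z. z \<in> I \<Longrightarrow> poly P z \<noteq> 0" and z: "z \<in> I"
  shows "((\<lambda>z. ln (W z * (poly \<eta> z)\<^sup>2)) has_real_derivative poly (Q - pderiv P) z / poly P z) (at z)"
proof -
  have \<eta>z: "poly \<eta> z \<noteq> 0" by (rule eta_nonzero[OF z nz[OF z]])
  have w0: "W z * (poly \<eta> z)\<^sup>2 > 0" using pos[OF z] \<eta>z by simp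
  have "((\<lambda>z. Y z / poly P z) has_real_derivative (\<rho> z * Y z * poly P z - Y z * poly (pderiv P) z) / (poly P z * poly P z)) (at z)"
    by (rule DERIV_divide[OF Y_deriv[OF z nz[OF z] \<eta>z] poly_DERIV nz[OF z]])
  then have "((\<lambda>z. W z * (poly \<eta> z)\<^sup>2) has_real_derivative (\<rho> z * Y z * poly P z - Y z * poly (pderiv P) z) / (poly P z * poly P z)) (at z)"
    by (rule has_field_derivative_transform_within_open[OF _ open_einterval z]) (simp add: Y_over_P nz)
  moreover have "(\<rho> z * Y z * poly P z - Y z * poly (pderiv P) z) / (poly P z * poly P z)
      = (poly (Q - pderiv P) z / poly P z) * (W z * (poly \<eta> z)\<^sup>2)"
    using nz[OF z] unfolding \<rho>_def Y_over_P[OF z nz[OF z]] by (simp add: algebra_simps diff_divide_distrib)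
  ultimately have d: "((\<lambda>z. W z * (poly \<eta> z)\<^sup>2) has_real_derivative (poly (Q - pderiv P) z / poly P z) * (W z * (poly \<eta> z)\<^sup>2)) (at z)"
    by simp
  show ?thesis
    by (rule DERIV_cong[OF DERIV_chain2[OF DERIV_ln_divide[OF w0] d]]) (use pos[OF z] \<eta>z in simp)
qed

text \<open>The hypothesis \<open>eq\<close> is what remains of \<open>(T - \<mu>) f = g\<close> and \<open>(T - \<mu>) g = 0\<close> after eliminating \<open>\<mu>\<close> and \<open>r\<close>
and clearing denominators. By it the function \<open>H = P W (f' g - f g')\<close> has derivative \<open>W g\<^sup>2 \<ge> 0\<close>;
being monotone with limit 0 at both ends, it vanishes identically.\<close>
lemma no_generalized_eigenpolynomial:
  assumes nz: "\<And>z. z \<in> I \<Longrightarrow> poly P z \<noteq> 0"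
    and eq: "\<eta> * P * (pderiv (pderiv f) * g - f * pderiv (pderiv g))
      + (\<eta> * Q - 2 * P * pderiv \<eta>) * (pderiv f * g - f * pderiv g) = \<eta> * g * g"
  shows "g = 0"
proof -
  define h where "h = pderiv f * g - f * pderiv g"
  have h': "pderiv h = pderiv (pderiv f) * g - f * pderiv (pderiv g)"
    by (simp add: h_def pderiv_diff pderiv_mult algebra_simps)
  have eq': "\<eta> * P * pderiv h + (\<eta> * Q - 2 * P * pderiv \<eta>) * h = \<eta> * g * g"
    unfolding h' using eq by (simp only: h_def)
  define H where "H = (\<lambda>z. poly h z * poly P z * W z)"
  have H': "(H has_real_derivative W z * (poly g z)\<^sup>2) (at z)" if z: "z \<in> I" for z
  proof -
    have \<eta>z: "poly \<eta> z \<noteq> 0" by (rule eta_nonzero[OF z nz[OF z]])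
    have "poly \<eta> z * (poly P z * poly (pderiv h) z + (poly Q z - 2 * poly P z * poly (pderiv \<eta>) z / poly \<eta> z) * poly h z)
        = poly (\<eta> * P * pderiv h + (\<eta> * Q - 2 * P * pderiv \<eta>) * h) z"
      using \<eta>z by (simp add: distrib_left distrib_right right_diff_distrib left_diff_distrib)
    also have "\<dots> = poly \<eta> z * (poly g z)\<^sup>2"
      unfolding eq' by (simp add: power2_eq_square)
    finally have key: "poly P z * poly (pderiv h) z + (poly Q z - 2 * poly P z * poly (pderiv \<eta>) z / poly \<eta> z) * poly h z = (poly g z)\<^sup>2"
      using \<eta>z by simp
    have "((\<lambda>z. poly h z * (poly P z * W z)) has_real_derivative
        poly (pderiv h) z * (poly P z * W z) + W z * (poly Q z - 2 * poly P z * poly (pderiv \<eta>) z / poly \<eta> z) * poly h z) (at z)"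
      by (rule DERIV_mult[OF poly_DERIV ode[OF z nz[OF z] \<eta>z]])
    moreover have "poly (pderiv h) z * (poly P z * W z) + W z * (poly Q z - 2 * poly P z * poly (pderiv \<eta>) z / poly \<eta> z) * poly h z
        = W z * (poly P z * poly (pderiv h) z + (poly Q z - 2 * poly P z * poly (pderiv \<eta>) z / poly \<eta> z) * poly h z)"
      by (simp only: distrib_left ac_simps)
    ultimately show ?thesis unfolding H_def key by (simp add: mult.assoc)
  qed
  have mono: "H x \<le> H y" if "x \<in> I" "y \<in> I" "x \<le> y" for x y
  proof (rule DERIV_nonneg_imp_nondecreasing[OF that(3)])
    fix z assume "x \<le> z" "z \<le> y"
    then have z: "z \<in> I" using that convex_I by (meson is_interval_1 is_interval_convex_1)
    then show "\<exists>d. (H has_real_derivative d) (at z) \<and> 0 \<le> d" using H'[OF z] pos[OF z] by (auto intro!: exI)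
  qed
  have zero: "H x = 0" if x: "x \<in> I" for x
  proof (rule antisym)
    have xab: "a < ereal x" "ereal x < b" using x by (auto simp: einterval_def)
    show "H x \<le> 0"
    proof (rule tendsto_lowerbound)
      show "((H \<circ> real_of_ereal) \<longlongrightarrow> 0) (at_left b)" unfolding H_def by (rule lim_b)
      show "eventually (\<lambda>e. H x \<le> (H \<circ> real_of_ereal) e) (at_left b)"
        unfolding eventually_at_left[OF xab(2)]
      proof (intro exI[of _ "ereal x"] conjI allI impI)
        fix e assume e: "ereal x < e" "e < b"
        then obtain r where r: "e = ereal r" by (cases e) auto
        then have "r \<in> I" "x \<le> r"
          using e xab order.strict_trans[OF xab(1) e(1)] by (auto simp: einterval_def)
        then show "H x \<le> (H \<circ> real_of_ereal) e" using mono[OF x] r by simp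
      qed (rule xab)
      show "at_left b \<noteq> bot" using ab by (intro at_left_ereal_nontrivial) (auto intro: order.strict_trans1[of _ a])
    qed
    show "0 \<le> H x"
    proof (rule tendsto_upperbound)
      show "((H \<circ> real_of_ereal) \<longlongrightarrow> 0) (at_right a)" unfolding H_def by (rule lim_a)
      show "eventually (\<lambda>e. (H \<circ> real_of_ereal) e \<le> H x) (at_right a)"
        unfolding eventually_at_right[OF xab(1)]
      proof (intro exI[of _ "ereal x"] conjI allI impI)
        fix e assume e: "a < e" "e < ereal x"
        then obtain r where r: "e = ereal r" by (cases e) auto
        then have "r \<in> I" "r \<le> x"
          using e xab order.strict_trans[OF e(2) xab(2)] by (auto simp: einterval_def)
        then show "(H \<circ> real_of_ereal) e \<le> H x" using mono[OF _ x] r by simp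
      qed (rule xab)
      show "at_right a \<noteq> bot" using ab by (intro at_right_ereal_nontrivial) (auto intro: order.strict_trans2[of _ b])
    qed
  qed
  have g0: "poly g z = 0" if z: "z \<in> I" for z
  proof -
    have "((\<lambda>z. 0) has_real_derivative W z * (poly g z)\<^sup>2) (at z)"
      using H'[OF z] by (rule has_field_derivative_transform_within_open[OF _ open_einterval z]) (simp add: zero)
    then have "W z * (poly g z)\<^sup>2 = 0" using DERIV_unique DERIV_const by blast
    then show ?thesis using pos[OF z] by simp
  qed
  show "g = 0"
  proof (rule ccontr)
    assume "g \<noteq> 0"
    then have "finite {z. poly g z = 0}" by (rule poly_roots_finite)
    then have "finite I" by (rule rev_finite_subset) (use g0 in auto)
    then have "I = {}" using open_einterval[of a b] by (simp add: finite_imp_not_open)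
    then show False using einterval_nonempty[OF ab] by blast
  qed
qed

end

section \<open>From rational coefficients to polynomials\<close>
lemma fract_quotient_reduced:
  fixes N E :: "real poly"
  assumes E: "E \<noteq> 0"
  shows "rat_poles (to_fract N / to_fract E) \<subseteq> {z. poly E z = 0}"
    and "poly E z \<noteq> 0 \<Longrightarrow> rat_eval (to_fract N / to_fract E) z = poly N z / poly E z"
proof -
  let ?x = "to_fract N / to_fract E"
  define n d where "n = fst (quot_of_fract ?x)" and "d = snd (quot_of_fract ?x)"
  have d0: "d \<noteq> 0" by (simp add: d_def)
  have "to_fract n / to_fract d = ?x"
    unfolding n_def d_def Fract_conv_to_fract[symmetric] by (rule Fract_quot_of_fract)
  then have "to_fract (n * E) = to_fract (N * d)" using E d0 by (simp add: field_simps)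
  then have eq: "n * E = N * d" by (simp only: to_fract_eq_iff)
  have "coprime d n" unfolding n_def d_def using coprime_quot_of_fract[of ?x] by (simp add: coprime_commute)
  moreover have "d dvd n * E" using eq by simp
  ultimately have dE: "d dvd E" by (simp add: coprime_dvd_mult_right_iff)
  then show "rat_poles ?x \<subseteq> {z. poly E z = 0}"
    unfolding rat_poles_def d_def[symmetric] by (auto elim!: dvdE)
  show "rat_eval ?x z = poly N z / poly E z" if z: "poly E z \<noteq> 0"
  proof -
    have "poly d z \<noteq> 0" using z dE by (auto elim!: dvdE)
    moreover have "poly n z * poly E z = poly N z * poly d z" using arg_cong[OF eq, of "\<lambda>p. poly p z"] by simp
    ultimately show ?thesis using z unfolding rat_eval_def n_def[symmetric] d_def[symmetric] by (simp add: field_simps)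
  qed
qed

lemma rat_to_fract: "rat_eval (to_fract P) z = poly P z" "rat_zeros (to_fract P) = {z. poly P z = 0}"
  "rat_poles (to_fract P) = {}"
  by (simp_all add: rat_eval_def rat_zeros_def rat_poles_def)

text \<open>The zeros and poles of the coefficients form a finite set, so a point outside has a neighbourhood
on which the formula for the weight holds with a single constant.\<close>
lemma associated_weight_ode:
  assumes aw: "associated_weight (to_fract P) (to_fract N / to_fract \<eta>) (einterval a b) W"
    and P: "P \<noteq> 0" and \<eta>: "\<eta> \<noteq> 0"
    and z: "z \<in> einterval a b" "poly P z \<noteq> 0" "poly \<eta> z \<noteq> 0"
  shows "((\<lambda>z. poly P z * W z) has_real_derivative W z * (poly N z / poly \<eta> z)) (at z)"
proof -
  define G where "G = einterval a b - ({z. poly P z = 0} \<union> {z. poly \<eta> z = 0})"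
  have "open G" unfolding G_def
    by (intro open_Diff open_einterval finite_imp_closed) (simp add: poly_roots_finite P \<eta>)
  moreover have "z \<in> G" using z by (simp add: G_def)
  ultimately obtain e where e: "e > 0" "ball z e \<subseteq> G" using open_contains_ball by blast
  have sub: "{z - e<..<z + e} \<subseteq> G" using e by (auto simp: ball_def dist_real_def subset_eq)
  have "{z - e<..<z + e} \<subseteq> einterval a b \<and>
      {z - e<..<z + e} \<inter> (rat_zeros (to_fract P) \<union> rat_poles (to_fract P) \<union> rat_poles (to_fract N / to_fract \<eta>)) = {}"
    using sub fract_quotient_reduced(1)[OF \<eta>, of N] unfolding rat_to_fract G_def by blast
  then obtain c R where R: "c \<noteq> 0"
    "\<And>x. x \<in> {z - e<..<z + e} \<Longrightarrow> (R has_real_derivative rat_eval (to_fract N / to_fract \<eta>) x / rat_eval (to_fract P) x) (at x)"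
    "\<And>x. x \<in> {z - e<..<z + e} \<Longrightarrow> W x = c * (1 / rat_eval (to_fract P) x * exp (R x))"
    using aw unfolding associated_weight_def by blast
  have zin: "z \<in> {z - e<..<z + e}" using e by simp
  have PW: "poly P x * W x = c * exp (R x)" if "x \<in> {z - e<..<z + e}" for x
    using R(3)[OF that] sub that by (auto simp: rat_to_fract G_def)
  have "((\<lambda>x. c * exp (R x)) has_real_derivative c * (exp (R z) * (poly N z / poly \<eta> z / poly P z))) (at z)"
    using R(2)[OF zin] fract_quotient_reduced(2)[OF \<eta> z(3), of N]
    by (auto intro!: derivative_eq_intros simp: rat_to_fract)
  then have "((\<lambda>x. poly P x * W x) has_real_derivative c * (exp (R z) * (poly N z / poly \<eta> z / poly P z))) (at z)"
    by (rule has_field_derivative_transform_within_open[OF _ _ zin]) (auto simp: PW)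
  moreover have "c * (exp (R z) * (poly N z / poly \<eta> z / poly P z)) = W z * (poly N z / poly \<eta> z)"
  proof -
    have "W z = c * exp (R z) / poly P z" using PW[OF zin] z(2) by (simp add: nonzero_eq_divide_eq mult.commute)
    then show ?thesis by (simp add: ac_simps)
  qed
  ultimately show ?thesis by simp
qed

lemma common_denominator:
  fixes p q r :: "real poly fract"
  obtains A B C D where "D \<noteq> 0" "p = to_fract A / to_fract D" "q = to_fract B / to_fract D" "r = to_fract C / to_fract D"
proof -
  define dp dq dr where "dp = snd (quot_of_fract p)" and "dq = snd (quot_of_fract q)" and "dr = snd (quot_of_fract r)"
  have nz: "dp \<noteq> 0" "dq \<noteq> 0" "dr \<noteq> 0" by (simp_all add: dp_def dq_def dr_def)
  have x: "to_fract (fst (quot_of_fract x)) / to_fract (snd (quot_of_fract x)) = x" for x :: "real poly fract"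
    unfolding Fract_conv_to_fract[symmetric] by (rule Fract_quot_of_fract)
  show ?thesis
  proof (rule that)
    show "dp * dq * dr \<noteq> 0" using nz by simp
    show "p = to_fract (fst (quot_of_fract p) * dq * dr) / to_fract (dp * dq * dr)"
      using x[of p] nz by (simp add: dp_def[symmetric])
    show "q = to_fract (fst (quot_of_fract q) * dp * dr) / to_fract (dp * dq * dr)"
      using x[of q] nz by (simp add: dq_def[symmetric])
    show "r = to_fract (fst (quot_of_fract r) * dp * dq) / to_fract (dp * dq * dr)"
      using x[of r] nz by (simp add: dr_def[symmetric])
  qed
qed

lemma eigenpoly_cleared:
  assumes "D \<noteq> 0"
  shows "eigenpoly (to_fract A / to_fract D) (to_fract B / to_fract D) (to_fract C / to_fract D) f \<longleftrightarrow>
    f \<noteq> 0 \<and> (\<exists>\<mu>. A * pderiv (pderiv f) + B * pderiv f + C * f = D * smult \<mu> f)"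
proof -
  have "diff_op (to_fract A / to_fract D) (to_fract B / to_fract D) (to_fract C / to_fract D) f
      = to_fract (A * pderiv (pderiv f) + B * pderiv f + C * f) / to_fract D"
    by (simp add: diff_op_def add_divide_distrib)
  moreover have "to_fract X / to_fract D = to_fract Z \<longleftrightarrow> X = D * Z" for X Z
  proof -
    have "to_fract X / to_fract D = to_fract Z \<longleftrightarrow> to_fract X = to_fract (D * Z)"
      using assms by (auto simp: field_simps)
    then show ?thesis by (simp only: to_fract_eq_iff)
  qed
  ultimately show ?thesis by (simp only: eigenpoly_def)
qed

section \<open>The form of the orthogonality weight\<close>
theorem proposition7p5:
  fixes K :: "nat set" and m :: nat and y :: "nat \<Rightarrow> real poly"
    and p q r :: "real poly fract" and a b :: ereal and W :: "real \<Rightarrow> real"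
  assumes "SL_OPS K y p q r a b W" and "card K = m"
  shows "\<exists>(P :: real poly) (s :: real poly) (\<eta> :: real poly) (W\<^sub>B :: real \<Rightarrow> real) (S :: real \<Rightarrow> real).
           p = to_fract P \<and> degree P \<le> 2 \<and> degree s \<le> 1 \<and> degree \<eta> = m \<and> \<eta> \<noteq> 0 \<and>
           (\<forall>z\<in>einterval a b. poly P z \<noteq> 0 \<and>
              (S has_real_derivative poly s z / poly P z) (at z) \<and> W\<^sub>B z = exp (S z)) \<and>
           classical_weight (einterval a b) W\<^sub>B \<and>
           (\<forall>z\<in>einterval a b. poly \<eta> z \<noteq> 0 \<and> W z = W\<^sub>B z / (poly \<eta> z)\<^sup>2)"
proof -
  let ?I = "einterval a b"
  from assms(1) have K: "finite K" and dy: "\<And>k. k \<notin> K \<Longrightarrow> degree (y k) = k" and p0: "p \<noteq> 0"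
    and ey: "\<And>k. k \<notin> K \<Longrightarrow> eigenpoly p q r (y k)"
    and ne: "\<And>f. degree f \<in> K \<Longrightarrow> \<not> eigenpoly p q r f"
    and ab: "a < b" and aw: "associated_weight p q ?I W" and pos: "\<And>z. z \<in> ?I \<Longrightarrow> W z > 0"
    and la: "\<And>f. (((\<lambda>z. poly f z * rat_eval p z * W z) \<circ> real_of_ereal) \<longlongrightarrow> 0) (at_right a)"
    and lb: "\<And>f. (((\<lambda>z. poly f z * rat_eval p z * W z) \<circ> real_of_ereal) \<longlongrightarrow> 0) (at_left b)"
    by (auto simp: SL_OPS_def)
  obtain A B C D where D: "D \<noteq> 0" and p: "p = to_fract A / to_fract D"
    and q: "q = to_fract B / to_fract D" and r: "r = to_fract C / to_fract D"
    by (rule common_denominator[of p q r])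
  have A: "A \<noteq> 0" using p p0 by auto
  note eig = eigenpoly_cleared[OF D, of A B C, folded p q r]
  define U where "U = inv_space (cpoly A) (cpoly B) (cpoly C) (cpoly D)"
  have lift: "\<exists>\<mu>. poly_op (cpoly A) (cpoly B) (cpoly C) (cpoly (y k)) = cpoly D * smult \<mu> (cpoly (y k)) \<and> y k \<noteq> 0"
    if k: "k \<notin> K" for k
  proof -
    obtain \<mu> where \<mu>: "y k \<noteq> 0" "A * pderiv (pderiv (y k)) + B * pderiv (y k) + C * y k = D * smult \<mu> (y k)"
      using ey[OF k] unfolding eig by blast
    from arg_cong[OF \<mu>(2), of cpoly] show ?thesis using \<mu>(1)
      by (intro exI[of _ "complex_of_real \<mu>"]) (simp only: poly_op_def cpoly_add cpoly_mult cpoly_pderiv cpoly_smult simp_thms)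
  qed
  \<comment> \<open>The eigenpolynomials lie in the largest invariant space.\<close>
  have sub: "- degrees U \<subseteq> K"
  proof
    fix k assume k: "k \<in> - degrees U"
    show "k \<in> K"
    proof (rule ccontr)
      assume "k \<notin> K"
      with lift[of k] have "cpoly (y k) \<in> U" "y k \<noteq> 0" unfolding U_def by (auto intro: inv_space_eigen)
      then have "degree (cpoly (y k)) \<in> degrees U" unfolding degrees_def by (intro imageI) auto
      then show False using k dy[OF \<open>k \<notin> K\<close>] by simp
    qed
  qed
  then have fin: "finite (- degrees U)" using K by (rule finite_subset)
  obtain P Q \<eta> where AP: "A = D * P" and \<eta>0: "\<eta> \<noteq> 0"
    and BQ: "B * \<eta> + 2 * A * pderiv \<eta> = D * \<eta> * Q" and deg\<eta>: "degree \<eta> = card (- degrees U)"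
    by (rule real_denominator_structure[OF A D fin[unfolded U_def]]) (rule that[unfolded U_def])
  have P0: "P \<noteq> 0" using A AP by auto
  have bounds: "degree A \<le> degree D + 2 \<and> degree B \<le> degree D + 1 \<and> degree C \<le> degree D"
  proof -
    have "degree (cpoly A) \<le> degree (cpoly D) + 2 \<and> degree (cpoly B) \<le> degree (cpoly D) + 1 \<and> degree (cpoly C) \<le> degree (cpoly D)"
    proof (rule coefficient_degree_bounds[where S="- K"])
      show "infinite (- K)" using K by (simp add: finite_compl)
      fix k assume "k \<in> - K"
      then show "\<exists>f \<mu>. f \<noteq> 0 \<and> degree f = k \<and> poly_op (cpoly A) (cpoly B) (cpoly C) f = cpoly D * smult \<mu> f"
        using lift[of k] dy[of k] by (intro exI[of _ "cpoly (y k)"]) auto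
    qed (use D in simp)
    then show ?thesis by simp
  qed
  have degP: "degree P \<le> 2" using bounds D P0 unfolding AP by (simp add: degree_mult_eq)
  have degQ: "degree Q \<le> 1"
  proof (cases "Q = 0")
    case False
    have "degree (2 * A * pderiv \<eta>) \<le> degree D + degree \<eta> + 1"
    proof (cases "degree \<eta> = 0")
      case True
      then have "pderiv \<eta> = 0" by (simp add: pderiv_eq_0_iff)
      then show ?thesis by simp
    next
      case False
      have "degree (2 * A * pderiv \<eta>) \<le> degree (2 * A) + degree (pderiv \<eta>)" by (rule degree_mult_le)
      also have "degree (2 * A) \<le> degree A" by (metis degree_smult_le numeral_mult_conv_smult)
      also have "degree (pderiv \<eta>) = degree \<eta> - 1" by (rule degree_pderiv)
      finally show ?thesis using bounds False by linarith
    qed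
    moreover have "degree (B * \<eta>) \<le> degree D + degree \<eta> + 1" using degree_mult_le[of B \<eta>] bounds by linarith
    ultimately have "degree (B * \<eta> + 2 * A * pderiv \<eta>) \<le> degree D + degree \<eta> + 1" by (rule degree_add_le[rotated])
    moreover have "degree (D * \<eta> * Q) = degree D + degree \<eta> + degree Q"
      using D \<eta>0 False by (simp add: degree_mult_eq)
    ultimately show ?thesis unfolding BQ by simp
  qed simp
  define N where "N = \<eta> * Q - 2 * P * pderiv \<eta>"
  have BN: "B * \<eta> = D * N" using BQ unfolding N_def AP by (simp add: algebra_simps eq_diff_eq)
  have pP: "p = to_fract P" unfolding p AP using D by simp
  have "to_fract B * to_fract \<eta> = to_fract D * to_fract N" using BN by (simp flip: to_fract_mult)
  then have qN: "q = to_fract N / to_fract \<eta>" unfolding q using D \<eta>0 by (simp add: field_simps)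
  interpret pearson P Q \<eta> W a b
  proof
    show "P \<noteq> 0" "\<eta> \<noteq> 0" "degree P \<le> 2" "degree Q \<le> 1" "a < b" by fact+
    show "continuous_on ?I W" using aw by (simp add: associated_weight_def)
    show "W z > 0" if "z \<in> ?I" for z by (rule pos[OF that])
    show "((\<lambda>z. poly P z * W z) has_real_derivative
        W z * (poly Q z - 2 * poly P z * poly (pderiv \<eta>) z / poly \<eta> z)) (at z)"
      if z: "z \<in> ?I" "poly P z \<noteq> 0" "poly \<eta> z \<noteq> 0" for z
    proof -
      have "poly N z / poly \<eta> z = poly Q z - 2 * poly P z * poly (pderiv \<eta>) z / poly \<eta> z"
        using z(3) by (simp add: N_def diff_divide_distrib)
      then show ?thesis using associated_weight_ode[OF aw[unfolded pP qN] P0 \<eta>0 z] by simp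
    qed
    show "(((\<lambda>z. poly f z * poly P z * W z) \<circ> real_of_ereal) \<longlongrightarrow> 0) (at_right a)"
      "(((\<lambda>z. poly f z * poly P z * W z) \<circ> real_of_ereal) \<longlongrightarrow> 0) (at_left b)" for f
      using la[of f] lb[of f] by (simp_all add: pP rat_to_fract)
  qed
  have nz: "poly P z \<noteq> 0" if "z \<in> ?I" for z using weight_is_classical that by blast
  have \<eta>nz: "poly \<eta> z \<noteq> 0" if "z \<in> ?I" for z by (rule eta_nonzero[OF that nz[OF that]])
  have "K \<subseteq> - degrees U"
  proof
    fix k assume k: "k \<in> K"
    have "k \<notin> degrees U"
    proof
      assume "k \<in> degrees U"
      then have "\<exists>e \<mu>. e \<noteq> 0 \<and> degree e = k \<and> A * pderiv (pderiv e) + B * pderiv e + C * e = D * smult \<mu> e"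
        unfolding U_def
      proof (rule real_eigen_in_every_degree[rotated -1])
        fix \<mu> f g
        assume 1: "A * pderiv (pderiv f) + B * pderiv f + C * f = D * (smult \<mu> f + g)"
          and 2: "A * pderiv (pderiv g) + B * pderiv g + C * g = D * smult \<mu> g"
        \<comment> \<open>Cross-multiplication eliminates \<open>C\<close> and \<open>\<mu>\<close>; then \<open>D\<close> cancels.\<close>
        have "A * (pderiv (pderiv f) * g - f * pderiv (pderiv g)) + B * (pderiv f * g - f * pderiv g)
            = (A * pderiv (pderiv f) + B * pderiv f + C * f) * g - f * (A * pderiv (pderiv g) + B * pderiv g + C * g)"
          by (simp add: algebra_simps)
        also have "\<dots> = D * (g * g)" unfolding 1 2 by (simp add: algebra_simps)
        finally have 3: "A * (pderiv (pderiv f) * g - f * pderiv (pderiv g)) + B * (pderiv f * g - f * pderiv g) = D * (g * g)" .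
        have "D * (\<eta> * P * (pderiv (pderiv f) * g - f * pderiv (pderiv g)) + N * (pderiv f * g - f * pderiv g))
            = \<eta> * (A * (pderiv (pderiv f) * g - f * pderiv (pderiv g))) + (D * N) * (pderiv f * g - f * pderiv g)"
          unfolding AP by (simp only: distrib_left ac_simps)
        also have "\<dots> = \<eta> * (A * (pderiv (pderiv f) * g - f * pderiv (pderiv g)) + B * (pderiv f * g - f * pderiv g))"
          unfolding BN[symmetric] by (simp only: distrib_left ac_simps)
        also have "\<dots> = D * (\<eta> * g * g)" unfolding 3 by (simp only: ac_simps)
        finally have "\<eta> * P * (pderiv (pderiv f) * g - f * pderiv (pderiv g)) + N * (pderiv f * g - f * pderiv g) = \<eta> * g * g"
          using D by (simp only: mult_cancel_left simp_thms)
        then show "g = 0" unfolding N_def by (rule no_generalized_eigenpolynomial[rotated]) (rule nz)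
      qed (use D bounds in auto)
      then show False using ne k unfolding eig by blast
    qed
    then show "k \<in> - degrees U" by simp
  qed
  with sub have "degree \<eta> = m" using deg\<eta> assms(2) by (simp add: subset_antisym)
  moreover have "degree (Q - pderiv P) \<le> 1"
    using degQ degP degree_pderiv[of P] by (intro degree_diff_le) auto
  moreover have "W z * (poly \<eta> z)\<^sup>2 = exp (ln (W z * (poly \<eta> z)\<^sup>2))" if "z \<in> ?I" for z
    using pos[OF that] \<eta>nz[OF that] by simp
  moreover have "W z = W z * (poly \<eta> z)\<^sup>2 / (poly \<eta> z)\<^sup>2" if "z \<in> ?I" for z
    using \<eta>nz[OF that] by simp
  ultimately show ?thesis
    using pP degP \<eta>0 nz \<eta>nz weight_is_classical log_weight_deriv[OF nz]
    by (intro exI[of _ P] exI[of _ "Q - pderiv P"] exI[of _ \<eta>] exI[of _ "\<lambda>z. W z * (poly \<eta> z)\<^sup>2"]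
        exI[of _ "\<lambda>z. ln (W z * (poly \<eta> z)\<^sup>2)"]) blast
qed

end
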